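(* Let $\{X_i, i\in\mathbb{Z}\}$ be a stationary sequence of standard (mean 0, variance 1) Gaussian random variables (a stationary Gaussian sequence) with covariance function $r_n=E(X_1X_{n+1})$. For $\beta>0$ let $$\Upsilon(X)=\min\{i\in\mathbb{Z}: X_i>-\beta i\},\qquad \tau(X)=\max\{i\ge0: X_i>\beta i\},$$ and let $$a(\beta)=\sqrt{2\left(\ln\beta^{-1}-\ln\left(2\ln\beta^{-1}\right)+\ln\left((2\pi)^{-1/2}\right)\right)}.$$ 1) If $r_n\ln n\to0$ as $n\to\infty$, then for any $x,y\in\mathbb{R}$ $$\lim_{\beta\to0}P\left(\Upsilon(X)\geq -u_{\beta}(x),\ \tau(X)\leq u_{\beta}(y)\right)=\exp\left(-(e^{-x}+e^{-y})\right),$$ where $u_\beta(x)=\left(a(\beta)+\dfrac{x}{a(\beta)}\right)\beta^{-1}$. 2) If $r_n\ln n\to\gamma>0$ as $n\to\infty$, then for any $x,y\in\mathbb{R}$ $$\lim_{\beta\to0}P\left(\Upsilon(X)\geq -u_{\beta}(x),\ \tau(X)\leq u_{\beta}(y)\right)=\int_{\mathbb{R}}\exp\left(-\big(e^{-\sqrt{2\gamma}(x-z)}+e^{-\sqrt{2\gamma}(y-z)}\big)\right)d\Phi(z),$$ where $\rho_\beta=\gamma/|\ln\beta|$, $u_{\beta}(x)=\left(\sqrt{1-\rho_\beta}\;a\big(\beta/\sqrt{1-\rho_\beta}\big)+\sqrt{\rho_{\beta}}\,x\right)\beta^{-1}$, and $\Phi$ is the standard normal distribution function.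
   Context: In the definitions of $\Upsilon(X)$ and $\tau(X)$ the index $i$ ranges over integers; both are almost surely finite, and if the set defining $\tau(X)$ is empty, $\tau(X)$ is taken to be $0$. The limit $\beta\to0$ is through positive values, and all quantities are considered for $\beta$ small enough that they are well defined. *)

theory Defs
  imports "HOL-Probability.Probability"
begin

(* The law may be degenerate (a point mass), as is usual for finite-dimensional Gaussian laws. *)
definition gaussian_rv :: "'a measure \<Rightarrow> ('a \<Rightarrow> real) \<Rightarrow> bool" where
  "gaussian_rv M Y \<longleftrightarrow> Y \<in> borel_measurable M \<and>
     ((\<exists>\<mu> \<sigma>. 0 < \<sigma> \<and> distributed M lborel Y (normal_density \<mu> \<sigma>)) \<or>
      (\<exists>\<mu>. AE \<omega> in M. Y \<omega> = \<mu>))"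

definition gaussian_process :: "'a measure \<Rightarrow> ('i \<Rightarrow> 'a \<Rightarrow> real) \<Rightarrow> bool" where
  "gaussian_process M X \<longleftrightarrow>
     (\<forall>J c. finite J \<longrightarrow> gaussian_rv M (\<lambda>\<omega>. \<Sum>i\<in>J. c i * X i \<omega>))"

definition stationary_process :: "'a measure \<Rightarrow> (int \<Rightarrow> 'a \<Rightarrow> real) \<Rightarrow> bool" where
  "stationary_process M X \<longleftrightarrow>
     (\<forall>i. X i \<in> borel_measurable M) \<and>
     (\<forall>J k. finite J \<longrightarrow>
        distr M (\<Pi>\<^sub>M i\<in>J. borel) (\<lambda>\<omega>. \<lambda>i\<in>J. X (i + k) \<omega>) =
        distr M (\<Pi>\<^sub>M i\<in>J. borel) (\<lambda>\<omega>. \<lambda>i\<in>J. X i \<omega>))"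

definition standard_stationary_gaussian :: "'a measure \<Rightarrow> (int \<Rightarrow> 'a \<Rightarrow> real) \<Rightarrow> bool" where
  "standard_stationary_gaussian M X \<longleftrightarrow>
     stationary_process M X \<and> gaussian_process M X \<and>
     (\<forall>i. distributed M lborel (X i) std_normal_density)"

definition covariance_seq :: "'a measure \<Rightarrow> (int \<Rightarrow> 'a \<Rightarrow> real) \<Rightarrow> nat \<Rightarrow> real" where
  "covariance_seq M X n = (\<integral>\<omega>. X 1 \<omega> * X (int n + 1) \<omega> \<partial>M)"

(* Upsilon and tau are functionals of a single path.  Where the minimum (resp. the maximum of a
   nonempty set) does not exist, which is a null event for the processes considered here, the
   value is a fixed but unspecified integer. *)
definition Upsilon :: "real \<Rightarrow> (int \<Rightarrow> real) \<Rightarrow> int" where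
  "Upsilon \<beta> x = (LEAST i. x i > - \<beta> * of_int i)"

definition tau :: "real \<Rightarrow> (int \<Rightarrow> real) \<Rightarrow> int" where
  "tau \<beta> x = (if \<exists>i\<ge>0. x i > \<beta> * of_int i
               then (GREATEST i. i \<ge> 0 \<and> x i > \<beta> * of_int i) else 0)"

definition a_norm :: "real \<Rightarrow> real" where
  "a_norm \<beta> = sqrt (2 * (ln (1 / \<beta>) - ln (2 * ln (1 / \<beta>)) + ln ((2 * pi) powr (- 1 / 2))))"

definition u_weak :: "real \<Rightarrow> real \<Rightarrow> real" where
  "u_weak \<beta> x = (a_norm \<beta> + x / a_norm \<beta>) * (1 / \<beta>)"

definition rho :: "real \<Rightarrow> real \<Rightarrow> real" where
  "rho \<gamma> \<beta> = \<gamma> / \<bar>ln \<beta>\<bar>"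

definition u_strong :: "real \<Rightarrow> real \<Rightarrow> real \<Rightarrow> real" where
  "u_strong \<gamma> \<beta> x =
     (sqrt (1 - rho \<gamma> \<beta>) * a_norm (\<beta> / sqrt (1 - rho \<gamma> \<beta>)) + sqrt (rho \<gamma> \<beta>) * x) * (1 / \<beta>)"

end

theory Submission
  imports Defs "HOL-Real_Asymp.Real_Asymp"
begin

text \<open>
Write L = ln (1/\<beta>), let Q be the standard normal tail and \<phi> the standard normal density.
Up to a null set, the event in question says that X i \<le> \<beta> |i| for every integer i outside a
window [-U, V] whose ends lie near a(\<beta>)/\<beta> (lemma prob_Upsilon_tau). Beyond such an
end U = (a + x/a)/\<beta> the expected number of violations is the sum of Q(\<beta> j) over j > U, which
is about \<phi>(\<beta> U) / (\<beta> (\<beta> U)^2), because \<phi>(v)/v^2 is asymptotically a primitive of -Q. The normalisation a(\<beta>) is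
the solution of \<phi>(a) = 2 \<beta> L, so this expectation tends to exp(-x), and independent
variables would give the limit exp(-exp(-x) - exp(-y)).

Both parts of the theorem are the same statement with \<gamma> = 0 and \<gamma> > 0. Almost all
pairs of indices that matter are at a distance n with ln n close to L, hence their covariance is
close to \<rho> = \<gamma>/L. So X is compared with the equicorrelated sequence
sqrt \<rho> Z + sqrt (1-\<rho>) W_i with independent standard normal Z and W_i. Given Z = z the
variables are independent and Z only shifts the thresholds, by sqrt \<rho> z. Since sqrt \<rho> a(\<beta>)
tends to sqrt (2\<gamma>), the conditional probability tends to the integrand of the
claimed limit, and dominated convergence integrates it over z (lemma equicorrelated_limit).

The comparison is a form of Berman's inequality (theorem normal_comparison): two probabilities
P(X_j \<le> u_j for all j) of Gaussian vectors with unit variances differ by at most a constant times the sum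
over k \<noteq> l of |C1_kl - C0_kl| exp(-(u_k + u_l)^2 / (4 (1 + r_kl))) / (1 - r_kl), where r_kl < 1
bounds both covariances. The proof interpolates
between the two families by sqrt t X + sqrt (1-t) Y on the product space. For a product of
trigonometric polynomials f_j the expectation is a finite sum of values of characteristic functions, so the
derivative in t is computed by elementary algebra: it is half the sum over k \<noteq> l of
(C1_kl - C0_kl) E(f_k' f_l' times the remaining factors). No multivariate density or integration by parts
enters. Polynomials in sin(x/R) approximate C1 transition functions together with their
derivatives, which carries the identity's consequences over to smoothed indicators. Their
derivatives live on short intervals to the right of u_k and u_l, and the probability that two of the variables
lie in such a box is estimated through their sum and difference, which are independent.

For the families at hand the bound tends to 0 (lemma comparison_sum_tendsto_0). Pairs at distance
n \<le> exp(\<kappa> L) are too few for the crude bound with a covariance \<theta> < 1 to matter. Pairs with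
exp(\<kappa> L) < n \<le> 1/(\<beta> L) have covariances O(1/L), so each contributes at most a constant times 1/L times what an independent
pair would, and they are still a vanishing fraction of all pairs. For the remaining pairs
|r_n - \<rho>| is o(1/L), while the corresponding sum of independent contributions is O(L).
Truncating the indices at L^2/\<beta> keeps ln n within O(ln L) of L and costs a
negligible probability.
\<close>

section \<open>Trigonometric approximation of smooth transition functions\<close>

text \<open>
Arbitrary real frequencies are allowed; this makes closure under multiplication by sin(a x)
immediate and costs nothing, because a Gaussian characteristic function is known at every real argument.
\<close>

definition trig_poly :: "(real \<Rightarrow> complex) \<Rightarrow> bool" where
  "trig_poly f \<longleftrightarrow> (\<exists>(S :: real set) c. finite S \<and> (\<forall>x. f x = (\<Sum>s\<in>S. c s * iexp (s * x))))"

lemma trig_poly_const: "trig_poly (\<lambda>x. a)"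
  unfolding trig_poly_def by (intro exI[of _ "{0}"] exI[of _ "\<lambda>_. a"]) auto

lemma trig_poly_cmult:
  assumes "trig_poly f" shows "trig_poly (\<lambda>x. a * f x)"
proof -
  obtain S c where "finite S" "\<And>x. f x = (\<Sum>s\<in>S. c s * iexp (s * x))"
    using assms unfolding trig_poly_def by auto
  then show ?thesis unfolding trig_poly_def
    by (intro exI[of _ S] exI[of _ "\<lambda>s. a * c s"]) (auto simp: sum_distrib_left mult.assoc)
qed

lemma trig_poly_add:
  assumes "trig_poly f" "trig_poly g" shows "trig_poly (\<lambda>x. f x + g x)"
proof -
  obtain S c where S: "finite S" "\<And>x. f x = (\<Sum>s\<in>S. c s * iexp (s * x))"
    using assms unfolding trig_poly_def by auto
  obtain T d where T: "finite T" "\<And>x. g x = (\<Sum>s\<in>T. d s * iexp (s * x))"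
    using assms unfolding trig_poly_def by auto
  let ?e = "\<lambda>s. (if s \<in> S then c s else 0) + (if s \<in> T then d s else 0)"
  have "f x + g x = (\<Sum>s\<in>S \<union> T. ?e s * iexp (s * x))" for x
  proof -
    have 1: "f x = (\<Sum>s\<in>S \<union> T. (if s \<in> S then c s else 0) * iexp (s * x))"
      unfolding S(2) using S(1) T(1) by (intro sum.mono_neutral_cong_left) auto
    have 2: "g x = (\<Sum>s\<in>S \<union> T. (if s \<in> T then d s else 0) * iexp (s * x))"
      unfolding T(2) using S(1) T(1) by (intro sum.mono_neutral_cong_left) auto
    show ?thesis unfolding 1 2 by (simp add: sum.distrib[symmetric] distrib_right)
  qed
  then show ?thesis unfolding trig_poly_def using S(1) T(1)
    by (intro exI[of _ "S \<union> T"] exI[of _ ?e]) auto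
qed

lemma trig_poly_shift:
  assumes "trig_poly f" shows "trig_poly (\<lambda>x. iexp (a * x) * f x)"
proof -
  obtain S c where S: "finite S" "\<And>x. f x = (\<Sum>s\<in>S. c s * iexp (s * x))"
    using assms unfolding trig_poly_def by auto
  have "iexp (a * x) * f x = (\<Sum>s\<in>(+) a ` S. c (s - a) * iexp (s * x))" for x
    unfolding S(2) by (subst sum.reindex)
      (auto simp: sum_distrib_left exp_add[symmetric] algebra_simps intro!: sum.cong)
  then show ?thesis unfolding trig_poly_def using S(1)
    by (intro exI[of _ "(+) a ` S"] exI[of _ "\<lambda>s. c (s - a)"]) auto
qed

lemma trig_poly_mult_sin:
  assumes "trig_poly f" shows "trig_poly (\<lambda>x. complex_of_real (sin (a * x)) * f x)"
proof -
  have "complex_of_real (sin (a * x)) * f x =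
     (1 / (2 * \<i>)) * (iexp (a * x) * f x) + (- 1 / (2 * \<i>)) * (iexp ((- a) * x) * f x)" for x
    by (simp add: sin_of_real[symmetric] sin_exp_eq field_simps exp_minus)
  then show ?thesis
    using trig_poly_add[OF trig_poly_cmult[OF trig_poly_shift[OF assms, of a]]
       trig_poly_cmult[OF trig_poly_shift[OF assms, of "- a"]]] by presburger
qed

lemma trig_poly_sum:
  "finite I \<Longrightarrow> (\<And>i. i \<in> I \<Longrightarrow> trig_poly (f i)) \<Longrightarrow> trig_poly (\<lambda>x. \<Sum>i\<in>I. f i x)"
  by (induction I rule: finite_induct) (auto intro: trig_poly_const trig_poly_add)

lemma trig_poly_polynomial_sin:
  "trig_poly (\<lambda>x. complex_of_real (\<Sum>i\<le>n. b i * sin (a * x) ^ i))"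
proof -
  have "trig_poly (\<lambda>x. complex_of_real (sin (a * x) ^ i))" for i
    by (induction i) (auto intro: trig_poly_const dest!: trig_poly_mult_sin[where a=a])
  then have "trig_poly (\<lambda>x. \<Sum>i\<le>n. complex_of_real (b i) * complex_of_real (sin (a * x) ^ i))"
    by (intro trig_poly_sum trig_poly_cmult) auto
  then show ?thesis by simp
qed

text \<open>
Substituting x = R arcsin y turns the problem into polynomial approximation on [-1, 1], and
a polynomial in sin(x/R) is a trigonometric polynomial that is bounded on the whole line by its
supremum over one half period. To control the derivative as well, it is the derivative of
y \<mapsto> f(R arcsin y) that is approximated, and the approximation is then integrated. The
singularity of arcsin' at the end points is harmless since f' vanishes for |x| \<ge> R, that is for |y| \<ge> sin 1.
\<close>

lemma trig_approx_C1:
  fixes f f' :: "real \<Rightarrow> real"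
  assumes der: "\<And>x. (f has_real_derivative f' x) (at x)"
    and cont: "continuous_on UNIV f'"
    and supp: "\<And>x. \<bar>x\<bar> \<ge> A \<Longrightarrow> f' x = 0"
    and bf: "\<And>x. \<bar>f x\<bar> \<le> a" and bf': "\<And>x. \<bar>f' x\<bar> \<le> B"
    and R: "R > 0" "R \<ge> A" and e: "e > 0"
  obtains p p' where "trig_poly (\<lambda>x. complex_of_real (p x))"
    "\<And>x. (p has_real_derivative p' x) (at x)"
    "\<And>x. \<bar>x\<bar> \<le> R \<Longrightarrow> \<bar>p x - f x\<bar> \<le> 2 * e" "\<And>x. \<bar>x\<bar> \<le> R \<Longrightarrow> \<bar>p' x - f' x\<bar> \<le> e / R"
    "\<And>x. \<bar>p x\<bar> \<le> a + 2 * e" "\<And>x. \<bar>p' x\<bar> \<le> B / cos 1 + e / R"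
proof -
  have B0: "B \<ge> 0" using bf'[of 0] by linarith
  have cos1: "cos (1::real) > 0" by (rule cos_gt_zero_pi) (use pi_gt3 in auto)
  \<comment> \<open>The derivative of y \<mapsto> f (R arcsin y). The maximum with cos 1 makes it continuous on the closed
    interval; it differs from sqrt (1 - y^2) only where the numerator vanishes.\<close>
  define h where "h y = f' (R * arcsin y) * R / max (sqrt (1 - y\<^sup>2)) (cos 1)" for y
  have "continuous_on {-1..1} h" unfolding h_def using cos1
    by (intro continuous_intros continuous_on_compose2[OF cont]) (auto simp: max_def)
  then obtain Q where Q: "real_polynomial_function Q" "\<And>y. y \<in> {-1..1} \<Longrightarrow> \<bar>h y - Q y\<bar> < e"
    using Stone_Weierstrass_real_polynomial_function[of "{-1..1::real}" h e] e by auto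
  then obtain q n where q: "Q = (\<lambda>y. \<Sum>i\<le>n. q i * y ^ i)"
    unfolding real_polynomial_function_iff_sum by auto
  define b where "b i = (if i = 0 then f 0 else q (i - 1) / real i)" for i
  define P where "P y = (\<Sum>i\<le>Suc n. b i * y ^ i)" for y
  have P0: "P 0 = f 0" unfolding P_def by (simp add: sum.atMost_Suc_shift b_def)
  have P: "(P has_real_derivative Q y) (at y)" for y
  proof -
    have "((\<lambda>y. b (Suc i) * y ^ Suc i) has_real_derivative q i * y ^ i) (at y)" for i
      using DERIV_cmult[OF DERIV_pow[of "Suc i" y], of "b (Suc i)"] by (simp add: b_def mult.assoc)
    then have "((\<lambda>y. b 0 * y ^ 0 + (\<Sum>i\<le>n. b (Suc i) * y ^ Suc i)) has_real_derivative
        0 + (\<Sum>i\<le>n. q i * y ^ i)) (at y)"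
      by (intro DERIV_add DERIV_sum) auto
    then show ?thesis unfolding P_def sum.atMost_Suc_shift q by simp
  qed
  define p where "p x = P (sin (x / R))" for x
  define p' where "p' x = Q (sin (x / R)) * cos (x / R) / R" for x
  have der_p: "(p has_real_derivative p' x) (at x)" for x
  proof -
    have "((\<lambda>x. sin (x / R)) has_real_derivative cos (x / R) / R) (at x)"
      using R by (auto intro!: derivative_eq_intros)
    from DERIV_chain2[OF P this] show ?thesis unfolding p_def p'_def by simp
  qed
  have f'_h: "f' x = h (sin (x / R)) * cos (x / R) / R" if x: "\<bar>x\<bar> \<le> R * (pi / 2)" for x
  proof -
    have th: "\<bar>x / R\<bar> \<le> pi / 2" using x R by (simp add: abs_divide pos_divide_le_eq mult.commute)
    have th': "- (pi / 2) \<le> x / R" "x / R \<le> pi / 2" using abs_le_D1[OF th] abs_le_D2[OF th] by linarith+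
    have arc: "arcsin (sin (x / R)) = x / R" using th' by (rule arcsin_sin)
    have c0: "cos (x / R) \<ge> 0" using th' by (rule cos_ge_zero)
    have sq: "sqrt (1 - (sin (x / R))\<^sup>2) = cos (x / R)"
      using c0 by (simp add: cos_squared_eq[symmetric])
    show ?thesis
    proof (cases "\<bar>x\<bar> \<ge> R")
      case True
      then show ?thesis using supp[of x] R by (simp add: h_def arc)
    next
      case False
      then have "cos 1 \<le> cos \<bar>x / R\<bar>" using R pi_gt3
        by (intro cos_monotone_0_pi_le) (auto simp: abs_divide pos_divide_le_eq)
      then have "cos 1 \<le> cos (x / R)" by (simp only: cos_abs_real)
      then show ?thesis using R cos1 by (simp add: h_def arc sq max_absorb1)
    qed
  qed
  have h_bound: "\<bar>h y\<bar> \<le> B / cos 1 * R" for y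
  proof -
    have "\<bar>h y\<bar> = \<bar>f' (R * arcsin y)\<bar> * R / max (sqrt (1 - y\<^sup>2)) (cos 1)"
      unfolding h_def using R cos1 by (simp add: abs_mult)
    also have "\<dots> \<le> B * R / cos 1"
      using R cos1 bf' B0 by (intro frac_le mult_mono) auto
    finally show ?thesis by simp
  qed
  have d: "\<bar>p' x - f' x\<bar> \<le> e / R" if x: "\<bar>x\<bar> \<le> R * (pi / 2)" for x
  proof -
    have "\<bar>p' x - f' x\<bar> = \<bar>h (sin (x / R)) - Q (sin (x / R))\<bar> * \<bar>cos (x / R)\<bar> / R"
    proof -
      have "p' x - f' x = - ((h (sin (x / R)) - Q (sin (x / R))) * cos (x / R) / R)"
        unfolding f'_h[OF x] p'_def by (simp add: left_diff_distrib diff_divide_distrib)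
      then show ?thesis using R by (simp only: abs_minus_cancel abs_mult abs_divide)
    qed
    also have "\<dots> \<le> e * 1 / R"
      using Q(2)[of "sin (x / R)"] R e by (intro divide_right_mono mult_mono) auto
    finally show ?thesis by simp
  qed
  have pf: "\<bar>p x - f x\<bar> \<le> 2 * e" if x: "\<bar>x\<bar> \<le> R * (pi / 2)" for x
  proof -
    have "norm ((p x - f x) - (p 0 - f 0)) \<le> e / R * norm (x - 0)"
    proof (rule field_differentiable_bound[where S = "{- (R * (pi / 2))..R * (pi / 2)}"])
      show "((\<lambda>x. p x - f x) has_field_derivative p' z - f' z) (at z within {- (R * (pi / 2))..R * (pi / 2)})" for z
        by (rule has_field_derivative_at_within[OF DERIV_diff[OF der_p der]])
    qed (use x R d in \<open>auto simp: abs_le_iff\<close>)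
    then have "\<bar>p x - f x\<bar> \<le> e / R * \<bar>x\<bar>" by (simp add: p_def P0)
    also have "\<dots> \<le> e / R * (R * (pi / 2))" using x e R by (intro mult_left_mono) auto
    also have "\<dots> = e * (pi / 2)" using R by simp
    also have "\<dots> \<le> e * 2" using pi_less_4 e by (intro mult_left_mono) auto
    finally show ?thesis by simp
  qed
  have RR: "R \<le> R * (pi / 2)" using R pi_gt3 by simp
  show thesis
  proof (rule that[of p p'])
    show "trig_poly (\<lambda>x. complex_of_real (p x))"
      using trig_poly_polynomial_sin[where n = "Suc n" and b = b and a = "1 / R"] by (simp add: p_def P_def)
    show "(p has_real_derivative p' x) (at x)" for x by (rule der_p)
    show "\<bar>p x - f x\<bar> \<le> 2 * e" if "\<bar>x\<bar> \<le> R" for x using pf[of x] that RR by linarith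
    show "\<bar>p' x - f' x\<bar> \<le> e / R" if "\<bar>x\<bar> \<le> R" for x using d[of x] that RR by linarith
    show "\<bar>p x\<bar> \<le> a + 2 * e" for x
    proof -
      \<comment> \<open>The point of the central half period at which p takes the same value.\<close>
      define x' where "x' = R * arcsin (sin (x / R))"
      have "p x = p x'" unfolding p_def x'_def using R by simp
      moreover have "\<bar>x'\<bar> \<le> R * (pi / 2)"
        unfolding x'_def using R arcsin_bounded[of "sin (x / R)"] by (auto simp: abs_mult abs_le_iff)
      ultimately show ?thesis using pf[of x'] bf[of x'] by linarith
    qed
    show "\<bar>p' x\<bar> \<le> B / cos 1 + e / R" for x
    proof -
      have "\<bar>p' x\<bar> = \<bar>Q (sin (x / R))\<bar> * \<bar>cos (x / R)\<bar> / R" unfolding p'_def using R by (simp add: abs_mult)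
      also have "\<dots> \<le> (B / cos 1 * R + e) * 1 / R"
        using Q(2)[of "sin (x / R)"] h_bound[of "sin (x / R)"] R e
        by (intro divide_right_mono mult_mono) auto
      also have "\<dots> = B / cos 1 + e / R" using R by (simp add: field_simps)
      finally show ?thesis .
    qed
  qed
qed

text \<open>
Differentiating the Fourier sum termwise multiplies each coefficient by \<i> s, whatever way the
derivative of f was obtained.
\<close>

lemma trig_poly_derivative:
  assumes f: "\<And>x. complex_of_real (f x) = (\<Sum>s\<in>S. c s * iexp (s * x))"
    and der: "(f has_real_derivative d) (at x)"
  shows "complex_of_real d = (\<Sum>s\<in>S. (c s * (\<i> * s)) * iexp (s * x))"
proof (rule vector_derivative_unique_at)
  show "((\<lambda>x. complex_of_real (f x)) has_vector_derivative complex_of_real d) (at x)"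
    using der by (intro has_vector_derivative_of_real) (simp add: has_real_derivative_iff_has_vector_derivative)
  have "((\<lambda>x. iexp (s * x)) has_vector_derivative (\<i> * s) * iexp (s * x)) (at x)" for s
  proof -
    have "((\<lambda>z. exp (\<i> * (of_real s * z))) has_field_derivative (\<i> * s) * iexp (s * x)) (at (complex_of_real x))"
      by (auto intro!: derivative_eq_intros)
    from has_vector_derivative_real_field[OF this] show ?thesis by simp
  qed
  then have "((\<lambda>x. \<Sum>s\<in>S. c s * iexp (s * x)) has_vector_derivative
      (\<Sum>s\<in>S. c s * ((\<i> * s) * iexp (s * x)))) (at x)"
    by (intro has_vector_derivative_sum has_vector_derivative_mult_right) auto
  then show "((\<lambda>x. complex_of_real (f x)) has_vector_derivative (\<Sum>s\<in>S. (c s * (\<i> * s)) * iexp (s * x))) (at x)"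
    by (simp add: f mult.assoc)
qed

text \<open>
Smoothed indicators: the class contains both transitions from 1 to 0 and bumps. The derivative
has compact support, although the function itself need not vanish at infinity.
\<close>

definition C1_transition :: "real \<Rightarrow> (real \<Rightarrow> real) \<Rightarrow> (real \<Rightarrow> real) \<Rightarrow> bool" where
  "C1_transition B f f' \<longleftrightarrow> (\<forall>x. (f has_real_derivative f' x) (at x)) \<and> continuous_on UNIV f' \<and>
     (\<exists>A. \<forall>x. \<bar>x\<bar> \<ge> A \<longrightarrow> f' x = 0) \<and> (\<forall>x. 0 \<le> f x \<and> f x \<le> 1) \<and> (\<forall>x. \<bar>f' x\<bar> \<le> B)"

lemma C1_transition_measurable:
  assumes "C1_transition B f f'"
  shows "f \<in> borel_measurable borel" "f' \<in> borel_measurable borel"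
proof -
  have "continuous_on UNIV f"
    using assms DERIV_isCont unfolding C1_transition_def by (intro continuous_at_imp_continuous_on) blast
  then show "f \<in> borel_measurable borel" by (rule borel_measurable_continuous_onI)
  show "f' \<in> borel_measurable borel"
    using assms unfolding C1_transition_def by (intro borel_measurable_continuous_onI) blast
qed

text \<open>
Along the sequence, p and its derivative p' converge pointwise and boundedly to f and f'; frequencies and
coefficients are recorded because the interpolation argument works with the Fourier sums.
\<close>

definition trig_approximation ::
  "real \<Rightarrow> (real \<Rightarrow> real) \<Rightarrow> (real \<Rightarrow> real) \<Rightarrow> (nat \<Rightarrow> real \<Rightarrow> real) \<Rightarrow> (nat \<Rightarrow> real \<Rightarrow> real) \<Rightarrow>
     (nat \<Rightarrow> real set) \<Rightarrow> (nat \<Rightarrow> real \<Rightarrow> complex) \<Rightarrow> bool" where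
  "trig_approximation B f f' p p' S c \<longleftrightarrow>
     (\<forall>n. finite (S n)) \<and>
     (\<forall>n x. complex_of_real (p n x) = (\<Sum>s\<in>S n. c n s * iexp (s * x))) \<and>
     (\<forall>n x. complex_of_real (p' n x) = (\<Sum>s\<in>S n. (c n s * (\<i> * s)) * iexp (s * x))) \<and>
     (\<forall>n. p n \<in> borel_measurable borel) \<and> (\<forall>n. p' n \<in> borel_measurable borel) \<and>
     (\<forall>x. (\<lambda>n. p n x) \<longlonglongrightarrow> f x) \<and> (\<forall>x. (\<lambda>n. p' n x) \<longlonglongrightarrow> f' x) \<and>
     (\<forall>n x. \<bar>p n x\<bar> \<le> 1 + 2 / real (Suc n)) \<and> (\<forall>n x. \<bar>p' n x\<bar> \<le> B / cos 1 + 1)"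

lemma C1_transition_trig_approx:
  assumes f: "C1_transition B f f'"
  shows "\<exists>p p' S c. trig_approximation B f f' p p' S c"
proof -
  have der: "\<And>x. (f has_real_derivative f' x) (at x)" and cont: "continuous_on UNIV f'"
    and bf: "\<And>x. \<bar>f x\<bar> \<le> 1" and bf': "\<And>x. \<bar>f' x\<bar> \<le> B"
    using f unfolding C1_transition_def by (auto simp: abs_le_iff intro: order_trans[of _ 0])
  obtain A where A: "\<And>x. \<bar>x\<bar> \<ge> A \<Longrightarrow> f' x = 0" using f unfolding C1_transition_def by blast
  define R where "R n = max 1 A + real n" for n
  have R: "R n > 0" "R n \<ge> A" "R n \<ge> 1" "R n \<ge> real n" for n unfolding R_def by (auto simp: max_def)
  have "\<exists>p p'. trig_poly (\<lambda>x. complex_of_real (p x)) \<and> (\<forall>x. (p has_real_derivative p' x) (at x)) \<and>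
     (\<forall>x. \<bar>x\<bar> \<le> R n \<longrightarrow> \<bar>p x - f x\<bar> \<le> 2 * (1 / real (Suc n))) \<and>
     (\<forall>x. \<bar>x\<bar> \<le> R n \<longrightarrow> \<bar>p' x - f' x\<bar> \<le> (1 / real (Suc n)) / R n) \<and>
     (\<forall>x. \<bar>p x\<bar> \<le> 1 + 2 * (1 / real (Suc n))) \<and> (\<forall>x. \<bar>p' x\<bar> \<le> B / cos 1 + (1 / real (Suc n)) / R n)" for n
    by (rule trig_approx_C1[OF der cont A bf bf' R(1)[of n] R(2)[of n], where e = "1 / real (Suc n)"]) (assumption, simp, blast)
  then obtain p p' where p: "\<And>n. trig_poly (\<lambda>x. complex_of_real (p n x))"
     "\<And>n x. (p n has_real_derivative p' n x) (at x)"
     "\<And>n x. \<bar>x\<bar> \<le> R n \<Longrightarrow> \<bar>p n x - f x\<bar> \<le> 2 * (1 / real (Suc n))"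
     "\<And>n x. \<bar>x\<bar> \<le> R n \<Longrightarrow> \<bar>p' n x - f' x\<bar> \<le> (1 / real (Suc n)) / R n"
     "\<And>n x. \<bar>p n x\<bar> \<le> 1 + 2 * (1 / real (Suc n))"
     "\<And>n x. \<bar>p' n x\<bar> \<le> B / cos 1 + (1 / real (Suc n)) / R n"
    by metis
  have "\<exists>S c. finite S \<and> (\<forall>x. complex_of_real (p n x) = (\<Sum>s\<in>S. c s * iexp (s * x)))" for n
    using p(1)[of n] unfolding trig_poly_def .
  then obtain S c where S: "\<And>n. finite (S n)"
    "\<And>n x. complex_of_real (p n x) = (\<Sum>s\<in>S n. c n s * iexp (s * x))" by metis
  have S': "complex_of_real (p' n x) = (\<Sum>s\<in>S n. (c n s * (\<i> * s)) * iexp (s * x))" for n x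
    by (rule trig_poly_derivative[OF S(2) p(2)])
  have small: "(1 / real (Suc n)) / R n \<le> 1 / real (Suc n)" for n
    using R(3)[of n] divide_left_mono[of 1 "R n" "1 / real (Suc n)"] by simp
  have ev: "eventually (\<lambda>n. \<bar>x\<bar> \<le> R n) sequentially" for x
  proof -
    obtain m where "\<bar>x\<bar> \<le> real m" using real_arch_simple by blast
    then show ?thesis using R(4) by (intro eventually_sequentiallyI[of m]) (metis of_nat_le_iff order_trans)
  qed
  have lim0: "(\<lambda>n. 2 * (1 / real (Suc n))) \<longlonglongrightarrow> 0"
    using tendsto_mult_right[OF LIMSEQ_inverse_real_of_nat, of 2] by (simp add: inverse_eq_divide)
  have "trig_approximation B f f' p p' S c"
    unfolding trig_approximation_def
  proof (intro conjI allI)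
    show "finite (S n)" for n by (rule S)
    show "complex_of_real (p n x) = (\<Sum>s\<in>S n. c n s * iexp (s * x))" for n x by (rule S)
    show "complex_of_real (p' n x) = (\<Sum>s\<in>S n. (c n s * (\<i> * s)) * iexp (s * x))" for n x by (rule S')
    show "p n \<in> borel_measurable borel" for n
      using p(2) DERIV_isCont by (intro borel_measurable_continuous_onI continuous_at_imp_continuous_on) blast
    have "p' n = (\<lambda>x. Re (\<Sum>s\<in>S n. (c n s * (\<i> * s)) * iexp (s * x)))" for n
      unfolding S'[symmetric] by simp
    then show "p' n \<in> borel_measurable borel" for n by simp
    show "(\<lambda>n. p n x) \<longlonglongrightarrow> f x" for x
      by (rule Lim_transform[OF tendsto_const Lim_null_comparison[OF _ lim0]], rule eventually_mono[OF ev[of x]])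
        (use p(3) in auto)
    show "(\<lambda>n. p' n x) \<longlonglongrightarrow> f' x" for x
    proof (rule Lim_transform[OF tendsto_const Lim_null_comparison[OF _ lim0]], rule eventually_mono[OF ev[of x]])
      fix n assume "\<bar>x\<bar> \<le> R n"
      then show "norm (p' n x - f' x) \<le> 2 * (1 / real (Suc n))"
        using p(4)[of x n] small[of n] by simp
    qed
    show "\<bar>p n x\<bar> \<le> 1 + 2 / real (Suc n)" for n x using p(5)[of n x] by simp
    show "\<bar>p' n x\<bar> \<le> B / cos 1 + 1" for n x
    proof -
      have "1 / real (Suc n) \<le> 1" by simp
      then show ?thesis using p(6)[of n x] small[of n] by linarith
    qed
  qed
  then show ?thesis by blast
qed

section \<open>Finite Gaussian families and their interpolation\<close>

text \<open>
Centred jointly Gaussian variables with covariance C, encoded by the characteristic function of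
all linear combinations. This form covers degenerate laws, is stable under linear maps and
independent superposition, and is exactly what expectations of trigonometric polynomials need.
\<close>

definition gaussian_family ::
  "'a measure \<Rightarrow> 'i set \<Rightarrow> ('i \<Rightarrow> 'a \<Rightarrow> real) \<Rightarrow> ('i \<Rightarrow> 'i \<Rightarrow> real) \<Rightarrow> bool" where
  "gaussian_family M J X C \<longleftrightarrow> prob_space M \<and> finite J \<and> (\<forall>i\<in>J. X i \<in> borel_measurable M) \<and>
     (\<forall>c. (\<integral>\<omega>. iexp (\<Sum>i\<in>J. c i * X i \<omega>) \<partial>M) =
          complex_of_real (exp (- (\<Sum>i\<in>J. \<Sum>j\<in>J. c i * c j * C i j) / 2)))"

lemma gaussian_family_prob_space: "gaussian_family M J X C \<Longrightarrow> prob_space M"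
  and gaussian_family_finite: "gaussian_family M J X C \<Longrightarrow> finite J"
  and gaussian_family_measurable: "gaussian_family M J X C \<Longrightarrow> i \<in> J \<Longrightarrow> X i \<in> borel_measurable M"
  and gaussian_family_char: "gaussian_family M J X C \<Longrightarrow> (\<integral>\<omega>. iexp (\<Sum>i\<in>J. c i * X i \<omega>) \<partial>M) =
          complex_of_real (exp (- (\<Sum>i\<in>J. \<Sum>j\<in>J. c i * c j * C i j) / 2))"
  by (auto simp: gaussian_family_def)

text \<open>
Multiplying out the product gives one exponential of a linear combination for every choice of
one frequency per factor.
\<close>

lemma gaussian_family_expect_trig_prod:
  fixes f :: "'i \<Rightarrow> real \<Rightarrow> complex"
  assumes gf: "gaussian_family M J X C"
    and S: "\<And>j. j \<in> J \<Longrightarrow> finite (S j)"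
    and f: "\<And>j x. j \<in> J \<Longrightarrow> f j x = (\<Sum>s\<in>S j. c j s * iexp (s * x))"
  shows "(\<integral>\<omega>. (\<Prod>j\<in>J. f j (X j \<omega>)) \<partial>M) =
     (\<Sum>\<sigma>\<in>PiE J S. (\<Prod>j\<in>J. c j (\<sigma> j)) *
        complex_of_real (exp (- (\<Sum>i\<in>J. \<Sum>j\<in>J. \<sigma> i * \<sigma> j * C i j) / 2)))"
proof -
  interpret prob_space M by (rule gaussian_family_prob_space[OF gf])
  have J: "finite J" by (rule gaussian_family_finite[OF gf])
  have [measurable]: "i \<in> J \<Longrightarrow> X i \<in> borel_measurable M" for i
    by (rule gaussian_family_measurable[OF gf])
  have "(\<Prod>j\<in>J. f j (X j \<omega>)) =
      (\<Sum>\<sigma>\<in>PiE J S. (\<Prod>j\<in>J. c j (\<sigma> j)) * iexp (\<Sum>j\<in>J. \<sigma> j * X j \<omega>))" for \<omega>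
  proof -
    have "(\<Prod>j\<in>J. f j (X j \<omega>)) = (\<Prod>j\<in>J. \<Sum>s\<in>S j. c j s * iexp (s * X j \<omega>))"
      by (intro prod.cong) (auto simp: f)
    also have "\<dots> = (\<Sum>\<sigma>\<in>PiE J S. \<Prod>j\<in>J. c j (\<sigma> j) * iexp (\<sigma> j * X j \<omega>))"
      by (rule prod_sum_PiE[OF J S])
    finally show ?thesis
      by (simp only: prod.distrib exp_sum[OF J, symmetric] of_real_sum sum_distrib_left)
  qed
  then have "(\<integral>\<omega>. (\<Prod>j\<in>J. f j (X j \<omega>)) \<partial>M) =
      (\<integral>\<omega>. (\<Sum>\<sigma>\<in>PiE J S. (\<Prod>j\<in>J. c j (\<sigma> j)) * iexp (\<Sum>j\<in>J. \<sigma> j * X j \<omega>)) \<partial>M)"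
    by simp
  also have "\<dots> = (\<Sum>\<sigma>\<in>PiE J S. (\<Prod>j\<in>J. c j (\<sigma> j)) * (\<integral>\<omega>. iexp (\<Sum>j\<in>J. \<sigma> j * X j \<omega>) \<partial>M))"
    by (subst Bochner_Integration.integral_sum)
       (auto intro!: integrable_mult_right integrable_iexp simp: integral_mult_right_zero)
  finally show ?thesis by (simp only: gaussian_family_char[OF gf])
qed

text \<open>
On the product space the two families are independent, so the covariance moves linearly from
that of Y at t = 0 to that of X at t = 1.
\<close>

definition interpolate ::
  "real \<Rightarrow> ('i \<Rightarrow> 'a \<Rightarrow> real) \<Rightarrow> ('i \<Rightarrow> 'b \<Rightarrow> real) \<Rightarrow> 'i \<Rightarrow> 'a \<times> 'b \<Rightarrow> real" where
  "interpolate t X Y i = (\<lambda>(\<omega>, \<omega>'). sqrt t * X i \<omega> + sqrt (1 - t) * Y i \<omega>')"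

lemma gaussian_family_interpolate:
  assumes X: "gaussian_family M J X C1" and Y: "gaussian_family N J Y C0" and t: "0 \<le> t" "t \<le> 1"
  shows "gaussian_family (M \<Otimes>\<^sub>M N) J (interpolate t X Y) (\<lambda>i j. t * C1 i j + (1 - t) * C0 i j)"
proof -
  interpret M: prob_space M by (rule gaussian_family_prob_space[OF X])
  interpret N: prob_space N by (rule gaussian_family_prob_space[OF Y])
  interpret P: pair_prob_space M N ..
  have J: "finite J" by (rule gaussian_family_finite[OF X])
  have [measurable]: "i \<in> J \<Longrightarrow> X i \<in> borel_measurable M" for i
    by (rule gaussian_family_measurable[OF X])
  have [measurable]: "i \<in> J \<Longrightarrow> Y i \<in> borel_measurable N" for i
    by (rule gaussian_family_measurable[OF Y])
  have "(\<integral>\<omega>. iexp (\<Sum>i\<in>J. c i * interpolate t X Y i \<omega>) \<partial>(M \<Otimes>\<^sub>M N)) =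
      complex_of_real (exp (- (\<Sum>i\<in>J. \<Sum>j\<in>J. c i * c j * (t * C1 i j + (1 - t) * C0 i j)) / 2))" for c
  proof -
    have split: "iexp (\<Sum>i\<in>J. c i * interpolate t X Y i (a, b)) =
       iexp (\<Sum>i\<in>J. (sqrt t * c i) * X i a) * iexp (\<Sum>i\<in>J. (sqrt (1 - t) * c i) * Y i b)" for a b
    proof -
      have "(\<Sum>i\<in>J. c i * interpolate t X Y i (a, b)) =
          (\<Sum>i\<in>J. (sqrt t * c i) * X i a) + (\<Sum>i\<in>J. (sqrt (1 - t) * c i) * Y i b)"
        unfolding interpolate_def sum.distrib[symmetric] by (intro sum.cong) (auto simp: algebra_simps)
      then show ?thesis by (simp only: of_real_add distrib_left exp_add)
    qed
    have "integrable (M \<Otimes>\<^sub>M N) (\<lambda>\<omega>. iexp (\<Sum>i\<in>J. c i * interpolate t X Y i \<omega>))"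
      unfolding interpolate_def by (intro P.integrable_iexp) auto
    from P.integral_fst'[OF this]
    have "(\<integral>\<omega>. iexp (\<Sum>i\<in>J. c i * interpolate t X Y i \<omega>) \<partial>(M \<Otimes>\<^sub>M N)) =
        (\<integral>a. \<integral>b. iexp (\<Sum>i\<in>J. c i * interpolate t X Y i (a, b)) \<partial>N \<partial>M)" by simp
    also have "\<dots> = (\<integral>a. iexp (\<Sum>i\<in>J. (sqrt t * c i) * X i a) \<partial>M) *
        (\<integral>b. iexp (\<Sum>i\<in>J. (sqrt (1 - t) * c i) * Y i b) \<partial>N)"
      unfolding split by simp
    also have "\<dots> = complex_of_real (exp (- (\<Sum>i\<in>J. \<Sum>j\<in>J. (sqrt t * c i) * (sqrt t * c j) * C1 i j) / 2)
        * exp (- (\<Sum>i\<in>J. \<Sum>j\<in>J. (sqrt (1 - t) * c i) * (sqrt (1 - t) * c j) * C0 i j) / 2))"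
      by (simp only: gaussian_family_char[OF X] gaussian_family_char[OF Y] of_real_mult)
    also have "(\<Sum>i\<in>J. \<Sum>j\<in>J. (sqrt t * c i) * (sqrt t * c j) * C1 i j) = t * (\<Sum>i\<in>J. \<Sum>j\<in>J. c i * c j * C1 i j)"
      using t by (simp add: sum_distrib_left algebra_simps)
        (simp add: mult.assoc[symmetric])
    also have "(\<Sum>i\<in>J. \<Sum>j\<in>J. (sqrt (1 - t) * c i) * (sqrt (1 - t) * c j) * C0 i j) =
        (1 - t) * (\<Sum>i\<in>J. \<Sum>j\<in>J. c i * c j * C0 i j)"
    proof -
      have "(sqrt (1 - t) * c i) * (sqrt (1 - t) * c j) * C0 i j = (1 - t) * (c i * c j * C0 i j)" for i j
      proof -
        have "sqrt (1 - t) * sqrt (1 - t) = 1 - t" using t by simp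
        then show ?thesis by (metis (no_types, lifting) mult.assoc mult.left_commute)
      qed
      then show ?thesis by (simp only: sum_distrib_left)
    qed
    also have "exp (- (t * (\<Sum>i\<in>J. \<Sum>j\<in>J. c i * c j * C1 i j)) / 2) *
        exp (- ((1 - t) * (\<Sum>i\<in>J. \<Sum>j\<in>J. c i * c j * C0 i j)) / 2) =
        exp (- (\<Sum>i\<in>J. \<Sum>j\<in>J. c i * c j * (t * C1 i j + (1 - t) * C0 i j)) / 2)"
    proof -
      have "(\<Sum>i\<in>J. \<Sum>j\<in>J. c i * c j * (t * C1 i j + (1 - t) * C0 i j)) =
         t * (\<Sum>i\<in>J. \<Sum>j\<in>J. c i * c j * C1 i j) + (1 - t) * (\<Sum>i\<in>J. \<Sum>j\<in>J. c i * c j * C0 i j)"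
        by (simp add: sum_distrib_left sum.distrib[symmetric] distrib_left mult.left_commute)
      then show ?thesis by (simp add: exp_add[symmetric] field_simps)
    qed
    finally show ?thesis .
  qed
  moreover have "interpolate t X Y i \<in> borel_measurable (M \<Otimes>\<^sub>M N)" if "i \<in> J" for i
    using that unfolding interpolate_def by measurable
  ultimately show ?thesis unfolding gaussian_family_def using J P.prob_space_axioms by auto
qed

text \<open>
Each frequency choice \<sigma> contributes exp(-Q_t(\<sigma>)/2), where the quadratic form Q_t is affine in t. Its derivative brings down
the factors \<sigma>_k \<sigma>_l, and -\<sigma>_k \<sigma>_l is exactly what replacing f_k and f_l by their derivatives
does to the coefficients. The diagonal drops out because the variances agree, so no second
derivative of a factor appears.
\<close>

lemma gaussian_interpolation_bound:
  fixes f f' :: "'i \<Rightarrow> real \<Rightarrow> real" and C1 C0 :: "'i \<Rightarrow> 'i \<Rightarrow> real"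
  assumes X: "gaussian_family M J X C1" and Y: "gaussian_family N J Y C0"
    and diag: "\<And>i. i \<in> J \<Longrightarrow> C1 i i = C0 i i"
    and S: "\<And>j. j \<in> J \<Longrightarrow> finite (S j)"
    and f: "\<And>j x. j \<in> J \<Longrightarrow> complex_of_real (f j x) = (\<Sum>s\<in>S j. c j s * iexp (s * x))"
    and f': "\<And>j x. j \<in> J \<Longrightarrow> complex_of_real (f' j x) = (\<Sum>s\<in>S j. (c j s * (\<i> * s)) * iexp (s * x))"
    and meas: "\<And>j. j \<in> J \<Longrightarrow> f j \<in> borel_measurable borel" "\<And>j. j \<in> J \<Longrightarrow> f' j \<in> borel_measurable borel"
    and a: "a \<ge> 1" "\<And>j x. j \<in> J \<Longrightarrow> \<bar>f j x\<bar> \<le> a" and b: "\<And>j x. j \<in> J \<Longrightarrow> \<bar>f' j x\<bar> \<le> b"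
    and D: "\<And>t k l. 0 \<le> t \<Longrightarrow> t \<le> 1 \<Longrightarrow> k \<in> J \<Longrightarrow> l \<in> J \<Longrightarrow> k \<noteq> l \<Longrightarrow>
      (\<integral>\<omega>. \<bar>f' k (interpolate t X Y k \<omega>)\<bar> * \<bar>f' l (interpolate t X Y l \<omega>)\<bar> \<partial>(M \<Otimes>\<^sub>M N)) \<le> D k l"
  shows "\<bar>(\<integral>\<omega>. (\<Prod>j\<in>J. f j (X j \<omega>)) \<partial>M) - (\<integral>\<omega>. (\<Prod>j\<in>J. f j (Y j \<omega>)) \<partial>N)\<bar>
    \<le> a ^ card J * (\<Sum>k\<in>J. \<Sum>l\<in>J - {k}. \<bar>C1 k l - C0 k l\<bar> * D k l) / 2"
proof -
  have J: "finite J" by (rule gaussian_family_finite[OF X])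
  have finS: "finite (PiE J S)" using J S by (intro finite_PiE) auto
  define Q where "Q C \<sigma> = (\<Sum>i\<in>J. \<Sum>j\<in>J. \<sigma> i * \<sigma> j * C i j)" for C :: "'i \<Rightarrow> 'i \<Rightarrow> real" and \<sigma>
  \<comment> \<open>The expectations are real, so only the real parts of the coefficients matter.\<close>
  define w where "w \<sigma> = Re (\<Prod>j\<in>J. c j (\<sigma> j))" for \<sigma>
  define Ct where "Ct t = (\<lambda>i j. t * C1 i j + (1 - t) * C0 i j)" for t
  define G where "G t = (\<Sum>\<sigma>\<in>PiE J S. w \<sigma> * exp (- Q (Ct t) \<sigma> / 2))" for t
  have QCt: "Q (Ct t) \<sigma> = t * (Q C1 \<sigma> - Q C0 \<sigma>) + Q C0 \<sigma>" for t \<sigma>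
    unfolding Q_def Ct_def
    by (simp add: sum_distrib_left sum.distrib[symmetric] sum_subtractf[symmetric] algebra_simps)
  have expect: "(\<integral>\<omega>. (\<Prod>j\<in>J. f j (Z j \<omega>)) \<partial>M') = (\<Sum>\<sigma>\<in>PiE J S. w \<sigma> * exp (- Q C \<sigma> / 2))"
    if Z: "gaussian_family M' J Z C" for M' :: "'z measure" and Z C
  proof -
    have "complex_of_real (\<integral>\<omega>. (\<Prod>j\<in>J. f j (Z j \<omega>)) \<partial>M') = (\<integral>\<omega>. (\<Prod>j\<in>J. complex_of_real (f j (Z j \<omega>))) \<partial>M')"
      by (simp add: integral_complex_of_real[symmetric])
    also have "\<dots> = (\<Sum>\<sigma>\<in>PiE J S. (\<Prod>j\<in>J. c j (\<sigma> j)) * complex_of_real (exp (- Q C \<sigma> / 2)))"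
      unfolding Q_def by (rule gaussian_family_expect_trig_prod[OF Z S f])
    finally have "Re (complex_of_real (\<integral>\<omega>. (\<Prod>j\<in>J. f j (Z j \<omega>)) \<partial>M')) =
       Re (\<Sum>\<sigma>\<in>PiE J S. (\<Prod>j\<in>J. c j (\<sigma> j)) * complex_of_real (exp (- Q C \<sigma> / 2)))" by simp
    then show ?thesis by (simp add: w_def)
  qed
  have G1: "G 1 = (\<integral>\<omega>. (\<Prod>j\<in>J. f j (X j \<omega>)) \<partial>M)"
    unfolding expect[OF X] G_def QCt by simp
  have G0: "G 0 = (\<integral>\<omega>. (\<Prod>j\<in>J. f j (Y j \<omega>)) \<partial>N)"
    unfolding expect[OF Y] G_def QCt by simp
  define Z where "Z t = interpolate t X Y" for t
  define G' where "G' t = (\<Sum>\<sigma>\<in>PiE J S. w \<sigma> * (exp (- Q (Ct t) \<sigma> / 2) * (- (Q C1 \<sigma> - Q C0 \<sigma>) / 2)))" for t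
  have der: "(G has_real_derivative G' t) (at t)" for t
    unfolding G_def G'_def QCt by (auto intro!: derivative_eq_intros sum.cong)
  define g where "g k l j = (if j \<in> {k, l} then f' j else f j)" for k l j
  define E where "E t k l = (\<integral>\<omega>. (\<Prod>j\<in>J. g k l j (Z t j \<omega>)) \<partial>(M \<Otimes>\<^sub>M N))" for t k l
  have Z: "gaussian_family (M \<Otimes>\<^sub>M N) J (Z t) (Ct t)" if "0 \<le> t" "t \<le> 1" for t
    unfolding Z_def Ct_def by (rule gaussian_family_interpolate[OF X Y that])
  have E_eq: "E t k l = (\<Sum>\<sigma>\<in>PiE J S. - (\<sigma> k * \<sigma> l) * w \<sigma> * exp (- Q (Ct t) \<sigma> / 2))"
    if t: "0 \<le> t" "t \<le> 1" and kl: "k \<in> J" "l \<in> J" "k \<noteq> l" for t k l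
  proof -
    define cc where "cc j s = c j s * (if j \<in> {k, l} then \<i> * complex_of_real s else 1)" for j s
    have prod_cc: "(\<Prod>j\<in>J. cc j (\<sigma> j)) = - complex_of_real (\<sigma> k * \<sigma> l) * (\<Prod>j\<in>J. c j (\<sigma> j))" for \<sigma>
    proof -
      have "(\<Prod>j\<in>J. cc j (\<sigma> j)) = (\<Prod>j\<in>J. c j (\<sigma> j)) * (\<Prod>j\<in>J. if j \<in> {k, l} then \<i> * complex_of_real (\<sigma> j) else 1)"
        unfolding cc_def by (rule prod.distrib)
      also have "(\<Prod>j\<in>J. if j \<in> {k, l} then \<i> * complex_of_real (\<sigma> j) else 1) =
          (\<Prod>j\<in>{k, l}. \<i> * complex_of_real (\<sigma> j))"
        using J kl by (intro prod.mono_neutral_cong_right) auto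
      also have "\<dots> = - complex_of_real (\<sigma> k * \<sigma> l)" using kl by (simp add: algebra_simps)
      finally show ?thesis by simp
    qed
    have "complex_of_real (E t k l) = (\<integral>\<omega>. (\<Prod>j\<in>J. complex_of_real (g k l j (Z t j \<omega>))) \<partial>(M \<Otimes>\<^sub>M N))"
      unfolding E_def by (simp add: integral_complex_of_real[symmetric])
    also have "\<dots> = (\<Sum>\<sigma>\<in>PiE J S. (\<Prod>j\<in>J. cc j (\<sigma> j)) * complex_of_real (exp (- Q (Ct t) \<sigma> / 2)))"
      unfolding Q_def
      by (rule gaussian_family_expect_trig_prod[OF Z[OF t] S]) (auto simp: g_def cc_def f f')
    also have "\<dots> = (\<Sum>\<sigma>\<in>PiE J S. - complex_of_real (\<sigma> k * \<sigma> l) *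
       (\<Prod>j\<in>J. c j (\<sigma> j)) * complex_of_real (exp (- Q (Ct t) \<sigma> / 2)))"
      by (simp only: prod_cc)
    finally have "Re (complex_of_real (E t k l)) = Re (\<Sum>\<sigma>\<in>PiE J S. - complex_of_real (\<sigma> k * \<sigma> l) *
       (\<Prod>j\<in>J. c j (\<sigma> j)) * complex_of_real (exp (- Q (Ct t) \<sigma> / 2)))" by simp
    then show ?thesis by (simp add: w_def)
  qed
  have G'_eq: "G' t = (\<Sum>k\<in>J. \<Sum>l\<in>J - {k}. (C1 k l - C0 k l) * E t k l) / 2" if t: "0 \<le> t" "t \<le> 1" for t
  proof -
    have "Q C1 \<sigma> - Q C0 \<sigma> = (\<Sum>k\<in>J. \<Sum>l\<in>J - {k}. \<sigma> k * \<sigma> l * (C1 k l - C0 k l))" for \<sigma>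
    proof -
      have "(\<Sum>l\<in>J. \<sigma> k * \<sigma> l * (C1 k l - C0 k l)) = (\<Sum>l\<in>J - {k}. \<sigma> k * \<sigma> l * (C1 k l - C0 k l))"
        if "k \<in> J" for k
        using J that diag by (intro sum.mono_neutral_right) auto
      then have "(\<Sum>k\<in>J. \<Sum>l\<in>J. \<sigma> k * \<sigma> l * (C1 k l - C0 k l)) =
          (\<Sum>k\<in>J. \<Sum>l\<in>J - {k}. \<sigma> k * \<sigma> l * (C1 k l - C0 k l))"
        by (rule sum.cong[OF refl])
      then show ?thesis unfolding Q_def by (simp add: sum_subtractf[symmetric] algebra_simps)
    qed
    then have "G' t = (\<Sum>\<sigma>\<in>PiE J S. \<Sum>k\<in>J. \<Sum>l\<in>J - {k}.
        (C1 k l - C0 k l) * (- (\<sigma> k * \<sigma> l) * w \<sigma> * exp (- Q (Ct t) \<sigma> / 2)) / 2)"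
      unfolding G'_def by (simp add: sum_distrib_left sum_divide_distrib sum_negf[symmetric] algebra_simps)
    also have "\<dots> = (\<Sum>k\<in>J. \<Sum>\<sigma>\<in>PiE J S. \<Sum>l\<in>J - {k}.
        (C1 k l - C0 k l) * (- (\<sigma> k * \<sigma> l) * w \<sigma> * exp (- Q (Ct t) \<sigma> / 2)) / 2)"
      by (rule sum.swap)
    also have "\<dots> = (\<Sum>k\<in>J. \<Sum>l\<in>J - {k}. \<Sum>\<sigma>\<in>PiE J S.
        (C1 k l - C0 k l) * (- (\<sigma> k * \<sigma> l) * w \<sigma> * exp (- Q (Ct t) \<sigma> / 2)) / 2)"
      by (intro sum.cong refl sum.swap)
    also have "\<dots> = (\<Sum>k\<in>J. \<Sum>l\<in>J - {k}. (C1 k l - C0 k l) * E t k l / 2)"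
      by (intro sum.cong refl) (subst E_eq[OF t], auto simp: sum_distrib_left sum_divide_distrib)
    finally show ?thesis by (simp add: sum_divide_distrib)
  qed
  have E_bound: "\<bar>E t k l\<bar> \<le> a ^ card J * D k l"
    if t: "0 \<le> t" "t \<le> 1" and kl: "k \<in> J" "l \<in> J" "k \<noteq> l" for t k l
  proof -
    interpret P: prob_space "M \<Otimes>\<^sub>M N" by (rule gaussian_family_prob_space[OF Z[OF t]])
    have [measurable]: "j \<in> J \<Longrightarrow> Z t j \<in> borel_measurable (M \<Otimes>\<^sub>M N)" for j
      by (rule gaussian_family_measurable[OF Z[OF t]])
    note meas[measurable]
    have b0: "b \<ge> 0" using b[OF kl(1), of 0] by linarith
    have int: "integrable (M \<Otimes>\<^sub>M N) (\<lambda>\<omega>. \<bar>f' k (Z t k \<omega>)\<bar> * \<bar>f' l (Z t l \<omega>)\<bar>)"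
      using kl b b0 by (intro P.integrable_const_bound[where B = "b * b"])
        (auto intro!: mult_mono AE_I2 measurable_compose[OF _ meas(2)] borel_measurable_times borel_measurable_abs simp: abs_mult)
    have pt: "\<bar>\<Prod>j\<in>J. g k l j (Z t j \<omega>)\<bar> \<le> a ^ card J * (\<bar>f' k (Z t k \<omega>)\<bar> * \<bar>f' l (Z t l \<omega>)\<bar>)" for \<omega>
    proof -
      let ?h = "\<lambda>j. if j \<in> {k, l} then \<bar>f' j (Z t j \<omega>)\<bar> else 1"
      have "\<bar>\<Prod>j\<in>J. g k l j (Z t j \<omega>)\<bar> = (\<Prod>j\<in>J. \<bar>g k l j (Z t j \<omega>)\<bar>)" by (rule abs_prod)
      also have "\<dots> \<le> (\<Prod>j\<in>J. a * ?h j)"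
      proof (rule prod_mono)
        fix j assume "j \<in> J"
        then show "0 \<le> \<bar>g k l j (Z t j \<omega>)\<bar> \<and> \<bar>g k l j (Z t j \<omega>)\<bar> \<le> a * ?h j"
          using a mult_right_mono[of 1 a "\<bar>f' j (Z t j \<omega>)\<bar>"] by (auto simp: g_def)
      qed
      also have "\<dots> = a ^ card J * (\<Prod>j\<in>J. ?h j)" by (simp add: prod.distrib)
      also have "(\<Prod>j\<in>J. ?h j) = (\<Prod>j\<in>{k, l}. \<bar>f' j (Z t j \<omega>)\<bar>)"
        using J kl by (intro prod.mono_neutral_cong_right) auto
      finally show ?thesis using kl by simp
    qed
    have "\<bar>E t k l\<bar> \<le> (\<integral>\<omega>. \<bar>\<Prod>j\<in>J. g k l j (Z t j \<omega>)\<bar> \<partial>(M \<Otimes>\<^sub>M N))"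
      unfolding E_def by (rule integral_abs_bound)
    also have "\<dots> \<le> (\<integral>\<omega>. a ^ card J * (\<bar>f' k (Z t k \<omega>)\<bar> * \<bar>f' l (Z t l \<omega>)\<bar>) \<partial>(M \<Otimes>\<^sub>M N))"
      using a by (intro integral_mono' integrable_mult_right int pt) auto
    also have "\<dots> = a ^ card J * (\<integral>\<omega>. \<bar>f' k (Z t k \<omega>)\<bar> * \<bar>f' l (Z t l \<omega>)\<bar> \<partial>(M \<Otimes>\<^sub>M N))"
      by simp
    also have "\<dots> \<le> a ^ card J * D k l"
      using D[OF t kl] a unfolding Z_def by (intro mult_left_mono) auto
    finally show ?thesis .
  qed
  have G'_bound: "\<bar>G' t\<bar> \<le> a ^ card J * (\<Sum>k\<in>J. \<Sum>l\<in>J - {k}. \<bar>C1 k l - C0 k l\<bar> * D k l) / 2"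
    if t: "0 \<le> t" "t \<le> 1" for t
  proof -
    have "\<bar>\<Sum>k\<in>J. \<Sum>l\<in>J - {k}. (C1 k l - C0 k l) * E t k l\<bar> \<le>
        (\<Sum>k\<in>J. \<Sum>l\<in>J - {k}. \<bar>(C1 k l - C0 k l) * E t k l\<bar>)"
      by (intro order_trans[OF sum_abs] sum_mono) auto
    also have "\<dots> \<le> (\<Sum>k\<in>J. \<Sum>l\<in>J - {k}. \<bar>C1 k l - C0 k l\<bar> * (a ^ card J * D k l))"
      using E_bound[OF t] by (intro sum_mono) (auto simp: abs_mult intro!: mult_left_mono)
    also have "\<dots> = a ^ card J * (\<Sum>k\<in>J. \<Sum>l\<in>J - {k}. \<bar>C1 k l - C0 k l\<bar> * D k l)"
      by (simp add: sum_distrib_left algebra_simps)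
    finally show ?thesis unfolding G'_eq[OF t] by simp
  qed
  have "norm (G 1 - G 0) \<le> a ^ card J * (\<Sum>k\<in>J. \<Sum>l\<in>J - {k}. \<bar>C1 k l - C0 k l\<bar> * D k l) / 2 * norm (1 - 0 :: real)"
    by (rule field_differentiable_bound[where S = "{0..1}" and f' = G'])
       (use G'_bound in \<open>auto intro: DERIV_subset[OF der]\<close>)
  then show ?thesis by (simp add: G1 G0)
qed

section \<open>Comparison of expectations of smooth products\<close>

text \<open>
Superposing coefficients of the new family gives coefficients of the old one.
\<close>

lemma gaussian_family_linear:
  assumes X: "gaussian_family M J X C" and I: "finite I"
  shows "gaussian_family M I (\<lambda>i \<omega>. \<Sum>j\<in>J. A i j * X j \<omega>)
     (\<lambda>i i'. \<Sum>j\<in>J. \<Sum>j'\<in>J. A i j * A i' j' * C j j')"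
proof -
  have J: "finite J" by (rule gaussian_family_finite[OF X])
  have [measurable]: "j \<in> J \<Longrightarrow> X j \<in> borel_measurable M" for j
    by (rule gaussian_family_measurable[OF X])
  have "(\<integral>\<omega>. iexp (\<Sum>i\<in>I. c i * (\<Sum>j\<in>J. A i j * X j \<omega>)) \<partial>M) = complex_of_real
     (exp (- (\<Sum>i\<in>I. \<Sum>i'\<in>I. c i * c i' * (\<Sum>j\<in>J. \<Sum>j'\<in>J. A i j * A i' j' * C j j')) / 2))" for c
  proof -
    let ?d = "\<lambda>j. \<Sum>i\<in>I. c i * A i j"
    have "(\<Sum>i\<in>I. c i * (\<Sum>j\<in>J. A i j * X j \<omega>)) = (\<Sum>j\<in>J. ?d j * X j \<omega>)" for \<omega>
      unfolding sum_distrib_left sum_distrib_right by (subst sum.swap) (simp add: mult.assoc)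
    then have "(\<integral>\<omega>. iexp (\<Sum>i\<in>I. c i * (\<Sum>j\<in>J. A i j * X j \<omega>)) \<partial>M) =
        complex_of_real (exp (- (\<Sum>j\<in>J. \<Sum>j'\<in>J. ?d j * ?d j' * C j j') / 2))"
      by (simp only: gaussian_family_char[OF X])
    also have "(\<Sum>j\<in>J. \<Sum>j'\<in>J. ?d j * ?d j' * C j j') =
       (\<Sum>j\<in>J. \<Sum>j'\<in>J. \<Sum>i\<in>I. \<Sum>i'\<in>I. c i * c i' * (A i j * A i' j' * C j j'))"
      by (simp only: sum_product, simp only: sum_distrib_right, simp only: ac_simps)
    also have "\<dots> = (\<Sum>j\<in>J. \<Sum>i\<in>I. \<Sum>j'\<in>J. \<Sum>i'\<in>I. c i * c i' * (A i j * A i' j' * C j j'))"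
      by (intro sum.cong refl sum.swap)
    also have "\<dots> = (\<Sum>i\<in>I. \<Sum>j\<in>J. \<Sum>i'\<in>I. \<Sum>j'\<in>J. c i * c i' * (A i j * A i' j' * C j j'))"
      by (subst sum.swap, intro sum.cong refl, intro sum.cong refl sum.swap)
    also have "\<dots> = (\<Sum>i\<in>I. \<Sum>i'\<in>I. \<Sum>j\<in>J. \<Sum>j'\<in>J. c i * c i' * (A i j * A i' j' * C j j'))"
      by (intro sum.cong refl sum.swap)
    also have "\<dots> = (\<Sum>i\<in>I. \<Sum>i'\<in>I. c i * c i' * (\<Sum>j\<in>J. \<Sum>j'\<in>J. A i j * A i' j' * C j j'))"
      by (simp add: sum_distrib_left)
    finally show ?thesis .
  qed
  then show ?thesis unfolding gaussian_family_def
    using I gaussian_family_prob_space[OF X] by auto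
qed

lemma gaussian_family_marginal:
  assumes X: "gaussian_family M J X C" and k: "k \<in> J" "C k k = 1"
  shows "distr M borel (X k) = std_normal_distribution"
proof (rule Levy_uniqueness)
  interpret prob_space M by (rule gaussian_family_prob_space[OF X])
  have J: "finite J" by (rule gaussian_family_finite[OF X])
  have m[measurable]: "X k \<in> borel_measurable M" by (rule gaussian_family_measurable[OF X k(1)])
  show "real_distribution (distr M borel (X k))" by (rule real_distribution_distr) simp
  show "real_distribution std_normal_distribution" by (rule real_dist_normal_dist)
  show "char (distr M borel (X k)) = char std_normal_distribution"
  proof
    fix t :: real
    let ?c = "\<lambda>i. if i = k then t else 0"
    have 1: "(\<Sum>i\<in>J. ?c i * X i \<omega>) = t * X k \<omega>" for \<omega>
      using J k by (subst sum.cong[OF refl, where h = "\<lambda>i. if i = k then t * X k \<omega> else 0"]) auto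
    have 2: "(\<Sum>i\<in>J. \<Sum>j\<in>J. ?c i * ?c j * C i j) = t\<^sup>2"
    proof -
      have "(\<Sum>j\<in>J. ?c i * ?c j * C i j) = (if i = k then t\<^sup>2 else 0)" for i
        using J k by (subst sum.cong[OF refl, where h = "\<lambda>j. if j = k then ?c i * t * C i k else 0"])
          (auto simp: power2_eq_square)
      then show ?thesis using J k by simp
    qed
    have "char (distr M borel (X k)) t = (\<integral>\<omega>. iexp (t * X k \<omega>) \<partial>M)"
      unfolding char_def by (subst integral_distr) auto
    also have "\<dots> = complex_of_real (exp (- t\<^sup>2 / 2))"
      using gaussian_family_char[OF X, of ?c] unfolding 1 2 .
    finally show "char (distr M borel (X k)) t = char std_normal_distribution t"
      by (simp add: char_std_normal_distribution)
  qed
qed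

lemma prob_space_std_normal: "prob_space std_normal_distribution"
  by (rule prob_space_normal_density) simp

lemma gaussian_family_iid:
  assumes J: "finite J"
  shows "gaussian_family (\<Pi>\<^sub>M j\<in>J. std_normal_distribution) J (\<lambda>j w. w j) (\<lambda>i j. if i = j then 1 else 0)"
proof -
  interpret N: prob_space std_normal_distribution by (rule prob_space_std_normal)
  interpret product_prob_space "\<lambda>_. std_normal_distribution" J by unfold_locales
  have "(\<integral>w. iexp (\<Sum>i\<in>J. c i * w i) \<partial>(\<Pi>\<^sub>M j\<in>J. std_normal_distribution)) =
      complex_of_real (exp (- (\<Sum>i\<in>J. \<Sum>j\<in>J. c i * c j * (if i = j then 1 else 0)) / 2))" for c
  proof -
    have "(\<integral>w. iexp (\<Sum>i\<in>J. c i * w i) \<partial>(\<Pi>\<^sub>M j\<in>J. std_normal_distribution)) =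
       (\<integral>w. (\<Prod>i\<in>J. iexp (c i * w i)) \<partial>(\<Pi>\<^sub>M j\<in>J. std_normal_distribution))"
      by (simp add: exp_sum[OF J, symmetric] sum_distrib_left)
    also have "\<dots> = (\<Prod>i\<in>J. \<integral>x. iexp (c i * x) \<partial>std_normal_distribution)"
      by (rule product_integral_prod[OF J]) (auto intro!: N.integrable_iexp)
    also have "\<dots> = (\<Prod>i\<in>J. complex_of_real (exp (- (c i)\<^sup>2 / 2)))"
      using char_std_normal_distribution unfolding char_def fun_eq_iff by simp
    also have "\<dots> = complex_of_real (exp (\<Sum>i\<in>J. - (c i)\<^sup>2 / 2))"
      by (simp add: exp_sum[OF J])
    also have "(\<Sum>i\<in>J. - (c i)\<^sup>2 / 2) = - (\<Sum>i\<in>J. \<Sum>j\<in>J. c i * c j * (if i = j then 1 else 0)) / 2"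
    proof -
      have "(\<Sum>j\<in>J. c i * c j * (if i = j then 1 else 0)) = (c i)\<^sup>2" if "i \<in> J" for i
        using J that by (subst sum.cong[OF refl, where h = "\<lambda>j. if i = j then c i * c i else 0"])
          (auto simp: power2_eq_square)
      then show ?thesis by (simp add: sum_divide_distrib sum_negf)
    qed
    finally show ?thesis .
  qed
  moreover have "(\<lambda>w. w j) \<in> borel_measurable (\<Pi>\<^sub>M j\<in>J. std_normal_distribution)" if "j \<in> J" for j
    using measurable_component_singleton[OF that, of "\<lambda>_. std_normal_distribution"] by simp
  ultimately show ?thesis unfolding gaussian_family_def using J prob_space_axioms by auto
qed

text \<open>
The inequality for trigonometric polynomials survives bounded pointwise approximation. On the
right-hand side the error must be uniform in t: replacing p' by f' in one variable costs
at most a multiple of the integral of |p' - f'| against the standard normal law, and that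
law is the marginal of the interpolated variables for every t.
\<close>

lemma gaussian_comparison_C1:
  fixes f f' :: "'i \<Rightarrow> real \<Rightarrow> real" and C1 C0 :: "'i \<Rightarrow> 'i \<Rightarrow> real"
  assumes X: "gaussian_family M J X C1" and Y: "gaussian_family N J Y C0"
    and diag: "\<And>i. i \<in> J \<Longrightarrow> C1 i i = 1" "\<And>i. i \<in> J \<Longrightarrow> C0 i i = 1"
    and f: "\<And>j. j \<in> J \<Longrightarrow> C1_transition B (f j) (f' j)"
    and D: "\<And>t k l. 0 \<le> t \<Longrightarrow> t \<le> 1 \<Longrightarrow> k \<in> J \<Longrightarrow> l \<in> J \<Longrightarrow> k \<noteq> l \<Longrightarrow>
      (\<integral>\<omega>. \<bar>f' k (interpolate t X Y k \<omega>)\<bar> * \<bar>f' l (interpolate t X Y l \<omega>)\<bar> \<partial>(M \<Otimes>\<^sub>M N)) \<le> D k l"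
  shows "\<bar>(\<integral>\<omega>. (\<Prod>j\<in>J. f j (X j \<omega>)) \<partial>M) - (\<integral>\<omega>. (\<Prod>j\<in>J. f j (Y j \<omega>)) \<partial>N)\<bar>
    \<le> (\<Sum>k\<in>J. \<Sum>l\<in>J - {k}. \<bar>C1 k l - C0 k l\<bar> * D k l) / 2"
proof -
  interpret M: prob_space M by (rule gaussian_family_prob_space[OF X])
  interpret N: prob_space N by (rule gaussian_family_prob_space[OF Y])
  interpret SN: prob_space std_normal_distribution by (rule prob_space_std_normal)
  have J: "finite J" by (rule gaussian_family_finite[OF X])
  have "\<forall>j\<in>J. \<exists>p p' S c. trig_approximation B (f j) (f' j) p p' S c"
    using C1_transition_trig_approx[OF f] by blast
  then obtain p p' S c where *: "\<And>j. j \<in> J \<Longrightarrow> trig_approximation B (f j) (f' j) (p j) (p' j) (S j) (c j)"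
    by metis
  have finS: "\<And>j n. j \<in> J \<Longrightarrow> finite (S j n)"
    and rep: "\<And>j n x. j \<in> J \<Longrightarrow> complex_of_real (p j n x) = (\<Sum>s\<in>S j n. c j n s * iexp (s * x))"
    and rep': "\<And>j n x. j \<in> J \<Longrightarrow> complex_of_real (p' j n x) = (\<Sum>s\<in>S j n. (c j n s * (\<i> * s)) * iexp (s * x))"
    and meas: "\<And>j n. j \<in> J \<Longrightarrow> p j n \<in> borel_measurable borel" "\<And>j n. j \<in> J \<Longrightarrow> p' j n \<in> borel_measurable borel"
    and lim: "\<And>j x. j \<in> J \<Longrightarrow> (\<lambda>n. p j n x) \<longlonglongrightarrow> f j x" "\<And>j x. j \<in> J \<Longrightarrow> (\<lambda>n. p' j n x) \<longlonglongrightarrow> f' j x"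
    and bd: "\<And>j n x. j \<in> J \<Longrightarrow> \<bar>p j n x\<bar> \<le> 1 + 2 / real (Suc n)"
    and bd': "\<And>j n x. j \<in> J \<Longrightarrow> \<bar>p' j n x\<bar> \<le> B / cos 1 + 1"
    using * unfolding trig_approximation_def by blast+
  have fmeas: "\<And>j. j \<in> J \<Longrightarrow> f j \<in> borel_measurable borel" "\<And>j. j \<in> J \<Longrightarrow> f' j \<in> borel_measurable borel"
    using C1_transition_measurable[OF f] by auto
  have bdf': "\<bar>f' j x\<bar> \<le> B" if "j \<in> J" for j x using f[OF that] unfolding C1_transition_def by blast
  define K where "K = B / cos 1 + 1"
  have cos1: "cos (1::real) > 0" by (rule cos_gt_zero_pi) (use pi_gt3 in auto)
  have K: "\<bar>p' j n x\<bar> \<le> K" "\<bar>f' j x\<bar> \<le> K" "0 \<le> K" if "j \<in> J" for j n x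
  proof -
    show "\<bar>p' j n x\<bar> \<le> K" using bd'[OF that] unfolding K_def .
    then show "0 \<le> K" by linarith
    have "B \<ge> 0" using bdf'[OF that, of 0] by linarith
    then have "B * cos 1 \<le> B" using cos_le_one[of 1] by (simp add: mult_left_le)
    then have "B \<le> B / cos 1" using cos1 by (simp add: pos_le_divide_eq)
    then show "\<bar>f' j x\<bar> \<le> K" using bdf'[OF that, of x] unfolding K_def by linarith
  qed
  define e where "e j n = (\<integral>x. \<bar>p' j n x - f' j x\<bar> \<partial>std_normal_distribution)" for j n
  have e_lim: "e j \<longlonglongrightarrow> 0" if j: "j \<in> J" for j
  proof -
    have [measurable]: "p' j n \<in> borel_measurable borel" "f' j \<in> borel_measurable borel" for n
      using meas fmeas j by auto
    have "(\<lambda>n. \<integral>x. \<bar>p' j n x - f' j x\<bar> \<partial>std_normal_distribution) \<longlonglongrightarrow> (\<integral>x. 0 \<partial>std_normal_distribution)"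
    proof (rule integral_dominated_convergence[where w = "\<lambda>_. 2 * K"])
      show "AE x in std_normal_distribution. (\<lambda>n. \<bar>p' j n x - f' j x\<bar>) \<longlonglongrightarrow> 0"
        using lim(2)[OF j] by (intro AE_I2 tendsto_rabs_zero) (simp add: LIM_zero)
      have "norm \<bar>p' j n x - f' j x\<bar> \<le> 2 * K" for n x using K(1)[OF j, of n x] K(2)[OF j, of x] by simp
      then show "AE x in std_normal_distribution. norm \<bar>p' j n x - f' j x\<bar> \<le> 2 * K" for n by simp
    qed auto
    then show ?thesis unfolding e_def by simp
  qed
  have Dn: "(\<integral>\<omega>. \<bar>p' k n (interpolate t X Y k \<omega>)\<bar> * \<bar>p' l n (interpolate t X Y l \<omega>)\<bar> \<partial>(M \<Otimes>\<^sub>M N))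
      \<le> D k l + K * (e k n + e l n)"
    if t: "0 \<le> t" "t \<le> 1" and kl: "k \<in> J" "l \<in> J" "k \<noteq> l" for t k l n
  proof -
    let ?Z = "interpolate t X Y"
    note Z = gaussian_family_interpolate[OF X Y t]
    interpret P: prob_space "M \<Otimes>\<^sub>M N" by (rule gaussian_family_prob_space[OF Z])
    have [measurable]: "?Z k \<in> borel_measurable (M \<Otimes>\<^sub>M N)" "?Z l \<in> borel_measurable (M \<Otimes>\<^sub>M N)"
      using gaussian_family_measurable[OF Z] kl by auto
    have [measurable]: "p' k n \<in> borel_measurable borel" "p' l n \<in> borel_measurable borel"
      "f' k \<in> borel_measurable borel" "f' l \<in> borel_measurable borel"
      using meas fmeas kl by auto
    have K0: "0 \<le> K" using K(3)[OF kl(1)] .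
    have e_eq: "(\<integral>\<omega>. \<bar>p' j n (?Z j \<omega>) - f' j (?Z j \<omega>)\<bar> \<partial>(M \<Otimes>\<^sub>M N)) = e j n" if "j \<in> {k, l}" for j
    proof -
      have m: "?Z j \<in> borel_measurable (M \<Otimes>\<^sub>M N)" "(\<lambda>x. \<bar>p' j n x - f' j x\<bar>) \<in> borel_measurable borel"
        using that by auto
      have "distr (M \<Otimes>\<^sub>M N) borel (?Z j) = std_normal_distribution"
        by (rule gaussian_family_marginal[OF Z]) (use that kl diag in auto)
      then show ?thesis unfolding e_def
        using integral_distr[OF m] by simp
    qed
    have i1: "integrable (M \<Otimes>\<^sub>M N) (\<lambda>\<omega>. \<bar>f' k (?Z k \<omega>)\<bar> * \<bar>f' l (?Z l \<omega>)\<bar>)"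
      using K kl K0 by (intro P.integrable_const_bound[where B = "K * K"]) (auto simp: abs_mult intro!: mult_mono)
    have i2: "integrable (M \<Otimes>\<^sub>M N) (\<lambda>\<omega>. \<bar>p' j n (?Z j \<omega>) - f' j (?Z j \<omega>)\<bar>)" if "j \<in> {k, l}" for j
    proof (rule P.integrable_const_bound[where B = "2 * K"])
      have j: "j \<in> J" using that kl by auto
      have "norm \<bar>p' j n x - f' j x\<bar> \<le> 2 * K" for x using K(1)[OF j, of n x] K(2)[OF j, of x] by simp
      then show "AE \<omega> in M \<Otimes>\<^sub>M N. norm \<bar>p' j n (?Z j \<omega>) - f' j (?Z j \<omega>)\<bar> \<le> 2 * K" by simp
    qed (use that in auto)
    have pt: "\<bar>a\<bar> * \<bar>b\<bar> \<le> \<bar>a'\<bar> * \<bar>b'\<bar> + K * (\<bar>a - a'\<bar> + \<bar>b - b'\<bar>)"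
      if "\<bar>a'\<bar> \<le> K" "\<bar>b\<bar> \<le> K" for a b a' b'
    proof -
      have "\<bar>a\<bar> * \<bar>b\<bar> \<le> (\<bar>a'\<bar> + \<bar>a - a'\<bar>) * \<bar>b\<bar>" by (intro mult_right_mono) auto
      also have "\<dots> = \<bar>a'\<bar> * \<bar>b\<bar> + \<bar>a - a'\<bar> * \<bar>b\<bar>" by (simp add: distrib_right)
      also have "\<dots> \<le> \<bar>a'\<bar> * (\<bar>b'\<bar> + \<bar>b - b'\<bar>) + \<bar>a - a'\<bar> * K"
        using that by (intro add_mono mult_left_mono) auto
      also have "\<dots> = \<bar>a'\<bar> * \<bar>b'\<bar> + \<bar>a'\<bar> * \<bar>b - b'\<bar> + \<bar>a - a'\<bar> * K" by (simp add: distrib_left)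
      also have "\<dots> \<le> \<bar>a'\<bar> * \<bar>b'\<bar> + K * \<bar>b - b'\<bar> + \<bar>a - a'\<bar> * K"
        using that by (intro add_mono mult_right_mono) auto
      finally show ?thesis by (simp add: algebra_simps)
    qed
    have "(\<integral>\<omega>. \<bar>p' k n (?Z k \<omega>)\<bar> * \<bar>p' l n (?Z l \<omega>)\<bar> \<partial>(M \<Otimes>\<^sub>M N)) \<le>
      (\<integral>\<omega>. \<bar>f' k (?Z k \<omega>)\<bar> * \<bar>f' l (?Z l \<omega>)\<bar> +
         K * (\<bar>p' k n (?Z k \<omega>) - f' k (?Z k \<omega>)\<bar> + \<bar>p' l n (?Z l \<omega>) - f' l (?Z l \<omega>)\<bar>) \<partial>(M \<Otimes>\<^sub>M N))"
      using i1 i2 K kl pt by (intro integral_mono') auto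
    also have "\<dots> = (\<integral>\<omega>. \<bar>f' k (?Z k \<omega>)\<bar> * \<bar>f' l (?Z l \<omega>)\<bar> \<partial>(M \<Otimes>\<^sub>M N)) + K * (e k n + e l n)"
      using i1 i2 by (simp add: e_eq)
    also have "\<dots> \<le> D k l + K * (e k n + e l n)" using D[OF t kl] by simp
    finally show ?thesis .
  qed
  have main: "\<bar>(\<integral>\<omega>. (\<Prod>j\<in>J. p j n (X j \<omega>)) \<partial>M) - (\<integral>\<omega>. (\<Prod>j\<in>J. p j n (Y j \<omega>)) \<partial>N)\<bar>
      \<le> (1 + 2 / real (Suc n)) ^ card J *
        (\<Sum>k\<in>J. \<Sum>l\<in>J - {k}. \<bar>C1 k l - C0 k l\<bar> * (D k l + K * (e k n + e l n))) / 2" for n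
    by (rule gaussian_interpolation_bound[OF X Y _ finS rep rep' meas _ bd K(1) Dn])
       (use diag in auto)
  have limX: "(\<lambda>n. \<integral>\<omega>. (\<Prod>j\<in>J. p j n (Z j \<omega>)) \<partial>M') \<longlonglongrightarrow> (\<integral>\<omega>. (\<Prod>j\<in>J. f j (Z j \<omega>)) \<partial>M')"
    if Z: "gaussian_family M' J Z CC" for M' :: "'z measure" and Z CC
  proof (rule integral_dominated_convergence[where w = "\<lambda>_. 3 ^ card J"])
    interpret prob_space M' by (rule gaussian_family_prob_space[OF Z])
    have [measurable]: "j \<in> J \<Longrightarrow> Z j \<in> borel_measurable M'" for j by (rule gaussian_family_measurable[OF Z])
    show "(\<lambda>\<omega>. \<Prod>j\<in>J. f j (Z j \<omega>)) \<in> borel_measurable M'"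
      using fmeas by (intro borel_measurable_prod) (auto intro: measurable_compose)
    show "(\<lambda>\<omega>. \<Prod>j\<in>J. p j n (Z j \<omega>)) \<in> borel_measurable M'" for n
      using meas by (intro borel_measurable_prod) (auto intro: measurable_compose)
    show "integrable M' (\<lambda>_. 3 ^ card J :: real)" by simp
    show "AE \<omega> in M'. (\<lambda>n. \<Prod>j\<in>J. p j n (Z j \<omega>)) \<longlonglongrightarrow> (\<Prod>j\<in>J. f j (Z j \<omega>))"
      by (intro AE_I2 tendsto_prod lim(1))
    show "AE \<omega> in M'. norm (\<Prod>j\<in>J. p j n (Z j \<omega>)) \<le> 3 ^ card J" for n
    proof (intro AE_I2)
      fix \<omega>
      have "norm (\<Prod>j\<in>J. p j n (Z j \<omega>)) = (\<Prod>j\<in>J. \<bar>p j n (Z j \<omega>)\<bar>)" by (simp add: abs_prod)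
      also have "\<dots> \<le> (\<Prod>j\<in>J. 3)"
      proof (intro prod_mono conjI)
        fix j assume "j \<in> J"
        moreover have "2 / real (Suc n) \<le> 2" by (simp add: field_simps)
        ultimately show "\<bar>p j n (Z j \<omega>)\<bar> \<le> 3" using bd[of j n "Z j \<omega>"] by linarith
      qed simp
      finally show "norm (\<Prod>j\<in>J. p j n (Z j \<omega>)) \<le> 3 ^ card J" by simp
    qed
  qed
  have lim1: "(\<lambda>n. 1 + 2 / real (Suc n)) \<longlonglongrightarrow> 1 + 2 * 0"
    using tendsto_add[OF tendsto_const tendsto_mult[OF tendsto_const LIMSEQ_inverse_real_of_nat]]
    by (simp add: divide_inverse)
  have "(\<lambda>n. (1 + 2 / real (Suc n)) ^ card J *
        (\<Sum>k\<in>J. \<Sum>l\<in>J - {k}. \<bar>C1 k l - C0 k l\<bar> * (D k l + K * (e k n + e l n))) / 2) \<longlonglongrightarrow>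
      (1 + 2 * 0) ^ card J *
        (\<Sum>k\<in>J. \<Sum>l\<in>J - {k}. \<bar>C1 k l - C0 k l\<bar> * (D k l + K * (0 + 0))) / 2"
    by (intro tendsto_intros lim1 e_lim) auto
  from LIMSEQ_le[OF tendsto_rabs[OF tendsto_diff[OF limX[OF X] limX[OF Y]]] this] main
  show ?thesis by auto
qed

section \<open>The normal comparison inequality\<close>

definition hat :: "real \<Rightarrow> real" where
  "hat y = 4 * max 0 y - 8 * max 0 (y - 1 / 2) + 4 * max 0 (y - 1)"

text \<open>
A quadratic spline with a piecewise linear derivative rises from 0 to 1 on [0, 1]. Built from squares of positive parts, it
has only one kind of joint to check.
\<close>

definition smooth_step :: "real \<Rightarrow> real" where
  "smooth_step y = 2 * (max 0 y)\<^sup>2 - 4 * (max 0 (y - 1 / 2))\<^sup>2 + 2 * (max 0 (y - 1))\<^sup>2"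

lemma DERIV_max_0_power2: "((\<lambda>y::real. (max 0 y)\<^sup>2) has_real_derivative 2 * max 0 x) (at x)"
proof -
  consider "x < 0" | "x = 0" | "x > 0" by linarith
  then show ?thesis
  proof cases
    case 1
    have "((\<lambda>y::real. 0) has_real_derivative 0) (at x)" by simp
    then have "((\<lambda>y::real. (max 0 y)\<^sup>2) has_real_derivative 0) (at x)"
      by (rule has_field_derivative_transform_within_open[where S = "{..<0}"]) (use 1 in auto)
    then show ?thesis using 1 by simp
  next
    case 2
    have "(\<lambda>h::real. ((max 0 (0 + h))\<^sup>2 - (max 0 0)\<^sup>2) / h) = (\<lambda>h. max 0 h)"
      by (auto simp: fun_eq_iff max_def power2_eq_square)
    moreover have "((\<lambda>h::real. max 0 h) \<longlongrightarrow> max 0 0) (at 0)" by (intro tendsto_intros)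
    ultimately show ?thesis using 2 unfolding DERIV_def by simp
  next
    case 3
    have "((\<lambda>y::real. y\<^sup>2) has_real_derivative 2 * x) (at x)" by (auto intro!: derivative_eq_intros)
    then have "((\<lambda>y::real. (max 0 y)\<^sup>2) has_real_derivative 2 * x) (at x)"
      by (rule has_field_derivative_transform_within_open[where S = "{0<..}"]) (use 3 in \<open>auto simp: max_def\<close>)
    then show ?thesis using 3 by simp
  qed
qed

lemma DERIV_smooth_step: "(smooth_step has_real_derivative hat x) (at x)"
proof -
  have "((\<lambda>y. (max 0 (y - c))\<^sup>2) has_real_derivative 2 * max 0 (x - c)) (at x)" for c
  proof -
    have "((\<lambda>y. y - c) has_real_derivative 1) (at x)" by (auto intro!: derivative_eq_intros)
    from DERIV_chain2[OF DERIV_max_0_power2 this] show ?thesis by simp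
  qed
  note d = this
  have "((\<lambda>y. 2 * (max 0 (y - 0))\<^sup>2 - 4 * (max 0 (y - 1 / 2))\<^sup>2 + 2 * (max 0 (y - 1))\<^sup>2) has_real_derivative
      2 * (2 * max 0 (x - 0)) - 4 * (2 * max 0 (x - 1 / 2)) + 2 * (2 * max 0 (x - 1))) (at x)"
    by (intro DERIV_add DERIV_diff DERIV_cmult d)
  then show ?thesis unfolding smooth_step_def[abs_def] hat_def by simp
qed

lemma continuous_on_hat: "continuous_on UNIV hat"
  unfolding hat_def[abs_def] by (intro continuous_intros)

lemma hat_bounds: "0 \<le> hat x" "hat x \<le> 2"
  unfolding hat_def by (auto simp: max_def)

lemma hat_outside: "x \<le> 0 \<or> x \<ge> 1 \<Longrightarrow> hat x = 0"
  unfolding hat_def by (auto simp: max_def)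

lemma smooth_step_le_0: "x \<le> 0 \<Longrightarrow> smooth_step x = 0"
  unfolding smooth_step_def by (auto simp: max_def)

lemma smooth_step_ge_1: "x \<ge> 1 \<Longrightarrow> smooth_step x = 1"
  unfolding smooth_step_def by (auto simp: max_def power2_eq_square algebra_simps)

lemma smooth_step_mono: "x \<le> y \<Longrightarrow> smooth_step x \<le> smooth_step y"
  by (rule DERIV_nonneg_imp_nondecreasing) (use DERIV_smooth_step hat_bounds in blast)+

lemma smooth_step_bounds: "0 \<le> smooth_step x" "smooth_step x \<le> 1"
  using smooth_step_mono[of "min x 0" x] smooth_step_mono[of x "max x 1"]
    smooth_step_le_0[of "min x 0"] smooth_step_ge_1[of "max x 1"] by auto

lemma DERIV_smooth_step_scaled:
  assumes "\<delta> > 0"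
  shows "((\<lambda>x. smooth_step ((x - u) / \<delta>)) has_real_derivative hat ((x - u) / \<delta>) / \<delta>) (at x)"
proof -
  have "((\<lambda>x. (x - u) / \<delta>) has_real_derivative 1 / \<delta>) (at x)"
    using assms by (auto intro!: derivative_eq_intros)
  from DERIV_chain2[OF DERIV_smooth_step this] show ?thesis by simp
qed

lemma C1_transition_step:
  assumes d: "\<delta> > 0"
  shows "C1_transition (2 / \<delta>) (\<lambda>x. 1 - smooth_step ((x - u) / \<delta>)) (\<lambda>x. - (hat ((x - u) / \<delta>) / \<delta>))"
  unfolding C1_transition_def
proof (intro conjI allI)
  show "((\<lambda>x. 1 - smooth_step ((x - u) / \<delta>)) has_real_derivative - (hat ((x - u) / \<delta>) / \<delta>)) (at x)" for x
    using DERIV_diff[OF DERIV_const DERIV_smooth_step_scaled[OF d]] by simp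
  show "continuous_on UNIV (\<lambda>x. - (hat ((x - u) / \<delta>) / \<delta>))"
    using d by (intro continuous_intros continuous_on_compose2[OF continuous_on_hat]) auto
  show "\<exists>A. \<forall>x. A \<le> \<bar>x\<bar> \<longrightarrow> - (hat ((x - u) / \<delta>) / \<delta>) = 0"
  proof (intro exI allI impI)
    fix x assume "\<bar>u\<bar> + \<delta> \<le> \<bar>x\<bar>"
    then have "(x - u) / \<delta> \<le> 0 \<or> (x - u) / \<delta> \<ge> 1"
      using d by (auto simp: divide_le_0_iff le_divide_eq)
    then show "- (hat ((x - u) / \<delta>) / \<delta>) = 0" using hat_outside by simp
  qed
  show "0 \<le> 1 - smooth_step ((x - u) / \<delta>)" "1 - smooth_step ((x - u) / \<delta>) \<le> 1" for x
    using smooth_step_bounds[of "(x - u) / \<delta>"] by auto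
  show "\<bar>- (hat ((x - u) / \<delta>) / \<delta>)\<bar> \<le> 2 / \<delta>" for x
    using d hat_bounds[of "(x - u) / \<delta>"] by (simp add: divide_right_mono)
qed

text \<open>
The difference of two shifted steps is a C1 function between the indicators of two concentric intervals.
\<close>

lemma C1_transition_bump:
  assumes e: "\<eta> > 0"
  obtains g g' where "C1_transition (4 / \<eta>) g g'" "\<And>x. \<bar>x - \<alpha>\<bar> \<le> \<eta> \<Longrightarrow> g x = 1"
    "\<And>x. g x \<le> indicator {\<alpha> - 2 * \<eta>..\<alpha> + 2 * \<eta>} x"
proof
  let ?g = "\<lambda>x. smooth_step ((x - (\<alpha> - 2 * \<eta>)) / \<eta>) - smooth_step ((x - (\<alpha> + \<eta>)) / \<eta>)"
  let ?g' = "\<lambda>x. hat ((x - (\<alpha> - 2 * \<eta>)) / \<eta>) / \<eta> - hat ((x - (\<alpha> + \<eta>)) / \<eta>) / \<eta>"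
  have le: "(x - (\<alpha> + \<eta>)) / \<eta> \<le> (x - (\<alpha> - 2 * \<eta>)) / \<eta>" for x
    using e by (intro divide_right_mono) auto
  show "C1_transition (4 / \<eta>) ?g ?g'"
    unfolding C1_transition_def
  proof (intro conjI allI)
    show "(?g has_real_derivative ?g' x) (at x)" for x
      by (rule DERIV_diff[OF DERIV_smooth_step_scaled[OF e] DERIV_smooth_step_scaled[OF e]])
    show "continuous_on UNIV ?g'"
      using e by (intro continuous_intros continuous_on_compose2[OF continuous_on_hat]) auto
    show "\<exists>A. \<forall>x. A \<le> \<bar>x\<bar> \<longrightarrow> ?g' x = 0"
    proof (intro exI allI impI)
      fix x assume *: "\<bar>\<alpha>\<bar> + 2 * \<eta> \<le> \<bar>x\<bar>"
      have "(x - (\<alpha> - 2 * \<eta>)) / \<eta> \<le> 0 \<or> (x - (\<alpha> - 2 * \<eta>)) / \<eta> \<ge> 1"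
        "(x - (\<alpha> + \<eta>)) / \<eta> \<le> 0 \<or> (x - (\<alpha> + \<eta>)) / \<eta> \<ge> 1"
        using * e by (auto simp: divide_le_0_iff le_divide_eq)
      then show "?g' x = 0" using hat_outside by simp
    qed
    show "0 \<le> ?g x" for x using smooth_step_mono[OF le] by simp
    show "?g x \<le> 1" for x
      using smooth_step_bounds(2)[of "(x - (\<alpha> - 2 * \<eta>)) / \<eta>"] smooth_step_bounds(1)[of "(x - (\<alpha> + \<eta>)) / \<eta>"] by linarith
    show "\<bar>?g' x\<bar> \<le> 4 / \<eta>" for x
    proof -
      have "\<bar>?g' x\<bar> = \<bar>hat ((x - (\<alpha> - 2 * \<eta>)) / \<eta>) - hat ((x - (\<alpha> + \<eta>)) / \<eta>)\<bar> / \<eta>"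
        using e by (simp add: diff_divide_distrib[symmetric])
      also have "\<dots> \<le> 4 / \<eta>"
        using e hat_bounds[of "(x - (\<alpha> - 2 * \<eta>)) / \<eta>"] hat_bounds[of "(x - (\<alpha> + \<eta>)) / \<eta>"]
        by (intro divide_right_mono) auto
      finally show ?thesis .
    qed
  qed
  show "?g x = 1" if "\<bar>x - \<alpha>\<bar> \<le> \<eta>" for x
  proof -
    have "(x - (\<alpha> - 2 * \<eta>)) / \<eta> \<ge> 1" "(x - (\<alpha> + \<eta>)) / \<eta> \<le> 0"
      using that e by (auto simp: divide_le_0_iff le_divide_eq)
    then show ?thesis by (simp add: smooth_step_ge_1 smooth_step_le_0)
  qed
  show "?g x \<le> indicator {\<alpha> - 2 * \<eta>..\<alpha> + 2 * \<eta>} x" for x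
  proof -
    consider "x < \<alpha> - 2 * \<eta>" | "x > \<alpha> + 2 * \<eta>" | "x \<in> {\<alpha> - 2 * \<eta>..\<alpha> + 2 * \<eta>}" by fastforce
    then show ?thesis
    proof cases
      case 1
      then have "(x - (\<alpha> - 2 * \<eta>)) / \<eta> \<le> 0" "(x - (\<alpha> + \<eta>)) / \<eta> \<le> 0"
        using e by (auto simp: divide_le_0_iff)
      then show ?thesis by (simp add: smooth_step_le_0)
    next
      case 2
      then have "(x - (\<alpha> - 2 * \<eta>)) / \<eta> \<ge> 1" "(x - (\<alpha> + \<eta>)) / \<eta> \<ge> 1"
        using e by (auto simp: le_divide_eq)
      then show ?thesis by (simp add: smooth_step_ge_1)
    next
      case 3
      then show ?thesis
        using smooth_step_bounds(2)[of "(x - (\<alpha> - 2 * \<eta>)) / \<eta>"] smooth_step_bounds(1)[of "(x - (\<alpha> + \<eta>)) / \<eta>"] by simp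
    qed
  qed
qed

lemma std_normal_interval_le:
  assumes "a \<le> b" "0 \<le> K" "\<And>x. x \<in> {a..b} \<Longrightarrow> exp (- x\<^sup>2 / 2) \<le> K"
  shows "measure std_normal_distribution {a..b} \<le> (b - a) * K"
proof -
  have "emeasure std_normal_distribution {a..b} = (\<integral>\<^sup>+x. ennreal (std_normal_density x) * indicator {a..b} x \<partial>lborel)"
    by (subst emeasure_density) auto
  also have "\<dots> \<le> (\<integral>\<^sup>+x. ennreal K * indicator {a..b} x \<partial>lborel)"
  proof (intro nn_integral_mono)
    fix x :: real
    have "std_normal_density x \<le> K" if "x \<in> {a..b}"
    proof -
      have "sqrt (2 * pi) \<ge> 1" using pi_gt3 by simp
      then have "std_normal_density x \<le> exp (- x\<^sup>2 / 2)"
        unfolding std_normal_density_def by (simp add: field_simps)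
      then show ?thesis using assms(3)[OF that] by linarith
    qed
    then show "ennreal (std_normal_density x) * indicator {a..b} x \<le> ennreal K * indicator {a..b} x"
      by (auto simp: indicator_def intro!: ennreal_leI)
  qed
  also have "\<dots> = ennreal ((b - a) * K)"
    using assms by (simp add: nn_integral_cmult_indicator ennreal_mult[symmetric] mult.commute)
  finally show ?thesis unfolding measure_def
    using assms by (intro enn2real_leI) auto
qed

text \<open>
The normalised sum and difference of the two variables form a Gaussian family with identity covariance.
Comparing it with an independent pair, where all covariance differences vanish, shows that
expectations of products of bumps factorise. Both factors are of order \<delta>, and the factor
of the sum carries the exponential decay. The exponent only sees u + v, which is sharp for u = v.
\<close>

lemma gaussian_pair_box_le:
  assumes Z: "gaussian_family M J Z C" and kl: "k \<in> J" "l \<in> J" "k \<noteq> l"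
    and C: "C k k = 1" "C l l = 1" "C l k = C k l" "\<bar>C k l\<bar> \<le> r" "r < 1"
    and d: "0 < \<delta>" "\<delta> \<le> u + v"
  shows "measure M {\<omega> \<in> space M. Z k \<omega> \<in> {u..u + \<delta>} \<and> Z l \<omega> \<in> {v..v + \<delta>}}
     \<le> 8 * \<delta>\<^sup>2 / (1 - r) * exp (- (u + v - \<delta>)\<^sup>2 / (4 * (1 + r)))"
proof -
  interpret M: prob_space M by (rule gaussian_family_prob_space[OF Z])
  interpret N: prob_space std_normal_distribution by (rule prob_space_std_normal)
  interpret PN: product_prob_space "\<lambda>_. std_normal_distribution" "UNIV :: bool set" by unfold_locales
  have J: "finite J" by (rule gaussian_family_finite[OF Z])
  have mZ[measurable]: "Z k \<in> borel_measurable M" "Z l \<in> borel_measurable M"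
    using gaussian_family_measurable[OF Z] kl by auto
  define q where "q = C k l"
  have q: "\<bar>q\<bar> \<le> r" "-1 < q" "q < 1" using C unfolding q_def by auto
  define s1 where "s1 = sqrt (2 * (1 + q))"
  define s2 where "s2 = sqrt (2 * (1 - q))"
  have s: "s1 > 0" "s2 > 0" "s1\<^sup>2 = 2 * (1 + q)" "s2\<^sup>2 = 2 * (1 - q)"
    using q unfolding s1_def s2_def by auto
  \<comment> \<open>The index True stands for the normalised sum, False for the normalised difference.\<close>
  define A where "A i j = (if i then (if j = k then 1 / s1 else if j = l then 1 / s1 else 0)
     else (if j = k then 1 / s2 else if j = l then - 1 / s2 else 0))" for i :: bool and j
  have sumA: "(\<Sum>j\<in>J. A i j * h j) = A i k * h k + A i l * h l" for i and h :: "'b \<Rightarrow> real"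
  proof -
    have "(\<Sum>j\<in>J. A i j * h j) = (\<Sum>j\<in>{k, l}. A i j * h j)"
      using J kl by (intro sum.mono_neutral_right) (auto simp: A_def)
    then show ?thesis using kl by simp
  qed
  define W where "W i \<omega> = (\<Sum>j\<in>J. A i j * Z j \<omega>)" for i \<omega>
  have W: "W True \<omega> = (Z k \<omega> + Z l \<omega>) / s1" "W False \<omega> = (Z k \<omega> - Z l \<omega>) / s2" for \<omega>
    unfolding W_def sumA using kl by (auto simp: A_def add_divide_distrib diff_divide_distrib)
  have covW: "(\<Sum>j\<in>J. \<Sum>j'\<in>J. A i j * A i' j' * C j j') = (if i = i' then 1 else 0)" for i i'
  proof -
    have "(\<Sum>j\<in>J. \<Sum>j'\<in>J. A i j * A i' j' * C j j') = (\<Sum>j\<in>J. A i j * (\<Sum>j'\<in>J. A i' j' * C j j'))"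
      by (simp add: sum_distrib_left mult.assoc)
    also have "\<dots> = A i k * (A i' k * 1 + A i' l * q) + A i l * (A i' k * q + A i' l * 1)"
      unfolding sumA using C by (simp add: q_def)
    also have "\<dots> = (if i = i' then 1 else 0)"
    proof -
      have "1 / s1 * (1 / s1 * 1 + 1 / s1 * q) + 1 / s1 * (1 / s1 * q + 1 / s1 * 1) = 2 * (1 + q) / s1\<^sup>2"
        by (simp add: power2_eq_square add_divide_distrib algebra_simps)
      moreover have "1 / s2 * (1 / s2 * 1 + - 1 / s2 * q) + - 1 / s2 * (1 / s2 * q + - 1 / s2 * 1) = 2 * (1 - q) / s2\<^sup>2"
        by (simp add: power2_eq_square add_divide_distrib diff_divide_distrib algebra_simps)
      ultimately show ?thesis using kl s q
        by (cases i; cases i') (auto simp: A_def algebra_simps)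
    qed
    finally show ?thesis .
  qed
  have gW: "gaussian_family M UNIV W (\<lambda>i i'. if i = i' then 1 else 0)"
    using gaussian_family_linear[OF Z, of "UNIV :: bool set" A] unfolding covW W_def[abs_def] by simp
  have gI: "gaussian_family (\<Pi>\<^sub>M j\<in>(UNIV::bool set). std_normal_distribution) UNIV (\<lambda>j w. w j) (\<lambda>i j. if i = j then 1 else 0)"
    by (rule gaussian_family_iid) simp
  define \<alpha> where "\<alpha> i = (if i then (u + v + \<delta>) / s1 else (u - v) / s2)" for i
  define \<eta> where "\<eta> i = (if i then \<delta> / s1 else \<delta> / s2)" for i
  have \<eta>: "\<eta> i > 0" for i using d s by (simp add: \<eta>_def)
  define B where "B = 4 / min (\<eta> True) (\<eta> False)"
  have B: "4 / \<eta> i \<le> B" "0 \<le> B" for i unfolding B_def using \<eta> by (cases i; auto intro!: frac_le simp: less_imp_le)+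
  have "\<forall>i. \<exists>g g'. C1_transition (4 / \<eta> i) g g' \<and> (\<forall>x. \<bar>x - \<alpha> i\<bar> \<le> \<eta> i \<longrightarrow> g x = 1) \<and>
     (\<forall>x. g x \<le> indicator {\<alpha> i - 2 * \<eta> i..\<alpha> i + 2 * \<eta> i} x)"
    using C1_transition_bump[OF \<eta>] by metis
  then obtain g g' where g: "\<And>i. C1_transition (4 / \<eta> i) (g i) (g' i)"
    "\<And>i x. \<bar>x - \<alpha> i\<bar> \<le> \<eta> i \<Longrightarrow> g i x = 1" "\<And>i x. g i x \<le> indicator {\<alpha> i - 2 * \<eta> i..\<alpha> i + 2 * \<eta> i} x"
    by metis
  have gB: "C1_transition B (g i) (g' i)" for i
    using g(1)[of i] B(1)[of i] unfolding C1_transition_def by (meson order_trans)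
  have gb: "0 \<le> g i x" "g i x \<le> 1" "\<bar>g' i x\<bar> \<le> B" for i x using gB[of i] unfolding C1_transition_def by auto
  have [measurable]: "g i \<in> borel_measurable borel" "g' i \<in> borel_measurable borel" for i
    using C1_transition_measurable[OF gB] by auto
  have [measurable]: "W i \<in> borel_measurable M" for i
    using gaussian_family_measurable[OF gW] by simp
  have bd: "(\<integral>\<omega>. \<bar>g' k (interpolate t W (\<lambda>j w. w j) k \<omega>)\<bar> * \<bar>g' l (interpolate t W (\<lambda>j w. w j) l \<omega>)\<bar>
       \<partial>(M \<Otimes>\<^sub>M (\<Pi>\<^sub>M j\<in>(UNIV::bool set). std_normal_distribution))) \<le> B * B"
    if t: "0 \<le> t" "t \<le> 1" for t :: real and k l :: bool
  proof -
    interpret P: prob_space "M \<Otimes>\<^sub>M (\<Pi>\<^sub>M j\<in>(UNIV::bool set). std_normal_distribution)"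
      by (rule gaussian_family_prob_space[OF gaussian_family_interpolate[OF gW gI t]])
    show ?thesis
      by (rule order_trans[OF integral_mono'[where f = "\<lambda>_. B * B"]]) (use gb B in \<open>auto intro!: mult_mono simp: P.prob_space\<close>)
  qed
  from gaussian_comparison_C1[OF gW gI, where f = g and f' = g' and B = B and D = "\<lambda>_ _. B * B"] gB bd
  have "(\<integral>\<omega>. (\<Prod>i\<in>UNIV. g i (W i \<omega>)) \<partial>M) =
      (\<integral>w. (\<Prod>i\<in>UNIV. g i (w i)) \<partial>(\<Pi>\<^sub>M j\<in>(UNIV::bool set). std_normal_distribution))"
    by simp
  also have "\<dots> = (\<Prod>i\<in>UNIV. \<integral>x. g i x \<partial>std_normal_distribution)"
    by (rule PN.product_integral_prod) (use gb in \<open>auto intro!: N.integrable_const_bound[where B = 1]\<close>)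
  also have "\<dots> \<le> (\<Prod>i\<in>UNIV. measure std_normal_distribution {\<alpha> i - 2 * \<eta> i..\<alpha> i + 2 * \<eta> i})"
  proof (intro prod_mono conjI)
    fix i
    show "0 \<le> (\<integral>x. g i x \<partial>std_normal_distribution)" using gb by (intro integral_nonneg_AE) auto
    have "(\<integral>x. g i x \<partial>std_normal_distribution) \<le> (\<integral>x. indicator {\<alpha> i - 2 * \<eta> i..\<alpha> i + 2 * \<eta> i} x \<partial>std_normal_distribution)"
      using g(3) by (intro integral_mono') (auto intro!: integrable_real_indicator simp: N.emeasure_finite less_top[symmetric])
    then show "(\<integral>x. g i x \<partial>std_normal_distribution) \<le> measure std_normal_distribution {\<alpha> i - 2 * \<eta> i..\<alpha> i + 2 * \<eta> i}"
      by simp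
  qed
  also have "\<dots> = measure std_normal_distribution {\<alpha> True - 2 * \<eta> True..\<alpha> True + 2 * \<eta> True} *
      measure std_normal_distribution {\<alpha> False - 2 * \<eta> False..\<alpha> False + 2 * \<eta> False}"
    by (simp add: UNIV_bool mult.commute)
  also have "\<dots> \<le> ((\<alpha> True + 2 * \<eta> True - (\<alpha> True - 2 * \<eta> True)) * exp (- ((u + v - \<delta>) / s1)\<^sup>2 / 2)) *
     ((\<alpha> False + 2 * \<eta> False - (\<alpha> False - 2 * \<eta> False)) * 1)"
  proof (intro mult_mono std_normal_interval_le)
    fix x assume "x \<in> {\<alpha> True - 2 * \<eta> True..\<alpha> True + 2 * \<eta> True}"
    then have "(u + v - \<delta>) / s1 \<le> x" unfolding \<alpha>_def \<eta>_def
      by (simp add: diff_divide_distrib add_divide_distrib)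
    moreover have "0 \<le> (u + v - \<delta>) / s1" using d s by simp
    ultimately have "((u + v - \<delta>) / s1)\<^sup>2 \<le> x\<^sup>2" by (intro power_mono) auto
    then show "exp (- x\<^sup>2 / 2) \<le> exp (- ((u + v - \<delta>) / s1)\<^sup>2 / 2)" by simp
  qed (use \<eta> in \<open>auto simp: less_imp_le\<close>)
  also have "\<dots> = 16 * \<delta>\<^sup>2 / (s1 * s2) * exp (- ((u + v - \<delta>) / s1)\<^sup>2 / 2)"
    using s by (simp add: \<eta>_def power2_eq_square)
  also have "\<dots> \<le> 16 * \<delta>\<^sup>2 / (2 * (1 - r)) * exp (- (u + v - \<delta>)\<^sup>2 / (4 * (1 + r)))"
  proof (rule mult_mono)
    have "1 - r \<le> 1 - \<bar>q\<bar>" using q by simp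
    also have "\<dots> = sqrt ((1 - \<bar>q\<bar>)\<^sup>2)" using q by simp
    also have "\<dots> \<le> sqrt ((1 + q) * (1 - q))"
    proof (rule real_sqrt_le_mono)
      have "\<bar>q\<bar> * \<bar>q\<bar> \<le> \<bar>q\<bar>" using q by (intro mult_left_le) auto
      then show "(1 - \<bar>q\<bar>)\<^sup>2 \<le> (1 + q) * (1 - q)"
        by (simp add: power2_eq_square algebra_simps)
    qed
    finally have "1 - r \<le> sqrt ((1 + q) * (1 - q))" .
    moreover have "2 * sqrt ((1 + q) * (1 - q)) = s1 * s2"
    proof -
      have "s1 * s2 = sqrt (2\<^sup>2 * ((1 + q) * (1 - q)))"
        unfolding s1_def s2_def real_sqrt_mult[symmetric] by (rule arg_cong[where f = sqrt]) algebra
      then show ?thesis by (simp only: real_sqrt_mult real_sqrt_abs)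
    qed
    ultimately have "2 * (1 - r) \<le> s1 * s2" by (metis mult_left_mono zero_le_numeral)
    then show "16 * \<delta>\<^sup>2 / (s1 * s2) \<le> 16 * \<delta>\<^sup>2 / (2 * (1 - r))"
      using s C by (intro divide_left_mono) auto
    have "((u + v - \<delta>) / s1)\<^sup>2 / 2 = (u + v - \<delta>)\<^sup>2 / (4 * (1 + q))"
      using s by (simp add: power_divide)
    moreover have "(u + v - \<delta>)\<^sup>2 / (4 * (1 + r)) \<le> (u + v - \<delta>)\<^sup>2 / (4 * (1 + q))"
      using q by (intro divide_left_mono) auto
    ultimately show "exp (- ((u + v - \<delta>) / s1)\<^sup>2 / 2) \<le> exp (- (u + v - \<delta>)\<^sup>2 / (4 * (1 + r)))"
      by (simp only: exp_le_cancel_iff minus_divide_left[symmetric] neg_le_iff_le)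
  qed (use s C in auto)
  also have "\<dots> = 8 * \<delta>\<^sup>2 / (1 - r) * exp (- (u + v - \<delta>)\<^sup>2 / (4 * (1 + r)))"
    using mult_divide_mult_cancel_left[of 2 "8 * \<delta>\<^sup>2" "1 - r"] by simp
  finally have bound: "(\<integral>\<omega>. (\<Prod>i\<in>UNIV. g i (W i \<omega>)) \<partial>M) \<le> 8 * \<delta>\<^sup>2 / (1 - r) * exp (- (u + v - \<delta>)\<^sup>2 / (4 * (1 + r)))" .
  let ?E = "{\<omega> \<in> space M. Z k \<omega> \<in> {u..u + \<delta>} \<and> Z l \<omega> \<in> {v..v + \<delta>}}"
  have "measure M ?E = (\<integral>\<omega>. indicator ?E \<omega> \<partial>M)" by simp
  also have "\<dots> \<le> (\<integral>\<omega>. (\<Prod>i\<in>UNIV. g i (W i \<omega>)) \<partial>M)"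
  proof (rule integral_mono')
    show "integrable M (\<lambda>\<omega>. \<Prod>i\<in>UNIV. g i (W i \<omega>))"
      using gb by (intro M.integrable_const_bound[where B = 1]) (auto simp: UNIV_bool abs_mult intro!: mult_le_one)
    show "0 \<le> (\<Prod>i\<in>UNIV. g i (W i \<omega>))" for \<omega> using gb by (intro prod_nonneg) auto
    fix \<omega> assume "\<omega> \<in> space M"
    show "indicator ?E \<omega> \<le> (\<Prod>i\<in>UNIV. g i (W i \<omega>))"
    proof (cases "\<omega> \<in> ?E")
      case True
      have "\<bar>W True \<omega> - \<alpha> True\<bar> = \<bar>Z k \<omega> + Z l \<omega> - (u + v + \<delta>)\<bar> / s1"
        unfolding W \<alpha>_def using s by (simp add: diff_divide_distrib[symmetric])
      also have "\<dots> \<le> \<eta> True" unfolding \<eta>_def using True s by (auto intro!: divide_right_mono)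
      finally have 1: "g True (W True \<omega>) = 1" by (rule g(2))
      have "\<bar>W False \<omega> - \<alpha> False\<bar> = \<bar>Z k \<omega> - Z l \<omega> - (u - v)\<bar> / s2"
        unfolding W \<alpha>_def using s by (simp add: diff_divide_distrib[symmetric])
      also have "\<dots> \<le> \<eta> False" unfolding \<eta>_def using True s by (auto intro!: divide_right_mono)
      finally have 2: "g False (W False \<omega>) = 1" by (rule g(2))
      show ?thesis using 1 2 by (simp add: UNIV_bool)
    next
      case False
      then show ?thesis using gb by (auto simp: indicator_def intro!: prod_nonneg)
    qed
  qed
  finally show ?thesis using bound by linarith
qed

text \<open>
Indicators are smoothed over a length \<delta>. The product of the two derivatives is of order \<delta> to the power -2, the
probability of the box on which it lives is of order \<delta>^2, and so \<delta> can tend to 0 with a bound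
that keeps the size of the bivariate density.
\<close>

theorem normal_comparison:
  fixes X :: "'i \<Rightarrow> 'a \<Rightarrow> real" and Y :: "'i \<Rightarrow> 'b \<Rightarrow> real" and C1 C0 :: "'i \<Rightarrow> 'i \<Rightarrow> real"
  assumes X: "gaussian_family M J X C1" and Y: "gaussian_family N J Y C0"
    and diag: "\<And>i. i \<in> J \<Longrightarrow> C1 i i = 1" "\<And>i. i \<in> J \<Longrightarrow> C0 i i = 1"
    and sym: "\<And>i j. i \<in> J \<Longrightarrow> j \<in> J \<Longrightarrow> C1 i j = C1 j i" "\<And>i j. i \<in> J \<Longrightarrow> j \<in> J \<Longrightarrow> C0 i j = C0 j i"
    and r: "\<And>i j. i \<in> J \<Longrightarrow> j \<in> J \<Longrightarrow> i \<noteq> j \<Longrightarrow> \<bar>C1 i j\<bar> \<le> r i j \<and> \<bar>C0 i j\<bar> \<le> r i j \<and> r i j < 1"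
    and u: "\<And>i. i \<in> J \<Longrightarrow> u i > 0"
  shows "\<bar>measure M {\<omega> \<in> space M. \<forall>j\<in>J. X j \<omega> \<le> u j} - measure N {\<omega> \<in> space N. \<forall>j\<in>J. Y j \<omega> \<le> u j}\<bar>
    \<le> 16 * (\<Sum>k\<in>J. \<Sum>l\<in>J - {k}. \<bar>C1 k l - C0 k l\<bar> / (1 - r k l) * exp (- (u k + u l)\<^sup>2 / (4 * (1 + r k l))))"
proof -
  have J: "finite J" by (rule gaussian_family_finite[OF X])
  obtain m where m: "m > 0" "\<And>i. i \<in> J \<Longrightarrow> m \<le> u i"
  proof
    show "Min (insert 1 (u ` J)) > 0" using J u by (auto simp: Min_gr_iff)
    show "i \<in> J \<Longrightarrow> Min (insert 1 (u ` J)) \<le> u i" for i using J by (intro Min_le) auto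
  qed
  define \<delta> where "\<delta> n = m / real (Suc n)" for n
  have \<delta>: "\<delta> n > 0" "\<delta> n \<le> m" for n using m by (auto simp: \<delta>_def field_simps)
  have \<delta>0: "\<delta> \<longlonglongrightarrow> 0"
    unfolding \<delta>_def using tendsto_mult[OF tendsto_const LIMSEQ_inverse_real_of_nat, of m] by (simp add: divide_inverse)
  define f where "f n j x = 1 - smooth_step ((x - u j) / \<delta> n)" for n j x
  define f' where "f' n j x = - (hat ((x - u j) / \<delta> n) / \<delta> n)" for n j x
  have f: "C1_transition (2 / \<delta> n) (f n j) (f' n j)" for n j
    using C1_transition_step[OF \<delta>(1)] unfolding f_def[abs_def] f'_def[abs_def] .
  have fb: "0 \<le> f n j x" "f n j x \<le> 1" "\<bar>f' n j x\<bar> \<le> 2 / \<delta> n" for n j x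
    using f[of n j] unfolding C1_transition_def by auto
  have f'0: "f' n j x = 0" if "x \<notin> {u j..u j + \<delta> n}" for n j x
  proof -
    have "(x - u j) / \<delta> n \<le> 0 \<or> (x - u j) / \<delta> n \<ge> 1"
      using that \<delta>(1)[of n] by (auto simp: divide_le_0_iff le_divide_eq)
    then show ?thesis unfolding f'_def using hat_outside by simp
  qed
  have [measurable]: "f n j \<in> borel_measurable borel" "f' n j \<in> borel_measurable borel" for n j
    using C1_transition_measurable[OF f] by auto
  define D where "D n k l = 32 / (1 - r k l) * exp (- (u k + u l - \<delta> n)\<^sup>2 / (4 * (1 + r k l)))" for n k l
  have main: "\<bar>(\<integral>\<omega>. (\<Prod>j\<in>J. f n j (X j \<omega>)) \<partial>M) - (\<integral>\<omega>. (\<Prod>j\<in>J. f n j (Y j \<omega>)) \<partial>N)\<bar>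
    \<le> (\<Sum>k\<in>J. \<Sum>l\<in>J - {k}. \<bar>C1 k l - C0 k l\<bar> * D n k l) / 2" for n
  proof (rule gaussian_comparison_C1[OF X Y diag f])
    fix t :: real and k l
    assume t: "0 \<le> t" "t \<le> 1" and kl: "k \<in> J" "l \<in> J" "k \<noteq> l"
    let ?Z = "interpolate t X Y" and ?P = "M \<Otimes>\<^sub>M N"
    note Z = gaussian_family_interpolate[OF X Y t]
    interpret P: prob_space ?P by (rule gaussian_family_prob_space[OF Z])
    have [measurable]: "?Z k \<in> borel_measurable ?P" "?Z l \<in> borel_measurable ?P"
      using gaussian_family_measurable[OF Z] kl by auto
    let ?E = "{\<omega> \<in> space ?P. ?Z k \<omega> \<in> {u k..u k + \<delta> n} \<and> ?Z l \<omega> \<in> {u l..u l + \<delta> n}}"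
    have E[measurable]: "?E \<in> sets ?P" by measurable
    have r': "\<bar>C1 k l\<bar> \<le> r k l" "\<bar>C0 k l\<bar> \<le> r k l" "r k l < 1" using r[OF kl] by auto
    have box: "measure ?P ?E \<le> 8 * (\<delta> n)\<^sup>2 / (1 - r k l) * exp (- (u k + u l - \<delta> n)\<^sup>2 / (4 * (1 + r k l)))"
    proof (rule gaussian_pair_box_le[OF Z kl])
      have "\<bar>t * C1 k l + (1 - t) * C0 k l\<bar> \<le> t * \<bar>C1 k l\<bar> + (1 - t) * \<bar>C0 k l\<bar>"
        using t by (intro order_trans[OF abs_triangle_ineq]) (simp add: abs_mult)
      also have "\<dots> \<le> t * r k l + (1 - t) * r k l"
        using t r' by (intro add_mono mult_left_mono) auto
      finally show "\<bar>t * C1 k l + (1 - t) * C0 k l\<bar> \<le> r k l" by (simp add: algebra_simps)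
      show "\<delta> n \<le> u k + u l" using \<delta>(2)[of n] m(2)[OF kl(1)] u[OF kl(2)] by linarith
    qed (use diag sym kl r' \<delta>(1) in auto)
    have "(\<integral>\<omega>. \<bar>f' n k (?Z k \<omega>)\<bar> * \<bar>f' n l (?Z l \<omega>)\<bar> \<partial>?P) \<le> (\<integral>\<omega>. (2 / \<delta> n * (2 / \<delta> n)) * indicator ?E \<omega> \<partial>?P)"
    proof (rule integral_mono')
      show "integrable ?P (\<lambda>\<omega>. (2 / \<delta> n * (2 / \<delta> n)) * indicator ?E \<omega>)"
        by (intro integrable_mult_right integrable_real_indicator E) (simp add: P.emeasure_finite less_top[symmetric])
      fix \<omega> assume w: "\<omega> \<in> space ?P"
      show "\<bar>f' n k (?Z k \<omega>)\<bar> * \<bar>f' n l (?Z l \<omega>)\<bar> \<le> (2 / \<delta> n * (2 / \<delta> n)) * indicator ?E \<omega>"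
      proof (cases "\<omega> \<in> ?E")
        case True
        then show ?thesis using fb \<delta>(1)[of n] by (auto intro!: mult_mono simp del: times_divide_eq_left times_divide_eq_right)
      next
        case False
        then have "f' n k (?Z k \<omega>) = 0 \<or> f' n l (?Z l \<omega>) = 0" using f'0 w by blast
        then show ?thesis by auto
      qed
    qed auto
    also have "\<dots> = (2 / \<delta> n * (2 / \<delta> n)) * measure ?P ?E" by simp
    also have "\<dots> \<le> (2 / \<delta> n * (2 / \<delta> n)) * (8 * (\<delta> n)\<^sup>2 / (1 - r k l) * exp (- (u k + u l - \<delta> n)\<^sup>2 / (4 * (1 + r k l))))"
      using \<delta>(1)[of n] by (intro mult_left_mono box) auto
    also have "\<dots> = D n k l"
      unfolding D_def using \<delta>(1)[of n] by (simp add: power2_eq_square)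
    finally show "(\<integral>\<omega>. \<bar>f' n k (?Z k \<omega>)\<bar> * \<bar>f' n l (?Z l \<omega>)\<bar> \<partial>?P) \<le> D n k l" .
  qed
  have lim: "(\<lambda>n. \<integral>\<omega>. (\<Prod>j\<in>J. f n j (Z j \<omega>)) \<partial>M') \<longlonglongrightarrow> measure M' {\<omega> \<in> space M'. \<forall>j\<in>J. Z j \<omega> \<le> u j}"
    if Z: "gaussian_family M' J Z CC" for M' :: "'z measure" and Z CC
  proof -
    interpret prob_space M' by (rule gaussian_family_prob_space[OF Z])
    have [measurable]: "j \<in> J \<Longrightarrow> Z j \<in> borel_measurable M'" for j by (rule gaussian_family_measurable[OF Z])
    let ?E = "{\<omega> \<in> space M'. \<forall>j\<in>J. Z j \<omega> \<le> u j}"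
    have E[measurable]: "?E \<in> sets M'" using J by measurable
    have "(\<lambda>n. \<integral>\<omega>. (\<Prod>j\<in>J. f n j (Z j \<omega>)) \<partial>M') \<longlonglongrightarrow> (\<integral>\<omega>. indicator ?E \<omega> \<partial>M')"
    proof (rule integral_dominated_convergence[where w = "\<lambda>_. 1"])
      show "(\<lambda>\<omega>. \<Prod>j\<in>J. f n j (Z j \<omega>)) \<in> borel_measurable M'" for n by measurable
      have "norm (\<Prod>j\<in>J. f n j (Z j \<omega>)) \<le> 1" for n \<omega>
        using fb by (auto simp: abs_prod intro!: prod_le_1)
      then show "AE \<omega> in M'. norm (\<Prod>j\<in>J. f n j (Z j \<omega>)) \<le> 1" for n by simp
      have flim: "(\<lambda>n. f n j x) \<longlonglongrightarrow> (if x \<le> u j then 1 else 0)" for j x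
      proof (cases "x \<le> u j")
        case True
        have "f n j x = 1" for n
          unfolding f_def using True \<delta>(1)[of n] by (subst smooth_step_le_0) (auto simp: divide_le_0_iff)
        then show ?thesis using True by simp
      next
        case False
        have "eventually (\<lambda>n. \<delta> n < x - u j) sequentially"
          by (rule order_tendstoD(2)[OF \<delta>0]) (use False in simp)
        then have "eventually (\<lambda>n. f n j x = 0) sequentially"
        proof (rule eventually_mono)
          fix n assume "\<delta> n < x - u j"
          then show "f n j x = 0" unfolding f_def using \<delta>(1)[of n] by (subst smooth_step_ge_1) (auto simp: le_divide_eq)
        qed
        then show ?thesis using False by (simp add: tendsto_eventually)
      qed
      show "AE \<omega> in M'. (\<lambda>n. \<Prod>j\<in>J. f n j (Z j \<omega>)) \<longlonglongrightarrow> indicator ?E \<omega>"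
      proof (intro AE_I2)
        fix \<omega> assume w: "\<omega> \<in> space M'"
        have "(\<lambda>n. \<Prod>j\<in>J. f n j (Z j \<omega>)) \<longlonglongrightarrow> (\<Prod>j\<in>J. if Z j \<omega> \<le> u j then 1 else 0)"
          by (intro tendsto_prod flim)
        also have "(\<Prod>j\<in>J. if Z j \<omega> \<le> u j then 1 else 0 :: real) = indicator ?E \<omega>"
        proof (cases "\<forall>j\<in>J. Z j \<omega> \<le> u j")
          case False
          then show ?thesis using J w by (subst prod_zero) auto
        qed (use w in simp)
        finally show "(\<lambda>n. \<Prod>j\<in>J. f n j (Z j \<omega>)) \<longlonglongrightarrow> indicator ?E \<omega>" .
      qed
    qed auto
    then show ?thesis by simp
  qed
  have Dlim: "(\<lambda>n. (\<Sum>k\<in>J. \<Sum>l\<in>J - {k}. \<bar>C1 k l - C0 k l\<bar> * D n k l) / 2) \<longlonglongrightarrow>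
     (\<Sum>k\<in>J. \<Sum>l\<in>J - {k}. \<bar>C1 k l - C0 k l\<bar> *
        (32 / (1 - r k l) * exp (- (u k + u l - 0)\<^sup>2 / (4 * (1 + r k l))))) / 2"
    unfolding D_def
  proof (intro tendsto_divide tendsto_const tendsto_sum tendsto_mult tendsto_exp tendsto_minus tendsto_power
      tendsto_diff \<delta>0)
    fix k l assume "k \<in> J" "l \<in> J - {k}"
    then show "4 * (1 + r k l) \<noteq> 0" using r[of k l] by auto
  next
    fix k l assume "k \<in> J" "l \<in> J - {k}"
    then show "1 - r k l \<noteq> 0" using r[of k l] by auto
  qed simp_all
  have "\<bar>measure M {\<omega> \<in> space M. \<forall>j\<in>J. X j \<omega> \<le> u j} - measure N {\<omega> \<in> space N. \<forall>j\<in>J. Y j \<omega> \<le> u j}\<bar> \<le>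
     (\<Sum>k\<in>J. \<Sum>l\<in>J - {k}. \<bar>C1 k l - C0 k l\<bar> *
        (32 / (1 - r k l) * exp (- (u k + u l - 0)\<^sup>2 / (4 * (1 + r k l))))) / 2"
    by (rule LIMSEQ_le[OF tendsto_rabs[OF tendsto_diff[OF lim[OF X] lim[OF Y]]] Dlim]) (use main in auto)
  also have "\<dots> = 16 * (\<Sum>k\<in>J. \<Sum>l\<in>J - {k}. \<bar>C1 k l - C0 k l\<bar> / (1 - r k l) * exp (- (u k + u l)\<^sup>2 / (4 * (1 + r k l))))"
  proof -
    have "a * (32 / d * e) / 2 = 16 * (a / d * e)" for a d e :: real by simp
    then show ?thesis by (simp only: diff_0_right sum_distrib_left sum_divide_distrib)
  qed
  finally show ?thesis .
qed

section \<open>Gaussian tails along an arithmetic progression\<close>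

definition std_normal_tail :: "real \<Rightarrow> real" where
  "std_normal_tail v = measure std_normal_distribution {v<..}"

text \<open>
Asymptotically a primitive of minus the tail: its derivative is -\<phi>(v) (1/v + 2/v^3).
An elementary substitute for the integral of the tail.
\<close>

definition tail_primitive :: "real \<Rightarrow> real" where
  "tail_primitive v = std_normal_density v / v\<^sup>2"

lemma std_normal_tail_nonneg: "0 \<le> std_normal_tail v"
  by (simp add: std_normal_tail_def)

lemma std_normal_tail_antimono: "v \<le> w \<Longrightarrow> std_normal_tail w \<le> std_normal_tail v"
proof -
  interpret prob_space std_normal_distribution by (rule prob_space_std_normal)
  show "v \<le> w \<Longrightarrow> std_normal_tail w \<le> std_normal_tail v"
    unfolding std_normal_tail_def by (intro finite_measure_mono) auto
qed

lemma measure_std_normal_atMost: "measure std_normal_distribution {..v} = 1 - std_normal_tail v"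
proof -
  interpret prob_space std_normal_distribution by (rule prob_space_std_normal)
  have "{..v} = space std_normal_distribution - {v<..}" by auto
  then show ?thesis unfolding std_normal_tail_def by (subst prob_compl[symmetric]) auto
qed

lemma DERIV_std_normal_density:
  "(std_normal_density has_real_derivative - x * std_normal_density x) (at x)"
  unfolding std_normal_density_def[abs_def] by (auto intro!: derivative_eq_intros simp: field_simps)

text \<open>
Mills' ratio, from -(\<phi>(x)/x)' = \<phi>(x) (1 + 1/x^2).
\<close>

lemma std_normal_tail_bounds:
  assumes v: "v > 0"
  shows "std_normal_tail v \<le> std_normal_density v / v"
    and "std_normal_density v / v \<le> (1 + 1 / v\<^sup>2) * std_normal_tail v"
proof -
  interpret prob_space std_normal_distribution by (rule prob_space_std_normal)
  let ?f = "\<lambda>x. std_normal_density x * (1 + 1 / x\<^sup>2)"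
  have I: "(\<integral>\<^sup>+x. ennreal (?f x) * indicator {v..} x \<partial>lborel) = ennreal (0 - (- (std_normal_density v / v)))"
  proof (rule nn_integral_FTC_atLeast)
    show "((\<lambda>x. - (std_normal_density x / x)) has_real_derivative ?f x) (at x)" if "v \<le> x" for x
      using that v by (auto intro!: derivative_eq_intros DERIV_std_normal_density simp: field_simps power2_eq_square)
    show "((\<lambda>x. - (std_normal_density x / x)) \<longlongrightarrow> 0) at_top"
      unfolding std_normal_density_def by real_asymp
  qed auto
  have tail: "emeasure std_normal_distribution {v..} = ennreal (std_normal_tail v)"
  proof -
    have "emeasure std_normal_distribution {v} = 0"
      by (subst emeasure_density) (auto simp: nn_integral_cmult_indicator nn_integral_indicator_singleton intro!: nn_integral_0_iff_AE[THEN iffD2])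
    then have "emeasure std_normal_distribution {v..} = emeasure std_normal_distribution {v<..}"
      using emeasure_Un_null_set[of "{v<..}" std_normal_distribution "{v}"]
      by (auto simp: null_sets_def ivl_disj_un_singleton(1)[symmetric] Un_commute)
    then show ?thesis unfolding std_normal_tail_def by (simp add: emeasure_eq_measure)
  qed
  have tail': "ennreal (std_normal_tail v) = (\<integral>\<^sup>+x. ennreal (std_normal_density x) * indicator {v..} x \<partial>lborel)"
    unfolding tail[symmetric] by (subst emeasure_density) auto
  have "ennreal (std_normal_tail v) \<le> (\<integral>\<^sup>+x. ennreal (?f x) * indicator {v..} x \<partial>lborel)"
    unfolding tail' by (intro nn_integral_mono mult_right_mono ennreal_leI) (auto simp: distrib_left)
  then show "std_normal_tail v \<le> std_normal_density v / v"
    unfolding I using v by simp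
  have "(\<integral>\<^sup>+x. ennreal (?f x) * indicator {v..} x \<partial>lborel) \<le>
      (\<integral>\<^sup>+x. ennreal (1 + 1 / v\<^sup>2) * (ennreal (std_normal_density x) * indicator {v..} x) \<partial>lborel)"
  proof (intro nn_integral_mono)
    fix x :: real
    have "?f x \<le> (1 + 1 / v\<^sup>2) * std_normal_density x" if "v \<le> x"
    proof -
      have "1 / x\<^sup>2 \<le> 1 / v\<^sup>2" using that v by (intro divide_left_mono power_mono mult_pos_pos zero_less_power) auto
      then show ?thesis by (subst mult.commute) (intro mult_right_mono, auto)
    qed
    then have "ennreal (?f x) \<le> ennreal (1 + 1 / v\<^sup>2) * ennreal (std_normal_density x)" if "v \<le> x"
      using that by (subst ennreal_mult[symmetric]) (auto intro!: ennreal_leI simp del: ennreal_plus)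
    then show "ennreal (?f x) * indicator {v..} x \<le> ennreal (1 + 1 / v\<^sup>2) * (ennreal (std_normal_density x) * indicator {v..} x)"
      by (cases "v \<le> x") auto
  qed
  also have "\<dots> = ennreal (1 + 1 / v\<^sup>2) * ennreal (std_normal_tail v)"
    unfolding tail' by (rule nn_integral_cmult) auto
  also have "\<dots> = ennreal ((1 + 1 / v\<^sup>2) * std_normal_tail v)"
    by (simp add: ennreal_mult std_normal_tail_nonneg)
  finally show "std_normal_density v / v \<le> (1 + 1 / v\<^sup>2) * std_normal_tail v"
    unfolding I using std_normal_tail_nonneg[of v] by simp
qed

lemma std_normal_density_antimono:
  "0 \<le> p \<Longrightarrow> p \<le> q \<Longrightarrow> std_normal_density q \<le> std_normal_density p"
  unfolding std_normal_density_def by (intro mult_left_mono) auto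

text \<open>
By the mean value theorem, the increment of tail_primitive is a value of \<phi>(v) (1/v + 2/v^3) times the step;
Mills' ratio sandwiches the tail between this and its multiple by 1 - 3/v^2.
\<close>

lemma tail_primitive_step:
  assumes p: "0 < p" "p < q"
  shows "(q - p) * std_normal_tail q \<le> tail_primitive p - tail_primitive q"
    and "3 \<le> p\<^sup>2 \<Longrightarrow> (1 - 3 / p\<^sup>2) * (tail_primitive p - tail_primitive q) \<le> (q - p) * std_normal_tail p"
proof -
  have "(tail_primitive has_real_derivative - (std_normal_density x * (1 / x + 2 / x ^ 3))) (at x)" if "x > 0" for x
    unfolding tail_primitive_def[abs_def] using that
    by (auto intro!: derivative_eq_intros DERIV_std_normal_density simp: field_simps power2_eq_square power3_eq_cube)
  then obtain \<xi> where \<xi>: "p < \<xi>" "\<xi> < q"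
    "tail_primitive q - tail_primitive p = (q - p) * - (std_normal_density \<xi> * (1 / \<xi> + 2 / \<xi> ^ 3))"
    using MVT2[OF p(2), of tail_primitive "\<lambda>x. - (std_normal_density x * (1 / x + 2 / x ^ 3))"] p by fastforce
  have eq: "tail_primitive p - tail_primitive q = (q - p) * (std_normal_density \<xi> * (1 / \<xi> + 2 / \<xi> ^ 3))"
    using \<xi>(3) by simp
  have "std_normal_tail q \<le> std_normal_density q * (1 / q)" using std_normal_tail_bounds(1)[of q] p by simp
  also have "\<dots> \<le> std_normal_density \<xi> * (1 / \<xi> + 2 / \<xi> ^ 3)"
  proof (intro mult_mono std_normal_density_antimono)
    have "1 / q \<le> 1 / \<xi>" using \<xi> p by (intro divide_left_mono) auto
    moreover have "0 \<le> 2 / \<xi> ^ 3" using \<xi> p by simp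
    ultimately show "1 / q \<le> 1 / \<xi> + 2 / \<xi> ^ 3" by linarith
  qed (use \<xi> p in auto)
  finally show "(q - p) * std_normal_tail q \<le> tail_primitive p - tail_primitive q"
    unfolding eq using p by (intro mult_left_mono) auto
  assume p3: "3 \<le> p\<^sup>2"
  define t where "t = 1 / p\<^sup>2"
  have t: "0 < t" "3 * t \<le> 1" using p p3 by (auto simp: t_def field_simps)
  have "std_normal_density \<xi> * (1 / \<xi> + 2 / \<xi> ^ 3) \<le> std_normal_density p * (1 / p + 2 / p ^ 3)"
    using \<xi> p by (intro mult_mono std_normal_density_antimono add_mono divide_left_mono power_mono) auto
  also have "1 / p + 2 / p ^ 3 = (1 / p) * (1 + 2 * t)"
    by (simp add: t_def power2_eq_square power3_eq_cube distrib_left)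
  finally have "(1 - 3 * t) * (std_normal_density \<xi> * (1 / \<xi> + 2 / \<xi> ^ 3)) \<le>
      (1 - 3 * t) * (std_normal_density p * ((1 / p) * (1 + 2 * t)))"
    using t by (intro mult_left_mono) auto
  also have "\<dots> = ((1 - 3 * t) * (1 + 2 * t)) * (std_normal_density p / p)" by simp
  also have "\<dots> \<le> ((1 - 3 * t) * (1 + 2 * t)) * ((1 + t) * std_normal_tail p)"
    using t std_normal_tail_bounds(2)[OF p(1)] unfolding t_def[symmetric]
    by (intro mult_left_mono) auto
  also have "\<dots> = ((1 - 3 * t) * (1 + 2 * t) * (1 + t)) * std_normal_tail p" by simp
  also have "\<dots> \<le> 1 * std_normal_tail p"
  proof (intro mult_right_mono std_normal_tail_nonneg)
    have "(1 - 3 * t) * (1 + 2 * t) * (1 + t) = 1 - 7 * (t * t) - 6 * (t * t * t)" by (simp add: algebra_simps)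
    moreover have "0 \<le> t * t" "0 \<le> t * t * t" using t by auto
    ultimately show "(1 - 3 * t) * (1 + 2 * t) * (1 + t) \<le> 1" by linarith
  qed
  finally have "(1 - 3 * t) * (std_normal_density \<xi> * (1 / \<xi> + 2 / \<xi> ^ 3)) \<le> std_normal_tail p" by simp
  then have "(q - p) * ((1 - 3 * t) * (std_normal_density \<xi> * (1 / \<xi> + 2 / \<xi> ^ 3))) \<le> (q - p) * std_normal_tail p"
    using p by (intro mult_left_mono) auto
  then show "(1 - 3 / p\<^sup>2) * (tail_primitive p - tail_primitive q) \<le> (q - p) * std_normal_tail p"
    unfolding eq by (simp add: t_def mult.left_commute)
qed

lemma tail_primitive_antimono: "0 < p \<Longrightarrow> p \<le> q \<Longrightarrow> tail_primitive q \<le> tail_primitive p"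
  unfolding tail_primitive_def
  by (intro frac_le std_normal_density_antimono power_mono) auto

lemma tail_primitive_nonneg: "0 \<le> tail_primitive q"
  unfolding tail_primitive_def by simp

text \<open>
Comparing each term with the increment of tail_primitive over the preceding step makes the sum telescope. The
additional step h absorbs the fractional part of u.
\<close>

lemma sum_std_normal_tail_le:
  fixes h d u :: real
  assumes h: "0 < h" and u: "0 \<le> u" "h < h * u - d"
  shows "(\<Sum>j\<in>{j::nat. u < real j \<and> j \<le> N}. std_normal_tail (h * real j - d)) \<le> tail_primitive (h * u - d - h) / h"
proof -
  define m where "m = nat \<lfloor>u\<rfloor>"
  have m: "real m \<le> u" "u < real m + 1" unfolding m_def using u by linarith+
  have set: "{j::nat. u < real j \<and> j \<le> N} = {m<..N}" using m by auto
  have vm: "0 < h * u - d - h" "h * u - d - h \<le> h * real m - d"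
    using u m h mult_left_mono[of "u - 1" "real m" h] by (auto simp: algebra_simps)
  have pos: "0 < h * real j - d" if "m \<le> j" for j
    using vm mult_left_mono[of "real m" "real j" h] that h by linarith
  have "h * (\<Sum>j\<in>{m<..N}. std_normal_tail (h * real j - d)) =
     (\<Sum>j\<in>{m<..N}. h * std_normal_tail (h * real j - d))" by (rule sum_distrib_left)
  also have "\<dots> \<le> (\<Sum>j\<in>{m<..N}. tail_primitive (h * real (j - 1) - d) - tail_primitive (h * real j - d))"
  proof (rule sum_mono)
    fix j assume j: "j \<in> {m<..N}"
    then have "real (j - 1) = real j - 1" by auto
    then have "h * real j - d - (h * real (j - 1) - d) = h" by (simp add: algebra_simps)
    then show "h * std_normal_tail (h * real j - d) \<le> tail_primitive (h * real (j - 1) - d) - tail_primitive (h * real j - d)"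
      using tail_primitive_step(1)[of "h * real (j - 1) - d" "h * real j - d"] pos[of "j - 1"] j h by auto
  qed
  also have "\<dots> \<le> tail_primitive (h * real m - d)"
  proof (cases "m \<le> N")
    case True
    have "(\<Sum>j\<in>{m<..N}. tail_primitive (h * real (j - 1) - d) - tail_primitive (h * real j - d)) =
        tail_primitive (h * real m - d) - tail_primitive (h * real N - d)"
      using sum_telescope''[OF True, of "\<lambda>j. - tail_primitive (h * real j - d)"]
      by (simp add: atLeastSucAtMost_greaterThanAtMost algebra_simps)
    then show ?thesis using tail_primitive_nonneg by simp
  qed (simp add: tail_primitive_nonneg)
  also have "\<dots> \<le> tail_primitive (h * u - d - h)" by (rule tail_primitive_antimono[OF vm])
  finally show ?thesis unfolding set using h by (simp add: field_simps)
qed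

lemma sum_std_normal_tail_ge:
  fixes h d u :: real
  assumes h: "0 < h" and u: "0 \<le> u" "0 < h * u - d" "3 \<le> (h * u - d)\<^sup>2" and N: "u < real N"
  shows "(1 - 3 / (h * u - d)\<^sup>2) * (tail_primitive (h * u - d + h) - tail_primitive (h * (real N + 1) - d)) / h
    \<le> (\<Sum>j\<in>{j::nat. u < real j \<and> j \<le> N}. std_normal_tail (h * real j - d))"
proof -
  define m where "m = nat \<lfloor>u\<rfloor>"
  define c where "c = 1 - 3 / (h * u - d)\<^sup>2"
  have c: "0 \<le> c" unfolding c_def using u by (simp add: divide_le_eq_1)
  have m: "real m \<le> u" "u < real m + 1" unfolding m_def using u by linarith+
  have set: "{j::nat. u < real j \<and> j \<le> N} = {m<..N}" using m by auto
  have mN: "m \<le> N" "Suc m \<le> N" using m N by linarith+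
  have ge: "h * u - d \<le> h * real j - d" if "j \<in> {m<..N}" for j
    using that m mult_left_mono[of u "real j" h] h by auto
  have "c * (tail_primitive (h * (real m + 1) - d) - tail_primitive (h * (real N + 1) - d)) =
    (\<Sum>j\<in>{m<..N}. c * (tail_primitive (h * real j - d) - tail_primitive (h * (real j + 1) - d)))"
  proof -
    have "(\<Sum>j\<in>{m<..N}. tail_primitive (h * real j - d) - tail_primitive (h * (real j + 1) - d)) =
        tail_primitive (h * (real m + 1) - d) - tail_primitive (h * (real N + 1) - d)"
      using mN(1)
    proof (induction rule: dec_induct)
      case (step n)
      then have "{m<..Suc n} = insert (Suc n) {m<..n}" by auto
      then show ?case using step by (simp add: algebra_simps)
    qed simp
    then show ?thesis by (simp add: sum_distrib_left[symmetric])
  qed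
  also have "\<dots> \<le> (\<Sum>j\<in>{m<..N}. h * std_normal_tail (h * real j - d))"
  proof (rule sum_mono)
    fix j assume j: "j \<in> {m<..N}"
    let ?p = "h * real j - d" and ?q = "h * (real j + 1) - d"
    have p: "0 < ?p" "?p < ?q" "?q - ?p = h"
      using ge[OF j] u(2) h by (linarith, simp_all add: algebra_simps)
    have sq: "(h * u - d)\<^sup>2 \<le> ?p\<^sup>2" using ge[OF j] u by (intro power_mono) auto
    then have "c \<le> 1 - 3 / ?p\<^sup>2" unfolding c_def using u by (simp add: frac_le)
    moreover have "0 \<le> tail_primitive ?p - tail_primitive ?q" using tail_primitive_antimono[of ?p ?q] p by simp
    ultimately have "c * (tail_primitive ?p - tail_primitive ?q) \<le> (1 - 3 / ?p\<^sup>2) * (tail_primitive ?p - tail_primitive ?q)"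
      by (rule mult_right_mono)
    also have "\<dots> \<le> h * std_normal_tail ?p" using tail_primitive_step(2)[OF p(1,2)] sq u p by simp
    finally show "c * (tail_primitive ?p - tail_primitive ?q) \<le> h * std_normal_tail ?p" .
  qed
  finally have "c * (tail_primitive (h * (real m + 1) - d) - tail_primitive (h * (real N + 1) - d)) \<le>
     h * (\<Sum>j\<in>{m<..N}. std_normal_tail (h * real j - d))" by (simp add: sum_distrib_left)
  moreover have "c * (tail_primitive (h * u - d + h) - tail_primitive (h * (real N + 1) - d)) \<le>
     c * (tail_primitive (h * (real m + 1) - d) - tail_primitive (h * (real N + 1) - d))"
  proof -
    have "h * (real m + 1) - d \<le> h * u - d + h" "0 < h * (real m + 1) - d"
      using m h u mult_left_mono[of "real m" u h] mult_strict_left_mono[of u "real m + 1" h] by (auto simp: algebra_simps)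
    then show ?thesis using tail_primitive_antimono c by (intro mult_left_mono) auto
  qed
  ultimately show ?thesis unfolding set c_def[symmetric] using h by (simp add: field_simps)
qed

lemma a_norm_at_top: "filterlim a_norm at_top (at_right 0)"
  unfolding a_norm_def by real_asymp

lemma a_norm_sq_asymp: "((\<lambda>h. (a_norm h)\<^sup>2 / (2 * ln (1 / h))) \<longlongrightarrow> 1) (at_right 0)"
proof (rule Lim_transform_eventually)
  show "((\<lambda>h. (2 * (ln (1 / h) - ln (2 * ln (1 / h)) + ln ((2 * pi) powr (- 1 / 2)))) / (2 * ln (1 / h)))
      \<longlongrightarrow> 1) (at_right 0)" by real_asymp
  have "eventually (\<lambda>h::real. 0 \<le> 2 * (ln (1 / h) - ln (2 * ln (1 / h)) + ln ((2 * pi) powr (- 1 / 2)))) (at_right 0)"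
    by real_asymp
  then show "eventually (\<lambda>h. (2 * (ln (1 / h) - ln (2 * ln (1 / h)) + ln ((2 * pi) powr (- 1 / 2)))) / (2 * ln (1 / h)) =
      (a_norm h)\<^sup>2 / (2 * ln (1 / h))) (at_right 0)"
    by eventually_elim (simp add: a_norm_def)
qed

lemma a_norm_mult_tendsto_0: "((\<lambda>h. h * a_norm h) \<longlongrightarrow> 0) (at_right 0)"
  unfolding a_norm_def by real_asymp

text \<open>
This equation is the origin of the normalisation: a_norm is its closed-form solution. It holds only eventually, because
the expression under the root has to be nonnegative.
\<close>

lemma std_normal_density_a_norm:
  "eventually (\<lambda>h. std_normal_density (a_norm h) = h * (2 * ln (1 / h))) (at_right 0)"
proof -
  have "eventually (\<lambda>h::real. 0 < h) (at_right 0)" by (simp add: eventually_at_right_less)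
  moreover have "eventually (\<lambda>h::real. 0 < 2 * ln (1 / h)) (at_right 0)" by real_asymp
  moreover have "eventually (\<lambda>h::real. 0 \<le> 2 * (ln (1 / h) - ln (2 * ln (1 / h)) + ln ((2 * pi) powr (- 1 / 2)))) (at_right 0)"
    by real_asymp
  ultimately show ?thesis
  proof eventually_elim
    case (elim h)
    define k :: real where "k = (2 * pi) powr (- 1 / 2)"
    have k: "k > 0" "k = 1 / sqrt (2 * pi)" unfolding k_def by (auto simp: powr_minus_divide powr_half_sqrt)
    have "(a_norm h)\<^sup>2 / 2 = ln (1 / h) - ln (2 * ln (1 / h)) + ln k"
      unfolding a_norm_def k_def using elim(3) by simp
    then have "exp (- (a_norm h)\<^sup>2 / 2) = exp (- ln (1 / h) + ln (2 * ln (1 / h)) - ln k)"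
      by (simp add: minus_divide_left[symmetric])
    also have "\<dots> = exp (ln h) * exp (ln (2 * ln (1 / h))) / exp (ln k)"
      using elim(1) by (simp add: exp_diff exp_add ln_div)
    also have "\<dots> = h * (2 * ln (1 / h)) / k"
      using elim k by simp
    finally show ?case unfolding std_normal_density_def k(2) by simp
  qed
qed

text \<open>
A shift of the argument by s/a multiplies the density by exp(-s) in the limit, as the square of a + s/a
is a^2 + 2 s + o(1).
\<close>

lemma tail_primitive_asymp:
  assumes h: "filterlim h (at_right 0) F" and s: "(s \<longlongrightarrow> s0) F"
  shows "((\<lambda>x. tail_primitive (a_norm (h x) + s x / a_norm (h x)) / h x) \<longlongrightarrow> exp (- s0)) F"
proof -
  define a where "a x = a_norm (h x)" for x
  have a: "filterlim a at_top F" unfolding a_def by (rule filterlim_compose[OF a_norm_at_top h])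
  have inv: "((\<lambda>x. 1 / a x) \<longlongrightarrow> 0) F"
    using tendsto_inverse_0_at_top[OF a] by (simp add: inverse_eq_divide)
  have inv2: "((\<lambda>x. s x * (1 / a x) * (1 / a x)) \<longlongrightarrow> s0 * 0 * 0) F" by (intro tendsto_intros s inv)
  have inv3: "((\<lambda>x. s x * s x * (1 / a x) * (1 / a x)) \<longlongrightarrow> s0 * s0 * 0 * 0) F" by (intro tendsto_intros s inv)
  have q: "((\<lambda>x. (a x)\<^sup>2 / (2 * ln (1 / h x))) \<longlongrightarrow> 1) F" unfolding a_def
    by (rule filterlim_compose[OF a_norm_sq_asymp h])
  have "((\<lambda>x. exp (- s x - s x * s x * (1 / a x) * (1 / a x) / 2) /
      ((a x)\<^sup>2 / (2 * ln (1 / h x)) * (1 + s x * (1 / a x) * (1 / a x))\<^sup>2)) \<longlongrightarrow>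
      exp (- s0 - s0 * s0 * 0 * 0 / 2) / (1 * (1 + s0 * 0 * 0)\<^sup>2)) F"
    by (intro tendsto_intros q s inv2 inv3) auto
  then have lim: "((\<lambda>x. exp (- s x - s x * s x * (1 / a x) * (1 / a x) / 2) /
      ((a x)\<^sup>2 / (2 * ln (1 / h x)) * (1 + s x * (1 / a x) * (1 / a x))\<^sup>2)) \<longlongrightarrow> exp (- s0)) F" by simp
  have "eventually (\<lambda>x. exp (- s x - s x * s x * (1 / a x) * (1 / a x) / 2) /
      ((a x)\<^sup>2 / (2 * ln (1 / h x)) * (1 + s x * (1 / a x) * (1 / a x))\<^sup>2) =
      tail_primitive (a_norm (h x) + s x / a_norm (h x)) / h x) F"
  proof -
    have "eventually (\<lambda>x. a x > 0) F" using a by (simp add: filterlim_at_top_dense)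
    moreover have "eventually (\<lambda>x. std_normal_density (a x) = h x * (2 * ln (1 / h x))) F"
      unfolding a_def by (rule eventually_compose_filterlim[OF std_normal_density_a_norm h])
    moreover have "eventually (\<lambda>x. h x > 0) F"
      by (rule eventually_compose_filterlim[OF _ h]) (simp add: eventually_at_right_less)
    ultimately show ?thesis
    proof eventually_elim
      case (elim x)
      let ?v = "a x + s x / a x"
      have v: "?v = a x * (1 + s x * (1 / a x) * (1 / a x))" using elim(1) by (simp add: field_simps)
      have "?v\<^sup>2 = (a x)\<^sup>2 + 2 * s x + s x * s x * (1 / a x) * (1 / a x)"
        using elim(1) by (simp add: power2_eq_square field_simps)
      then have "std_normal_density ?v = std_normal_density (a x) * exp (- s x - s x * s x * (1 / a x) * (1 / a x) / 2)"
      proof -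
        assume eq: "?v\<^sup>2 = (a x)\<^sup>2 + 2 * s x + s x * s x * (1 / a x) * (1 / a x)"
        have gen: "- (A + 2 * S + R) / 2 = - A / 2 + (- S - R / 2)" for A S R :: real by (simp add: field_simps)
        show ?thesis unfolding std_normal_density_def eq gen exp_add by simp
      qed
      then have "tail_primitive ?v / h x = h x * (2 * ln (1 / h x)) * exp (- s x - s x * s x * (1 / a x) * (1 / a x) / 2) /
          (a x * (1 + s x * (1 / a x) * (1 / a x)))\<^sup>2 / h x"
        unfolding tail_primitive_def elim(2) v[symmetric] by simp
      also have "\<dots> = exp (- s x - s x * s x * (1 / a x) * (1 / a x) / 2) /
          ((a x)\<^sup>2 / (2 * ln (1 / h x)) * (1 + s x * (1 / a x) * (1 / a x))\<^sup>2)"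
        using elim(3) by (simp add: power_mult_distrib)
      finally show ?case unfolding a_def by simp
    qed
  qed
  then show ?thesis by (rule Lim_transform_eventually[OF lim])
qed

text \<open>
The mean number of exceedances of a line by independent standard normal variables. The threshold enters as
a_norm h + s / a_norm h; the shifts by one step h in the sandwich bounds change s by h a_norm h, which tends to 0.
The second condition on N lets the upper end of the sum lie beyond every level of this form, so
that the truncation is invisible in the limit.
\<close>

lemma sum_std_normal_tail_tendsto:
  fixes h d u s :: "'x \<Rightarrow> real" and N :: "'x \<Rightarrow> nat"
  assumes h: "filterlim h (at_right 0) F" and s: "(s \<longlongrightarrow> s0) F"
    and u: "eventually (\<lambda>x. 0 \<le> u x \<and> h x * u x - d x = a_norm (h x) + s x / a_norm (h x)) F"
    and N: "eventually (\<lambda>x. u x < real (N x)) F"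
      "filterlim (\<lambda>x. (h x * (real (N x) + 1) - d x - a_norm (h x)) * a_norm (h x)) at_top F"
  shows "((\<lambda>x. \<Sum>j\<in>{j::nat. u x < real j \<and> j \<le> N x}. std_normal_tail (h x * real j - d x)) \<longlongrightarrow> exp (- s0)) F"
proof -
  define a where "a x = a_norm (h x)" for x
  define v where "v x = h x * u x - d x" for x
  have a: "filterlim a at_top F" unfolding a_def by (rule filterlim_compose[OF a_norm_at_top h])
  have inv: "((\<lambda>x. 1 / a x) \<longlongrightarrow> 0) F"
    using tendsto_inverse_0_at_top[OF a] by (simp add: inverse_eq_divide)
  have apos: "eventually (\<lambda>x. a x > 0) F" using a by (simp add: filterlim_at_top_dense)
  have ha: "((\<lambda>x. h x * a x) \<longlongrightarrow> 0) F" unfolding a_def by (rule filterlim_compose[OF a_norm_mult_tendsto_0 h])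
  have hpos: "eventually (\<lambda>x. h x > 0) F"
    by (rule eventually_compose_filterlim[OF _ h]) (simp add: eventually_at_right_less)
  have h0: "(h \<longlongrightarrow> 0) F" using h by (rule filterlim_mono) (auto simp: at_within_le_nhds)
  have vlim: "filterlim v at_top F"
  proof -
    have "((\<lambda>x. s x * (1 / a x)) \<longlongrightarrow> s0 * 0) F" by (intro tendsto_intros s inv)
    then have "filterlim (\<lambda>x. s x * (1 / a x) + a x) at_top F" by (rule filterlim_tendsto_add_at_top[OF _ a])
    moreover have "eventually (\<lambda>x. s x * (1 / a x) + a x = v x) F" using u
      by eventually_elim (simp add: v_def a_def)
    ultimately show ?thesis by (rule filterlim_cong[OF refl refl, THEN iffD1, rotated])
  qed
  have up: "((\<lambda>x. tail_primitive (v x - h x) / h x) \<longlongrightarrow> exp (- s0)) F"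
  proof -
    have "((\<lambda>x. s x - h x * a x) \<longlongrightarrow> s0 - 0) F" by (intro tendsto_intros s ha)
    from tail_primitive_asymp[OF h this] have "((\<lambda>x. tail_primitive (a x + (s x - h x * a x) / a x) / h x) \<longlongrightarrow> exp (- s0)) F"
      by (simp add: a_def)
    moreover have "eventually (\<lambda>x. tail_primitive (a x + (s x - h x * a x) / a x) / h x = tail_primitive (v x - h x) / h x) F"
      using u apos by eventually_elim (simp add: v_def a_def diff_divide_distrib add_diff_eq)
    ultimately show ?thesis by (rule Lim_transform_eventually)
  qed
  have low: "((\<lambda>x. tail_primitive (v x + h x) / h x) \<longlongrightarrow> exp (- s0)) F"
  proof -
    have "((\<lambda>x. s x + h x * a x) \<longlongrightarrow> s0 + 0) F" by (intro tendsto_intros s ha)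
    from tail_primitive_asymp[OF h this] have "((\<lambda>x. tail_primitive (a x + (s x + h x * a x) / a x) / h x) \<longlongrightarrow> exp (- s0)) F"
      by (simp add: a_def)
    moreover have "eventually (\<lambda>x. tail_primitive (a x + (s x + h x * a x) / a x) / h x = tail_primitive (v x + h x) / h x) F"
      using u apos by eventually_elim (simp add: v_def a_def add_divide_distrib add.assoc)
    ultimately show ?thesis by (rule Lim_transform_eventually)
  qed
  have rest: "((\<lambda>x. tail_primitive (h x * (real (N x) + 1) - d x) / h x) \<longlongrightarrow> 0) F"
  proof (rule order_tendstoI)
    fix e :: real assume "e < 0"
    have "eventually (\<lambda>x. 0 \<le> tail_primitive (h x * (real (N x) + 1) - d x) / h x) F"
      using hpos by eventually_elim (simp add: tail_primitive_nonneg)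
    then show "eventually (\<lambda>x. e < tail_primitive (h x * (real (N x) + 1) - d x) / h x) F"
      by eventually_elim (use \<open>e < 0\<close> in linarith)
  next
    fix e :: real assume e: "0 < e"
    \<comment> \<open>The upper end of the sum lies beyond the level a + t/a, where the limit of the normalised
    primitive is exp (- t) < e.\<close>
  define t where "t = max 0 (- ln (e / 2))"
    have "exp (- t) \<le> e / 2"
    proof -
      have "exp (- t) \<le> exp (ln (e / 2))" unfolding t_def by (subst exp_le_cancel_iff) (simp add: max_def)
      then show ?thesis using e by simp
    qed
    then have t: "exp (- t) < e" using e by linarith
    have "((\<lambda>x. tail_primitive (a x + t / a x) / h x) \<longlongrightarrow> exp (- t)) F"
      unfolding a_def by (rule tail_primitive_asymp[OF h tendsto_const])
    then have "eventually (\<lambda>x. tail_primitive (a x + t / a x) / h x < e) F"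
      by (rule order_tendstoD) (use t in simp)
    moreover have "eventually (\<lambda>x. t \<le> (h x * (real (N x) + 1) - d x - a x) * a x) F"
      using N(2) unfolding a_def by (simp add: filterlim_at_top)
    ultimately show "eventually (\<lambda>x. tail_primitive (h x * (real (N x) + 1) - d x) / h x < e) F"
      using apos hpos
    proof eventually_elim
      case (elim x)
      have "t / a x \<le> h x * (real (N x) + 1) - d x - a x" using elim by (simp add: pos_divide_le_eq)
      moreover have "0 \<le> t / a x" using elim by (simp add: t_def)
      ultimately have "tail_primitive (h x * (real (N x) + 1) - d x) \<le> tail_primitive (a x + t / a x)"
        using elim by (intro tail_primitive_antimono) linarith+
      then show ?case using elim by (meson divide_right_mono less_imp_le order_le_less_trans)
    qed
  qed
  have c: "((\<lambda>x. 1 - 3 / (v x)\<^sup>2) \<longlongrightarrow> 1 - 0) F"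
  proof (intro tendsto_diff tendsto_const)
    have "filterlim (\<lambda>x. (v x)\<^sup>2) at_top F" by (rule filterlim_pow_at_top[OF _ vlim]) simp
    then show "((\<lambda>x. 3 / (v x)\<^sup>2) \<longlongrightarrow> 0) F"
      by (intro real_tendsto_divide_at_top[OF tendsto_const])
  qed
  have "((\<lambda>x. (1 - 3 / (v x)\<^sup>2) * (tail_primitive (v x + h x) / h x - tail_primitive (h x * (real (N x) + 1) - d x) / h x)) \<longlongrightarrow>
     (1 - 0) * (exp (- s0) - 0)) F" by (intro tendsto_mult tendsto_diff c low rest)
  then have low': "((\<lambda>x. (1 - 3 / (v x)\<^sup>2) * (tail_primitive (v x + h x) - tail_primitive (h x * (real (N x) + 1) - d x)) / h x) \<longlongrightarrow>
     exp (- s0)) F" by (simp add: diff_divide_distrib[symmetric])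
  have v2: "eventually (\<lambda>x. 2 \<le> v x) F" using vlim by (simp add: filterlim_at_top)
  have h1: "eventually (\<lambda>x. h x < 1) F" using h0 by (rule order_tendstoD) simp
  show ?thesis
  proof (rule tendsto_sandwich[OF _ _ low' up])
    show "eventually (\<lambda>x. (1 - 3 / (v x)\<^sup>2) * (tail_primitive (v x + h x) - tail_primitive (h x * (real (N x) + 1) - d x)) / h x \<le>
      (\<Sum>j\<in>{j::nat. u x < real j \<and> j \<le> N x}. std_normal_tail (h x * real j - d x))) F"
      using u v2 hpos N(1)
    proof eventually_elim
      case (elim x)
      have "2\<^sup>2 \<le> (v x)\<^sup>2" using elim by (intro power_mono) auto
      then show ?case using sum_std_normal_tail_ge[of "h x" "u x" "d x" "N x"] elim by (simp add: v_def)
    qed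
    show "eventually (\<lambda>x. (\<Sum>j\<in>{j::nat. u x < real j \<and> j \<le> N x}. std_normal_tail (h x * real j - d x)) \<le>
       tail_primitive (v x - h x) / h x) F"
      using u v2 hpos h1
    proof eventually_elim
      case (elim x)
      then show ?case using sum_std_normal_tail_le[of "h x" "u x" "d x" "N x"] by (simp add: v_def)
    qed
  qed
qed

text \<open>
Poisson approximation in its simplest form: many small probabilities with a convergent sum.
\<close>

lemma prod_one_minus_tendsto_exp:
  fixes q :: "'x \<Rightarrow> 'i \<Rightarrow> real"
  assumes fin: "\<And>x. finite (T x)" and sum: "((\<lambda>x. \<Sum>j\<in>T x. q x j) \<longlongrightarrow> l) F"
    and q: "eventually (\<lambda>x. \<forall>j\<in>T x. 0 \<le> q x j \<and> q x j \<le> m x) F" and m: "(m \<longlongrightarrow> 0) F"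
  shows "((\<lambda>x. \<Prod>j\<in>T x. 1 - q x j) \<longlongrightarrow> exp (- l)) F"
proof (rule tendsto_sandwich[where h = "\<lambda>x. exp (- (\<Sum>j\<in>T x. q x j))" and
      f = "\<lambda>x. exp (- (\<Sum>j\<in>T x. q x j) - 2 * m x * (\<Sum>j\<in>T x. q x j))"])
  show "((\<lambda>x. exp (- (\<Sum>j\<in>T x. q x j))) \<longlongrightarrow> exp (- l)) F" by (intro tendsto_intros sum)
  have "((\<lambda>x. exp (- (\<Sum>j\<in>T x. q x j) - 2 * m x * (\<Sum>j\<in>T x. q x j))) \<longlongrightarrow> exp (- l - 2 * 0 * l)) F"
    by (intro tendsto_intros sum m)
  then show "((\<lambda>x. exp (- (\<Sum>j\<in>T x. q x j) - 2 * m x * (\<Sum>j\<in>T x. q x j))) \<longlongrightarrow> exp (- l)) F" by simp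
  have m2: "eventually (\<lambda>x. m x < 1 / 2) F" using m by (rule order_tendstoD) simp
  have pr: "(\<Prod>j\<in>T x. 1 - q x j) = exp (\<Sum>j\<in>T x. ln (1 - q x j))"
    if "\<forall>j\<in>T x. 0 \<le> q x j \<and> q x j \<le> m x" "m x < 1 / 2" for x
    unfolding exp_sum[OF fin] using that by (intro prod.cong refl) (subst exp_ln, fastforce+)
  show "eventually (\<lambda>x. (\<Prod>j\<in>T x. 1 - q x j) \<le> exp (- (\<Sum>j\<in>T x. q x j))) F"
    using q m2
  proof eventually_elim
    case (elim x)
    have "ln (1 - q x j) \<le> - q x j" if "j \<in> T x" for j
    proof -
      have "0 < 1 - q x j" using elim that by fastforce
      then show ?thesis using ln_le_minus_one[of "1 - q x j"] by simp
    qed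
    then show ?case unfolding pr[OF elim] sum_negf[symmetric] by (subst exp_le_cancel_iff) (rule sum_mono)
  qed
  show "eventually (\<lambda>x. exp (- (\<Sum>j\<in>T x. q x j) - 2 * m x * (\<Sum>j\<in>T x. q x j)) \<le> (\<Prod>j\<in>T x. 1 - q x j)) F"
    using q m2
  proof eventually_elim
    case (elim x)
    have "- q x j - 2 * m x * q x j \<le> ln (1 - q x j)" if "j \<in> T x" for j
    proof -
      have qj: "0 \<le> q x j" "q x j \<le> m x" using elim that by auto
      then have "- q x j - 2 * (q x j)\<^sup>2 \<le> ln (1 - q x j)" using elim by (intro ln_one_minus_pos_lower_bound) auto
      moreover have "(q x j)\<^sup>2 \<le> m x * q x j" unfolding power2_eq_square using qj by (intro mult_right_mono)
      ultimately show ?thesis by linarith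
    qed
    then have "(\<Sum>j\<in>T x. - q x j - 2 * m x * q x j) \<le> (\<Sum>j\<in>T x. ln (1 - q x j))" by (intro sum_mono)
    then show ?case unfolding pr[OF elim] by (simp add: sum_subtractf sum_negf sum_distrib_left)
  qed
qed

section \<open>The equicorrelated Gaussian sequence\<close>

text \<open>
The fully dependent family: one standard normal variable repeated.
\<close>

lemma gaussian_family_common:
  assumes J: "finite J"
  shows "gaussian_family std_normal_distribution J (\<lambda>_ z. z) (\<lambda>_ _. 1)"
proof -
  have "(\<integral>z. iexp (\<Sum>i\<in>J. c i * z) \<partial>std_normal_distribution) =
      complex_of_real (exp (- (\<Sum>i\<in>J. \<Sum>j\<in>J. c i * c j * 1) / 2))" for c :: "'a \<Rightarrow> real"
  proof -
    have "(\<integral>z. iexp (\<Sum>i\<in>J. c i * z) \<partial>std_normal_distribution) = char std_normal_distribution (sum c J)"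
      unfolding char_def sum_distrib_right ..
    also have "\<dots> = complex_of_real (exp (- (\<Sum>i\<in>J. \<Sum>j\<in>J. c i * c j * 1) / 2))"
      by (simp add: char_std_normal_distribution power2_eq_square sum_product)
    finally show ?thesis .
  qed
  then show ?thesis unfolding gaussian_family_def using J prob_space_std_normal by auto
qed

lemma std_normal_tail_measurable [measurable]: "std_normal_tail \<in> borel_measurable borel"
proof -
  have "(\<lambda>v. - std_normal_tail v) \<in> borel_measurable borel"
    by (rule borel_measurable_mono) (simp add: mono_def std_normal_tail_antimono)
  then show ?thesis by simp
qed

text \<open>
Interpolating at \<rho> between the fully dependent and the independent family gives correlation \<rho>
for every pair; Fubini separates the common component.
\<close>

lemma equicorrelated_prob:
  fixes J :: "'i set" and u :: "'i \<Rightarrow> real"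
  assumes J: "finite J" and \<rho>: "0 \<le> \<rho>" "\<rho> < 1"
  shows "measure (std_normal_distribution \<Otimes>\<^sub>M (\<Pi>\<^sub>M j\<in>J. std_normal_distribution))
      {\<omega> \<in> space (std_normal_distribution \<Otimes>\<^sub>M (\<Pi>\<^sub>M j\<in>J. std_normal_distribution)).
        \<forall>j\<in>J. interpolate \<rho> (\<lambda>_ z. z) (\<lambda>j w. w j) j \<omega> \<le> u j} =
    (\<integral>z. (\<Prod>j\<in>J. 1 - std_normal_tail ((u j - sqrt \<rho> * z) / sqrt (1 - \<rho>))) \<partial>std_normal_distribution)"
proof -
  let ?P = "\<Pi>\<^sub>M j\<in>J. std_normal_distribution"
  interpret N: prob_space std_normal_distribution by (rule prob_space_std_normal)
  interpret P: product_prob_space "\<lambda>_. std_normal_distribution" J by unfold_locales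
  interpret NP: pair_prob_space std_normal_distribution ?P ..
  let ?Y = "interpolate \<rho> (\<lambda>_ z. z) (\<lambda>j w. w j)"
  let ?E = "{\<omega> \<in> space (std_normal_distribution \<Otimes>\<^sub>M ?P). \<forall>j\<in>J. ?Y j \<omega> \<le> u j}"
  have [measurable]: "?Y j \<in> borel_measurable (std_normal_distribution \<Otimes>\<^sub>M ?P)" if "j \<in> J" for j
    using gaussian_family_measurable[OF gaussian_family_interpolate[OF gaussian_family_common[OF J] gaussian_family_iid[OF J]] that] \<rho>
    by simp
  have E[measurable]: "?E \<in> sets (std_normal_distribution \<Otimes>\<^sub>M ?P)" using J by measurable
  have s: "sqrt (1 - \<rho>) > 0" using \<rho> by simp
  have "measure (std_normal_distribution \<Otimes>\<^sub>M ?P) ?E = (\<integral>\<omega>. indicator ?E \<omega> \<partial>(std_normal_distribution \<Otimes>\<^sub>M ?P))"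
    unfolding Bochner_Integration.integral_indicator by (rule arg_cong[where f = "measure _"]) blast
  also have "\<dots> = (\<integral>z. \<integral>w. indicator ?E (z, w) \<partial>?P \<partial>std_normal_distribution)"
    by (rule NP.integral_fst'[symmetric]) (intro integrable_real_indicator E, simp add: NP.P.emeasure_finite less_top[symmetric])
  also have "\<dots> = (\<integral>z. (\<Prod>j\<in>J. 1 - std_normal_tail ((u j - sqrt \<rho> * z) / sqrt (1 - \<rho>))) \<partial>std_normal_distribution)"
  proof (rule Bochner_Integration.integral_cong[OF refl])
    fix z :: real
    have "(\<integral>w. indicator ?E (z, w) \<partial>?P) = (\<integral>w. (\<Prod>j\<in>J. indicator {..(u j - sqrt \<rho> * z) / sqrt (1 - \<rho>)} (w j)) \<partial>?P :: real)"
    proof (rule Bochner_Integration.integral_cong[OF refl])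
      fix w assume w: "w \<in> space ?P"
      have "sqrt \<rho> * z + sqrt (1 - \<rho>) * w j \<le> u j \<longleftrightarrow> w j \<le> (u j - sqrt \<rho> * z) / sqrt (1 - \<rho>)" for j
        using s by (auto simp: pos_le_divide_eq algebra_simps)
      then have "(z, w) \<in> ?E \<longleftrightarrow> (\<forall>j\<in>J. w j \<in> {..(u j - sqrt \<rho> * z) / sqrt (1 - \<rho>)})"
        using w by (auto simp: space_pair_measure interpolate_def)
      then show "indicator ?E (z, w) = (\<Prod>j\<in>J. indicator {..(u j - sqrt \<rho> * z) / sqrt (1 - \<rho>)} (w j) :: real)"
        using J by (cases "(z, w) \<in> ?E") (auto simp: indicator_def intro!: prod_zero[symmetric] split: if_splits)
    qed
    also have "\<dots> = (\<Prod>j\<in>J. \<integral>x. indicator {..(u j - sqrt \<rho> * z) / sqrt (1 - \<rho>)} x \<partial>std_normal_distribution)"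
      by (rule P.product_integral_prod[OF J])
        (intro integrable_real_indicator, auto simp: N.emeasure_finite less_top[symmetric])
    also have "\<dots> = (\<Prod>j\<in>J. 1 - std_normal_tail ((u j - sqrt \<rho> * z) / sqrt (1 - \<rho>)))"
      by (simp add: measure_std_normal_atMost)
    finally show "(\<integral>w. indicator ?E (z, w) \<partial>?P) = (\<Prod>j\<in>J. 1 - std_normal_tail ((u j - sqrt \<rho> * z) / sqrt (1 - \<rho>)))" .
  qed
  finally show ?thesis .
qed

text \<open>
After division by sqrt (1 - \<rho>) the independent components are standard normal, and the
line \<beta> i becomes a line with this slope.
\<close>

definition step_size :: "real \<Rightarrow> real \<Rightarrow> real" where
  "step_size \<gamma> \<beta> = \<beta> / sqrt (1 - rho \<gamma> \<beta>)"

text \<open>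
The ends of the window, with the second-order term written as s divided by the normalisation. Both u_weak
and u_strong have this form, the latter with s depending on \<beta> and tending to sqrt (2 \<gamma>) x.
\<close>

definition level_index :: "real \<Rightarrow> real \<Rightarrow> real \<Rightarrow> real" where
  "level_index \<gamma> s \<beta> = sqrt (1 - rho \<gamma> \<beta>) * (a_norm (step_size \<gamma> \<beta>) + s / a_norm (step_size \<gamma> \<beta>)) / \<beta>"

text \<open>
The choice L^2/\<beta> lies far beyond the relevant indices, of order sqrt L / \<beta>, and still
has logarithm L + O(ln L).
\<close>

definition truncation :: "real \<Rightarrow> nat" where
  "truncation \<beta> = nat \<lfloor>(ln (1 / \<beta>))\<^sup>2 / \<beta>\<rfloor>"

definition outer_indices :: "real \<Rightarrow> real \<Rightarrow> nat \<Rightarrow> int set" where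
  "outer_indices U V N = {i. \<bar>i\<bar> \<le> int N \<and> (real_of_int i < - U \<or> V < real_of_int i)}"

abbreviation critical_indices :: "real \<Rightarrow> real \<Rightarrow> real \<Rightarrow> real \<Rightarrow> int set" where
  "critical_indices \<gamma> s t \<beta> \<equiv> outer_indices (level_index \<gamma> s \<beta>) (level_index \<gamma> t \<beta>) (truncation \<beta>)"

lemma finite_outer_indices: "finite (outer_indices U V N)"
  by (rule finite_subset[of _ "{- int N..int N}"]) (auto simp: outer_indices_def)

lemma sum_outer_indices:
  assumes "0 \<le> U" "0 \<le> V"
  shows "(\<Sum>i\<in>outer_indices U V N. f \<bar>i\<bar>) =
     (\<Sum>j\<in>{j::nat. U < real j \<and> j \<le> N}. f (int j)) + (\<Sum>j\<in>{j::nat. V < real j \<and> j \<le> N}. f (int j))"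
proof -
  let ?A = "{j::nat. U < real j \<and> j \<le> N}" and ?B = "{j::nat. V < real j \<and> j \<le> N}"
  have fin: "finite ?A" "finite ?B" by (auto intro: finite_subset[of _ "{..N}"])
  have "i \<in> (\<lambda>j. - int j) ` ?A \<union> int ` ?B" if i: "i \<in> outer_indices U V N" for i
  proof (cases "i < 0")
    case True
    then have "i = - int (nat (- i))" "nat (- i) \<in> ?A" using i assms by (auto simp: outer_indices_def)
    then show ?thesis by blast
  next
    case False
    then have "i = int (nat i)" "nat i \<in> ?B" using i assms by (auto simp: outer_indices_def)
    then show ?thesis by blast
  qed
  then have eq: "outer_indices U V N = (\<lambda>j. - int j) ` ?A \<union> int ` ?B"
    using assms by (auto simp: outer_indices_def)
  have disj: "(\<lambda>j. - int j) ` ?A \<inter> int ` ?B = {}" using assms by auto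
  have "(\<Sum>i\<in>outer_indices U V N. f \<bar>i\<bar>) = (\<Sum>i\<in>(\<lambda>j. - int j) ` ?A. f \<bar>i\<bar>) + (\<Sum>i\<in>int ` ?B. f \<bar>i\<bar>)"
    unfolding eq using fin by (intro sum.union_disjoint disj) auto
  also have "(\<Sum>i\<in>(\<lambda>j. - int j) ` ?A. f \<bar>i\<bar>) = (\<Sum>j\<in>?A. f (int j))"
    by (subst sum.reindex) (auto simp: inj_on_def)
  also have "(\<Sum>i\<in>int ` ?B. f \<bar>i\<bar>) = (\<Sum>j\<in>?B. f (int j))"
    by (subst sum.reindex) (auto simp: inj_on_def)
  finally show ?thesis .
qed

lemma ln_inverse_at_top: "filterlim (\<lambda>\<beta>::real. ln (1 / \<beta>)) at_top (at_right 0)"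
  by real_asymp

lemma rho_eq: "0 < \<beta> \<Longrightarrow> \<beta> < 1 \<Longrightarrow> rho \<gamma> \<beta> = \<gamma> / ln (1 / \<beta>)"
  by (simp add: rho_def ln_div abs_of_neg)

lemma eventually_small: "0 < b \<Longrightarrow> eventually (\<lambda>\<beta>::real. 0 < \<beta> \<and> \<beta> < b) (at_right 0)"
  by (auto simp: eventually_at_right_field)

lemma rho_tendsto_0: "(rho \<gamma> \<longlongrightarrow> 0) (at_right 0)"
proof -
  have "((\<lambda>\<beta>. \<gamma> / ln (1 / \<beta>)) \<longlongrightarrow> 0) (at_right 0)"
    by (rule real_tendsto_divide_at_top[OF tendsto_const ln_inverse_at_top])
  moreover have "eventually (\<lambda>\<beta>. \<gamma> / ln (1 / \<beta>) = rho \<gamma> \<beta>) (at_right 0)"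
    by (rule eventually_mono[OF eventually_small[OF zero_less_one]]) (simp add: rho_eq)
  ultimately show ?thesis by (rule Lim_transform_eventually)
qed

lemma rho_nonneg: "0 \<le> \<gamma> \<Longrightarrow> 0 \<le> rho \<gamma> \<beta>"
  by (simp add: rho_def)

lemma eventually_rho_less: "0 < e \<Longrightarrow> eventually (\<lambda>\<beta>. rho \<gamma> \<beta> < e) (at_right 0)"
  using order_tendstoD(2)[OF rho_tendsto_0] by blast

lemma step_size_filterlim:
  assumes "0 \<le> \<gamma>" shows "filterlim (step_size \<gamma>) (at_right 0) (at_right 0)"
proof -
  have "((\<lambda>\<beta>. \<beta> / sqrt (1 - rho \<gamma> \<beta>)) \<longlongrightarrow> 0 / sqrt (1 - 0)) (at_right 0)"
    by (intro tendsto_intros rho_tendsto_0) auto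
  moreover have "eventually (\<lambda>\<beta>. 0 < step_size \<gamma> \<beta>) (at_right 0)"
    using eventually_small[OF zero_less_one] eventually_rho_less[OF zero_less_one, of \<gamma>]
    by eventually_elim (simp add: step_size_def)
  ultimately show ?thesis
    by (auto simp: filterlim_at step_size_def[abs_def] elim!: eventually_mono)
qed

lemma ln_step_size_asymp:
  assumes g: "0 \<le> \<gamma>"
  shows "((\<lambda>\<beta>. ln (1 / step_size \<gamma> \<beta>) / ln (1 / \<beta>)) \<longlongrightarrow> 1) (at_right 0)"
proof -
  have "((\<lambda>\<beta>. ln (sqrt (1 - rho \<gamma> \<beta>))) \<longlongrightarrow> ln (sqrt (1 - 0))) (at_right 0)"
    by (intro tendsto_intros rho_tendsto_0) auto
  then have "((\<lambda>\<beta>. 1 + ln (sqrt (1 - rho \<gamma> \<beta>)) / ln (1 / \<beta>)) \<longlongrightarrow> 1 + 0) (at_right 0)"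
    by (intro tendsto_add tendsto_const real_tendsto_divide_at_top[OF _ ln_inverse_at_top])
  moreover have "eventually (\<lambda>\<beta>. 1 + ln (sqrt (1 - rho \<gamma> \<beta>)) / ln (1 / \<beta>) = ln (1 / step_size \<gamma> \<beta>) / ln (1 / \<beta>)) (at_right 0)"
    using eventually_small[OF zero_less_one] eventually_rho_less[OF zero_less_one, of \<gamma>]
  proof eventually_elim
    case (elim \<beta>)
    have "ln (1 / step_size \<gamma> \<beta>) = ln (sqrt (1 - rho \<gamma> \<beta>)) + ln (1 / \<beta>)"
      using elim by (simp add: step_size_def ln_div)
    moreover have "ln (1 / \<beta>) > 0" using elim by simp
    ultimately show ?case by (simp add: add_divide_distrib)
  qed
  ultimately show ?thesis using Lim_transform_eventually by fastforce
qed

lemma a_norm_step_at_top: "0 \<le> \<gamma> \<Longrightarrow> filterlim (\<lambda>\<beta>. a_norm (step_size \<gamma> \<beta>)) at_top (at_right 0)"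
  by (rule filterlim_compose[OF a_norm_at_top step_size_filterlim])

lemma a_norm_step_sq_asymp:
  assumes g: "0 \<le> \<gamma>"
  shows "((\<lambda>\<beta>. (a_norm (step_size \<gamma> \<beta>))\<^sup>2 / ln (1 / \<beta>)) \<longlongrightarrow> 2) (at_right 0)"
proof -
  have "((\<lambda>\<beta>. 2 * ((a_norm (step_size \<gamma> \<beta>))\<^sup>2 / (2 * ln (1 / step_size \<gamma> \<beta>))) *
      (ln (1 / step_size \<gamma> \<beta>) / ln (1 / \<beta>))) \<longlongrightarrow> 2 * 1 * 1) (at_right 0)"
    by (intro tendsto_mult tendsto_const ln_step_size_asymp[OF g]
        filterlim_compose[OF a_norm_sq_asymp step_size_filterlim[OF g]])
  moreover have "eventually (\<lambda>\<beta>. 0 < ln (1 / step_size \<gamma> \<beta>)) (at_right 0)"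
    using filterlim_compose[OF ln_inverse_at_top step_size_filterlim[OF g]] by (simp add: filterlim_at_top_dense)
  then have "eventually (\<lambda>\<beta>. 2 * ((a_norm (step_size \<gamma> \<beta>))\<^sup>2 / (2 * ln (1 / step_size \<gamma> \<beta>))) *
      (ln (1 / step_size \<gamma> \<beta>) / ln (1 / \<beta>)) = (a_norm (step_size \<gamma> \<beta>))\<^sup>2 / ln (1 / \<beta>)) (at_right 0)"
    by eventually_elim simp
  ultimately show ?thesis using Lim_transform_eventually by fastforce
qed

text \<open>
The common component moves every threshold by an amount of order sqrt \<rho>, which is of the same order as
1/a_norm, the scale on which the exceedance probability changes. This is where sqrt (2 \<gamma>) arises.
\<close>

lemma sqrt_rho_a_norm_tendsto:
  assumes g: "0 \<le> \<gamma>"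
  shows "((\<lambda>\<beta>. sqrt (rho \<gamma> \<beta>) / sqrt (1 - rho \<gamma> \<beta>) * a_norm (step_size \<gamma> \<beta>)) \<longlongrightarrow> sqrt (2 * \<gamma>)) (at_right 0)"
proof -
  have "((\<lambda>\<beta>. sqrt (\<gamma> * ((a_norm (step_size \<gamma> \<beta>))\<^sup>2 / ln (1 / \<beta>))) / sqrt (1 - rho \<gamma> \<beta>)) \<longlongrightarrow>
      sqrt (\<gamma> * 2) / sqrt (1 - 0)) (at_right 0)"
    by (intro tendsto_intros a_norm_step_sq_asymp[OF g] rho_tendsto_0) auto
  moreover have "eventually (\<lambda>\<beta>. 0 < a_norm (step_size \<gamma> \<beta>)) (at_right 0)"
    using a_norm_step_at_top[OF g] by (simp add: filterlim_at_top_dense)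
  then have "eventually (\<lambda>\<beta>. sqrt (\<gamma> * ((a_norm (step_size \<gamma> \<beta>))\<^sup>2 / ln (1 / \<beta>))) / sqrt (1 - rho \<gamma> \<beta>) =
      sqrt (rho \<gamma> \<beta>) / sqrt (1 - rho \<gamma> \<beta>) * a_norm (step_size \<gamma> \<beta>)) (at_right 0)"
    using eventually_small[OF zero_less_one]
  proof eventually_elim
    case (elim \<beta>)
    then have "sqrt (\<gamma> * ((a_norm (step_size \<gamma> \<beta>))\<^sup>2 / ln (1 / \<beta>))) = sqrt (rho \<gamma> \<beta>) * a_norm (step_size \<gamma> \<beta>)"
      by (simp add: rho_eq real_sqrt_mult real_sqrt_divide)
    then show ?case by simp
  qed
  ultimately show ?thesis using Lim_transform_eventually by (fastforce simp: mult.commute)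
qed

lemma truncation_bounds:
  assumes "0 < \<beta>" "\<beta> < 1"
  shows "(ln (1 / \<beta>))\<^sup>2 \<le> \<beta> * (real (truncation \<beta>) + 1)" "\<beta> * real (truncation \<beta>) \<le> (ln (1 / \<beta>))\<^sup>2"
proof -
  have "0 \<le> (ln (1 / \<beta>))\<^sup>2 / \<beta>" using assms by simp
  then have "(ln (1 / \<beta>))\<^sup>2 / \<beta> \<le> real (truncation \<beta>) + 1" "real (truncation \<beta>) \<le> (ln (1 / \<beta>))\<^sup>2 / \<beta>"
    unfolding truncation_def by linarith+
  then show "(ln (1 / \<beta>))\<^sup>2 \<le> \<beta> * (real (truncation \<beta>) + 1)" "\<beta> * real (truncation \<beta>) \<le> (ln (1 / \<beta>))\<^sup>2"
    using assms by (auto simp: pos_divide_le_eq pos_le_divide_eq mult.commute)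
qed

lemma a_norm_step_le_ln:
  assumes g: "0 \<le> \<gamma>"
  shows "eventually (\<lambda>\<beta>. a_norm (step_size \<gamma> \<beta>) + 3 \<le> (ln (1 / \<beta>))\<^sup>2) (at_right 0)"
proof -
  have "eventually (\<lambda>\<beta>. (a_norm (step_size \<gamma> \<beta>))\<^sup>2 / ln (1 / \<beta>) < 3) (at_right 0)"
    by (rule order_tendstoD(2)[OF a_norm_step_sq_asymp[OF g]]) simp
  moreover have "eventually (\<lambda>\<beta>::real. 4 \<le> ln (1 / \<beta>)) (at_right 0)"
    using ln_inverse_at_top by (simp add: filterlim_at_top)
  ultimately show ?thesis
  proof eventually_elim
    case (elim \<beta>)
    define L where "L = ln (1 / \<beta>)"
    define a where "a = a_norm (step_size \<gamma> \<beta>)"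
    have L: "4 \<le> L" "a\<^sup>2 / L < 3" using elim unfolding L_def a_def by blast+
    have "a\<^sup>2 \<le> 3 * L" using L by (simp add: pos_divide_less_eq)
    also have "\<dots> \<le> L * L" using L by (intro mult_right_mono) auto
    finally have "a\<^sup>2 \<le> L\<^sup>2" by (simp add: power2_eq_square)
    then have "a \<le> L" by (rule power2_le_imp_le) (use L in simp)
    moreover have "4 * L \<le> L\<^sup>2" unfolding power2_eq_square using L by (intro mult_right_mono) auto
    ultimately have "a + 3 \<le> L\<^sup>2" using L by linarith
    then show ?case unfolding L_def a_def .
  qed
qed

lemma level_index_eventually_in_range:
  assumes g: "0 \<le> \<gamma>" and s: "(s \<longlongrightarrow> s0) (at_right 0)"
  shows "eventually (\<lambda>\<beta>. 0 \<le> level_index \<gamma> (s \<beta>) \<beta> \<and> level_index \<gamma> (s \<beta>) \<beta> < real (truncation \<beta>)) (at_right 0)"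
proof -
  have a: "filterlim (\<lambda>\<beta>. a_norm (step_size \<gamma> \<beta>)) at_top (at_right 0)" by (rule a_norm_step_at_top[OF g])
  have "((\<lambda>\<beta>. s \<beta> / a_norm (step_size \<gamma> \<beta>)) \<longlongrightarrow> 0) (at_right 0)"
    by (rule real_tendsto_divide_at_top[OF s a])
  then have "eventually (\<lambda>\<beta>. s \<beta> / a_norm (step_size \<gamma> \<beta>) < 1) (at_right 0)"
     "eventually (\<lambda>\<beta>. - 1 < s \<beta> / a_norm (step_size \<gamma> \<beta>)) (at_right 0)"
    by (auto intro: order_tendstoD)
  moreover have "eventually (\<lambda>\<beta>. 1 \<le> a_norm (step_size \<gamma> \<beta>)) (at_right 0)" using a by (simp add: filterlim_at_top)
  ultimately show ?thesis
    using a_norm_step_le_ln[OF g] eventually_small[OF zero_less_one] eventually_rho_less[OF zero_less_one, of \<gamma>]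
  proof eventually_elim
    case (elim \<beta>)
    let ?v = "a_norm (step_size \<gamma> \<beta>) + s \<beta> / a_norm (step_size \<gamma> \<beta>)"
    have r: "0 \<le> sqrt (1 - rho \<gamma> \<beta>)" "sqrt (1 - rho \<gamma> \<beta>) \<le> 1" using elim rho_nonneg[OF g, of \<beta>] by auto
    have v: "0 \<le> ?v" using elim by linarith
    have "sqrt (1 - rho \<gamma> \<beta>) * ?v \<le> 1 * ?v" using r v by (intro mult_right_mono)
    also have "\<dots> < (ln (1 / \<beta>))\<^sup>2 - 1"
    proof -
      have "x < 1 \<Longrightarrow> b + 3 \<le> l \<Longrightarrow> 1 * (b + x) < l - 1" for x b l :: real by simp
      then show ?thesis using elim by blast
    qed
    also have "\<dots> \<le> \<beta> * real (truncation \<beta>)" using truncation_bounds(1)[of \<beta>] elim by (simp add: algebra_simps)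
    finally have "level_index \<gamma> (s \<beta>) \<beta> < real (truncation \<beta>)"
      unfolding level_index_def using elim by (simp add: pos_divide_less_eq mult.commute)
    moreover have "0 \<le> level_index \<gamma> (s \<beta>) \<beta>" unfolding level_index_def using elim r v by simp
    ultimately show ?case by simp
  qed
qed

text \<open>
For a fixed value z of the common component, the shift turns s0 into s0 - sqrt (2 \<gamma>) z.
\<close>

lemma shifted_tail_sum_tendsto:
  assumes g: "0 \<le> \<gamma>" and s: "(s \<longlongrightarrow> s0) (at_right 0)"
  shows "((\<lambda>\<beta>. \<Sum>j\<in>{j::nat. level_index \<gamma> (s \<beta>) \<beta> < real j \<and> j \<le> truncation \<beta>}.
       std_normal_tail ((\<beta> * real j - sqrt (rho \<gamma> \<beta>) * z) / sqrt (1 - rho \<gamma> \<beta>))) \<longlongrightarrow>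
     exp (- (s0 - sqrt (2 * \<gamma>) * z))) (at_right 0)"
proof -
  define a where "a \<beta> = a_norm (step_size \<gamma> \<beta>)" for \<beta>
  define d where "d \<beta> = sqrt (rho \<gamma> \<beta>) / sqrt (1 - rho \<gamma> \<beta>) * z" for \<beta>
  have alim: "filterlim a at_top (at_right 0)" unfolding a_def by (rule a_norm_step_at_top[OF g])
  have a2: "eventually (\<lambda>\<beta>. 1 \<le> a \<beta>) (at_right 0)" using alim by (simp add: filterlim_at_top)
  have da: "((\<lambda>\<beta>. d \<beta> * a \<beta>) \<longlongrightarrow> sqrt (2 * \<gamma>) * z) (at_right 0)"
    using tendsto_mult[OF sqrt_rho_a_norm_tendsto[OF g] tendsto_const[of z]]
    by (simp add: d_def a_def mult_ac)
  have d0: "(d \<longlongrightarrow> 0) (at_right 0)"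
  proof -
    have "((\<lambda>\<beta>. sqrt (rho \<gamma> \<beta>) / sqrt (1 - rho \<gamma> \<beta>) * z) \<longlongrightarrow> sqrt 0 / sqrt (1 - 0) * z) (at_right 0)"
      by (intro tendsto_intros rho_tendsto_0) auto
    then show ?thesis by (simp add: d_def[abs_def])
  qed
  have "((\<lambda>\<beta>. \<Sum>j\<in>{j::nat. level_index \<gamma> (s \<beta>) \<beta> < real j \<and> j \<le> truncation \<beta>}.
       std_normal_tail (step_size \<gamma> \<beta> * real j - d \<beta>)) \<longlongrightarrow> exp (- (s0 - sqrt (2 * \<gamma>) * z))) (at_right 0)"
  proof (rule sum_std_normal_tail_tendsto[OF step_size_filterlim[OF g]])
    show "((\<lambda>\<beta>. s \<beta> - d \<beta> * a \<beta>) \<longlongrightarrow> s0 - sqrt (2 * \<gamma>) * z) (at_right 0)"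
      by (intro tendsto_diff s da)
    show "eventually (\<lambda>\<beta>. 0 \<le> level_index \<gamma> (s \<beta>) \<beta> \<and> step_size \<gamma> \<beta> * level_index \<gamma> (s \<beta>) \<beta> - d \<beta> =
        a_norm (step_size \<gamma> \<beta>) + (s \<beta> - d \<beta> * a \<beta>) / a_norm (step_size \<gamma> \<beta>)) (at_right 0)"
      using level_index_eventually_in_range[OF g s] a2 eventually_small[OF zero_less_one] eventually_rho_less[OF zero_less_one, of \<gamma>]
    proof eventually_elim
      case (elim \<beta>)
      have "step_size \<gamma> \<beta> * level_index \<gamma> (s \<beta>) \<beta> = a \<beta> + s \<beta> / a \<beta>"
      proof -
        have gen: "b / q * (q * v / b) = v" if "b \<noteq> 0" "q \<noteq> 0" for b q v :: real using that by simp
        have "\<beta> \<noteq> 0" "sqrt (1 - rho \<gamma> \<beta>) \<noteq> 0" using elim by auto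
        then have "\<beta> / sqrt (1 - rho \<gamma> \<beta>) * level_index \<gamma> (s \<beta>) \<beta> = a \<beta> + s \<beta> / a \<beta>"
          unfolding level_index_def a_def by (rule gen)
        then show ?thesis unfolding step_size_def .
      qed
      then show ?case using elim by (simp add: a_def diff_divide_distrib)
    qed
    show "eventually (\<lambda>\<beta>. level_index \<gamma> (s \<beta>) \<beta> < real (truncation \<beta>)) (at_right 0)"
      using level_index_eventually_in_range[OF g s] by eventually_elim simp
    show "filterlim (\<lambda>\<beta>. (step_size \<gamma> \<beta> * (real (truncation \<beta>) + 1) - d \<beta> - a_norm (step_size \<gamma> \<beta>)) *
        a_norm (step_size \<gamma> \<beta>)) at_top (at_right 0)"
    proof (rule filterlim_at_top_mono[OF alim])
      have "eventually (\<lambda>\<beta>. d \<beta> < 1) (at_right 0)" by (rule order_tendstoD(2)[OF d0]) simp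
      then show "eventually (\<lambda>\<beta>. a \<beta> \<le> (step_size \<gamma> \<beta> * (real (truncation \<beta>) + 1) - d \<beta> - a_norm (step_size \<gamma> \<beta>)) *
        a_norm (step_size \<gamma> \<beta>)) (at_right 0)"
        using a_norm_step_le_ln[OF g] a2 eventually_small[OF zero_less_one] eventually_rho_less[OF zero_less_one, of \<gamma>]
      proof eventually_elim
        case (elim \<beta>)
        have "\<beta> \<le> step_size \<gamma> \<beta>" unfolding step_size_def
          using elim rho_nonneg[OF g, of \<beta>] by (simp add: pos_le_divide_eq mult_left_le)
        then have "\<beta> * (real (truncation \<beta>) + 1) \<le> step_size \<gamma> \<beta> * (real (truncation \<beta>) + 1)"
          by (intro mult_right_mono) auto
        then have "1 \<le> step_size \<gamma> \<beta> * (real (truncation \<beta>) + 1) - d \<beta> - a \<beta>"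
          using truncation_bounds(1)[of \<beta>] elim unfolding a_def by linarith
        then have "1 * a \<beta> \<le> (step_size \<gamma> \<beta> * (real (truncation \<beta>) + 1) - d \<beta> - a \<beta>) * a \<beta>"
          using elim by (intro mult_right_mono) auto
        then show ?case unfolding a_def by simp
      qed
    qed
  qed
  moreover have "step_size \<gamma> \<beta> * real j - d \<beta> = (\<beta> * real j - sqrt (rho \<gamma> \<beta>) * z) / sqrt (1 - rho \<gamma> \<beta>)" for \<beta> j
    by (simp add: step_size_def d_def diff_divide_distrib)
  ultimately show ?thesis by simp
qed

lemma std_normal_tail_tendsto_0: "(std_normal_tail \<longlongrightarrow> 0) at_top"
proof (rule tendsto_sandwich[OF _ _ tendsto_const])
  show "((\<lambda>v::real. 1 / v) \<longlongrightarrow> 0) at_top" by real_asymp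
  show "eventually (\<lambda>v. 0 \<le> std_normal_tail v) at_top" by (simp add: std_normal_tail_nonneg)
  show "eventually (\<lambda>v. std_normal_tail v \<le> 1 / v) at_top"
    using eventually_gt_at_top[of 0]
  proof eventually_elim
    case (elim v)
    have "1 \<le> sqrt (2 * pi)" using pi_gt3 by simp
    then have "1 / sqrt (2 * pi) \<le> 1" by simp
    moreover have "exp (- v\<^sup>2 / 2) \<le> 1" by simp
    ultimately have "std_normal_density v \<le> 1 * 1" unfolding std_normal_density_def by (intro mult_mono) auto
    then have "std_normal_density v / v \<le> 1 / v" using elim by (intro divide_right_mono) auto
    then show ?case using std_normal_tail_bounds(1)[OF elim] by linarith
  qed
qed

lemma shifted_prod_tendsto:
  assumes g: "0 \<le> \<gamma>" and s: "(s \<longlongrightarrow> s0) (at_right 0)" and t: "(t \<longlongrightarrow> t0) (at_right 0)"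
  shows "((\<lambda>\<beta>. \<Prod>i\<in>critical_indices \<gamma> (s \<beta>) (t \<beta>) \<beta>.
       1 - std_normal_tail ((\<beta> * real_of_int \<bar>i\<bar> - sqrt (rho \<gamma> \<beta>) * z) / sqrt (1 - rho \<gamma> \<beta>))) \<longlongrightarrow>
     exp (- (exp (- (s0 - sqrt (2 * \<gamma>) * z)) + exp (- (t0 - sqrt (2 * \<gamma>) * z))))) (at_right 0)"
proof -
  define T where "T \<beta> y = std_normal_tail ((\<beta> * y - sqrt (rho \<gamma> \<beta>) * z) / sqrt (1 - rho \<gamma> \<beta>))" for \<beta> y
  define m where "m \<beta> = T \<beta> (level_index \<gamma> (s \<beta>) \<beta>) + T \<beta> (level_index \<gamma> (t \<beta>) \<beta>)" for \<beta>
  have Tlim: "((\<lambda>\<beta>. T \<beta> (level_index \<gamma> (s \<beta>) \<beta>)) \<longlongrightarrow> 0) (at_right 0)"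
    if s: "(s \<longlongrightarrow> s0) (at_right 0)" for s s0
  proof -
    have "((\<lambda>\<beta>. s \<beta> / a_norm (step_size \<gamma> \<beta>)) \<longlongrightarrow> 0) (at_right 0)"
      by (rule real_tendsto_divide_at_top[OF s a_norm_step_at_top[OF g]])
    moreover have "((\<lambda>\<beta>. sqrt (rho \<gamma> \<beta>) * z / sqrt (1 - rho \<gamma> \<beta>)) \<longlongrightarrow> sqrt 0 * z / sqrt (1 - 0)) (at_right 0)"
      by (intro tendsto_intros rho_tendsto_0) auto
    ultimately have "((\<lambda>\<beta>. s \<beta> / a_norm (step_size \<gamma> \<beta>) - sqrt (rho \<gamma> \<beta>) * z / sqrt (1 - rho \<gamma> \<beta>)) \<longlongrightarrow> 0 - sqrt 0 * z / sqrt (1 - 0)) (at_right 0)"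
      by (rule tendsto_diff)
    then have "filterlim (\<lambda>\<beta>. s \<beta> / a_norm (step_size \<gamma> \<beta>) - sqrt (rho \<gamma> \<beta>) * z / sqrt (1 - rho \<gamma> \<beta>) + a_norm (step_size \<gamma> \<beta>)) at_top (at_right 0)"
      by (rule filterlim_tendsto_add_at_top[OF _ a_norm_step_at_top[OF g]])
    moreover have "eventually (\<lambda>\<beta>. s \<beta> / a_norm (step_size \<gamma> \<beta>) - sqrt (rho \<gamma> \<beta>) * z / sqrt (1 - rho \<gamma> \<beta>) + a_norm (step_size \<gamma> \<beta>) =
       (\<beta> * level_index \<gamma> (s \<beta>) \<beta> - sqrt (rho \<gamma> \<beta>) * z) / sqrt (1 - rho \<gamma> \<beta>)) (at_right 0)"
      using eventually_small[OF zero_less_one] eventually_rho_less[OF zero_less_one, of \<gamma>]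
    proof eventually_elim
      case (elim \<beta>)
      define q where "q = sqrt (1 - rho \<gamma> \<beta>)"
      have "\<beta> \<noteq> 0" "q \<noteq> 0" using elim by (auto simp: q_def)
      then show ?case unfolding level_index_def q_def[symmetric] by (simp add: diff_divide_distrib)
    qed
    ultimately have "filterlim (\<lambda>\<beta>. (\<beta> * level_index \<gamma> (s \<beta>) \<beta> - sqrt (rho \<gamma> \<beta>) * z) / sqrt (1 - rho \<gamma> \<beta>)) at_top (at_right 0)"
      using filterlim_cong[OF refl refl] by fast
    then show ?thesis unfolding T_def by (rule filterlim_compose[OF std_normal_tail_tendsto_0])
  qed
  have "((\<lambda>\<beta>. \<Prod>i\<in>critical_indices \<gamma> (s \<beta>) (t \<beta>) \<beta>.
       1 - T \<beta> (real_of_int \<bar>i\<bar>)) \<longlongrightarrow>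
     exp (- (exp (- (s0 - sqrt (2 * \<gamma>) * z)) + exp (- (t0 - sqrt (2 * \<gamma>) * z))))) (at_right 0)"
  proof (rule prod_one_minus_tendsto_exp[OF finite_outer_indices])
    have "((\<lambda>\<beta>. m \<beta>) \<longlongrightarrow> 0 + 0) (at_right 0)" unfolding m_def by (intro tendsto_add Tlim[OF s] Tlim[OF t])
    then show "(m \<longlongrightarrow> 0) (at_right 0)" by simp
    show "eventually (\<lambda>\<beta>. \<forall>i\<in>critical_indices \<gamma> (s \<beta>) (t \<beta>) \<beta>.
        0 \<le> T \<beta> (real_of_int \<bar>i\<bar>) \<and> T \<beta> (real_of_int \<bar>i\<bar>) \<le> m \<beta>) (at_right 0)"
      using eventually_small[OF zero_less_one] eventually_rho_less[OF zero_less_one, of \<gamma>]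
    proof eventually_elim
      case (elim \<beta>)
      have mono: "T \<beta> y' \<le> T \<beta> y" if "y \<le> y'" for y y'
        unfolding T_def using that elim
        by (intro std_normal_tail_antimono divide_right_mono diff_right_mono mult_left_mono) auto
      have T0: "0 \<le> T \<beta> y" for y unfolding T_def by (rule std_normal_tail_nonneg)
      show ?case
      proof (intro ballI conjI T0)
        fix i assume "i \<in> critical_indices \<gamma> (s \<beta>) (t \<beta>) \<beta>"
        then have "level_index \<gamma> (s \<beta>) \<beta> \<le> real_of_int \<bar>i\<bar> \<or> level_index \<gamma> (t \<beta>) \<beta> \<le> real_of_int \<bar>i\<bar>"
          unfolding outer_indices_def by auto
        then show "T \<beta> (real_of_int \<bar>i\<bar>) \<le> m \<beta>"
          unfolding m_def using mono T0[of "level_index \<gamma> (s \<beta>) \<beta>"] T0[of "level_index \<gamma> (t \<beta>) \<beta>"] by fastforce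
      qed
    qed
    have "((\<lambda>\<beta>. (\<Sum>j\<in>{j::nat. level_index \<gamma> (s \<beta>) \<beta> < real j \<and> j \<le> truncation \<beta>}. T \<beta> (real j)) +
        (\<Sum>j\<in>{j::nat. level_index \<gamma> (t \<beta>) \<beta> < real j \<and> j \<le> truncation \<beta>}. T \<beta> (real j))) \<longlongrightarrow>
       exp (- (s0 - sqrt (2 * \<gamma>) * z)) + exp (- (t0 - sqrt (2 * \<gamma>) * z))) (at_right 0)"
      unfolding T_def by (intro tendsto_add shifted_tail_sum_tendsto[OF g s] shifted_tail_sum_tendsto[OF g t])
    moreover have "eventually (\<lambda>\<beta>. (\<Sum>j\<in>{j::nat. level_index \<gamma> (s \<beta>) \<beta> < real j \<and> j \<le> truncation \<beta>}. T \<beta> (real j)) +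
        (\<Sum>j\<in>{j::nat. level_index \<gamma> (t \<beta>) \<beta> < real j \<and> j \<le> truncation \<beta>}. T \<beta> (real j)) =
      (\<Sum>i\<in>critical_indices \<gamma> (s \<beta>) (t \<beta>) \<beta>. T \<beta> (real_of_int \<bar>i\<bar>))) (at_right 0)"
      using level_index_eventually_in_range[OF g s] level_index_eventually_in_range[OF g t]
    proof eventually_elim
      case (elim \<beta>)
      then show ?case
        using sum_outer_indices[of "level_index \<gamma> (s \<beta>) \<beta>" "level_index \<gamma> (t \<beta>) \<beta>" "\<lambda>i. T \<beta> (real_of_int i)" "truncation \<beta>"]
        by simp
    qed
    ultimately show "((\<lambda>\<beta>. \<Sum>i\<in>critical_indices \<gamma> (s \<beta>) (t \<beta>) \<beta>. T \<beta> (real_of_int \<bar>i\<bar>)) \<longlongrightarrow>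
       exp (- (s0 - sqrt (2 * \<gamma>) * z)) + exp (- (t0 - sqrt (2 * \<gamma>) * z))) (at_right 0)"
      by (rule Lim_transform_eventually)
  qed
  then show ?thesis unfolding T_def .
qed

text \<open>
Probabilities are bounded by 1, so the limit may be taken inside the integral over the common
component.
\<close>

lemma equicorrelated_limit:
  assumes g: "0 \<le> \<gamma>" and s: "(s \<longlongrightarrow> s0) (at_right 0)" and t: "(t \<longlongrightarrow> t0) (at_right 0)"
  shows "((\<lambda>\<beta>. \<integral>z. (\<Prod>i\<in>critical_indices \<gamma> (s \<beta>) (t \<beta>) \<beta>.
       1 - std_normal_tail ((\<beta> * real_of_int \<bar>i\<bar> - sqrt (rho \<gamma> \<beta>) * z) / sqrt (1 - rho \<gamma> \<beta>))) \<partial>std_normal_distribution) \<longlongrightarrow>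
     (\<integral>z. exp (- (exp (- (s0 - sqrt (2 * \<gamma>) * z)) + exp (- (t0 - sqrt (2 * \<gamma>) * z)))) \<partial>std_normal_distribution)) (at_right 0)"
proof (rule tendsto_at_right_sequentially[OF zero_less_one])
  interpret N: prob_space std_normal_distribution by (rule prob_space_std_normal)
  fix S :: "nat \<Rightarrow> real" assume S: "\<And>n. 0 < S n" "S \<longlonglongrightarrow> 0"
  have lim: "filterlim S (at_right 0) sequentially"
    using S by (auto simp: filterlim_at less_imp_neq[OF S(1), symmetric])
  let ?f = "\<lambda>\<beta> z. (\<Prod>i\<in>critical_indices \<gamma> (s \<beta>) (t \<beta>) \<beta>.
       1 - std_normal_tail ((\<beta> * real_of_int \<bar>i\<bar> - sqrt (rho \<gamma> \<beta>) * z) / sqrt (1 - rho \<gamma> \<beta>)))"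
  show "(\<lambda>n. \<integral>z. ?f (S n) z \<partial>std_normal_distribution) \<longlonglongrightarrow>
    (\<integral>z. exp (- (exp (- (s0 - sqrt (2 * \<gamma>) * z)) + exp (- (t0 - sqrt (2 * \<gamma>) * z)))) \<partial>std_normal_distribution)"
  proof (rule integral_dominated_convergence[where w = "\<lambda>_. 1"])
    show "AE z in std_normal_distribution. (\<lambda>n. ?f (S n) z) \<longlonglongrightarrow>
        exp (- (exp (- (s0 - sqrt (2 * \<gamma>) * z)) + exp (- (t0 - sqrt (2 * \<gamma>) * z))))"
      by (intro AE_I2 filterlim_compose[OF shifted_prod_tendsto[OF g s t] lim])
    have le1: "std_normal_tail v \<le> 1" for v unfolding std_normal_tail_def by (rule N.prob_le_1)
    have "norm (?f \<beta> z) \<le> 1" for \<beta> z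
    proof -
      have "norm (?f \<beta> z) = ?f \<beta> z" using le1 by (auto simp: prod_nonneg)
      also have "\<dots> \<le> 1" using le1 std_normal_tail_nonneg by (intro prod_le_1) auto
      finally show ?thesis .
    qed
    then show "AE z in std_normal_distribution. norm (?f (S n) z) \<le> 1" for n by simp
  qed auto
qed

section \<open>The comparison error\<close>

text \<open>
A geometric series with ratio exp(-w \<beta>/2), once on each side of the origin.
\<close>

lemma sum_weight_le:
  fixes J :: "int set" and w \<beta> :: real
  assumes pos: "0 < \<beta>" "0 < w" "w * \<beta> \<le> 2"
    and J: "\<And>k. k \<in> J \<Longrightarrow> \<bar>k\<bar> \<le> int N \<and> w \<le> \<beta> * real_of_int \<bar>k\<bar>"
  shows "(\<Sum>k\<in>J. exp (- (w * (\<beta> * real_of_int \<bar>k\<bar> - w) / 2))) \<le> 8 / (w * \<beta>)"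
proof -
  define m where "m = nat \<lceil>w / \<beta>\<rceil>"
  define q where "q = exp (- (w * \<beta> / 2))"
  have m: "w \<le> \<beta> * real m"
  proof -
    have "w / \<beta> \<le> real m" unfolding m_def using pos by (simp add: real_nat_ceiling_ge)
    then show ?thesis using pos by (simp add: pos_divide_le_eq mult.commute)
  qed
  define g where "g j = exp (- (w * (\<beta> * real j - w) / 2))" for j :: nat
  have side: "(\<Sum>j\<in>{m..N}. g j) \<le> 4 / (w * \<beta>)"
  proof -
    have "(\<Sum>j\<in>{m..N}. g j) \<le> (\<Sum>j\<in>{m..N}. q ^ (j - m))"
    proof (rule sum_mono)
      fix j assume j: "j \<in> {m..N}"
      have "w * (\<beta> * (real j - real m)) \<le> w * (\<beta> * real j - w)"
        using m pos by (intro mult_left_mono) (auto simp: algebra_simps)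
      then have "g j \<le> exp (real (j - m) * (- (w * \<beta> / 2)))"
      proof -
        assume X: "w * (\<beta> * (real j - real m)) \<le> w * (\<beta> * real j - w)"
        have "real (j - m) * (- (w * \<beta> / 2)) = - (w * (\<beta> * (real j - real m)) / 2)"
          using j by (simp add: of_nat_diff)
        then show ?thesis unfolding g_def using X by (subst exp_le_cancel_iff) linarith
      qed
      then show "g j \<le> q ^ (j - m)" unfolding q_def exp_of_nat_mult .
    qed
    also have "\<dots> = (\<Sum>i<Suc N - m. q ^ i)"
      by (rule sum.reindex_bij_witness[of _ "\<lambda>i. i + m" "\<lambda>j. j - m"]) auto
    also have "\<dots> \<le> 4 / (w * \<beta>)"
    proof -
      define x where "x = w * \<beta> / 2"
      have x: "0 < x" "x \<le> 1" using pos unfolding x_def by auto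
      have "exp (- x) \<le> 1 - x / 2"
      proof -
        have "1 + x \<le> exp x" by (rule exp_ge_add_one_self)
        then have "exp (- x) \<le> 1 / (1 + x)" using x by (simp add: exp_minus inverse_eq_divide frac_le)
        also have "\<dots> \<le> 1 - x / 2"
        proof -
          have "x * x \<le> x" using x by (simp add: mult_left_le)
          then have "1 \<le> (1 - x / 2) * (1 + x)" by (simp add: algebra_simps)
          then show ?thesis using x by (simp add: pos_divide_le_eq)
        qed
        finally show ?thesis .
      qed
      then have q: "x / 2 \<le> 1 - q" unfolding q_def x_def[symmetric] by linarith
      have s0: "0 \<le> (\<Sum>i<Suc N - m. q ^ i)" unfolding q_def by (intro sum_nonneg) auto
      have "(1 - q) * (\<Sum>i<Suc N - m. q ^ i) = 1 - q ^ (Suc N - m)" by (rule one_diff_power_eq[symmetric])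
      also have "\<dots> \<le> 1" unfolding q_def by simp
      finally have "x / 2 * (\<Sum>i<Suc N - m. q ^ i) \<le> 1" using mult_right_mono[OF q s0] by linarith
      then have "(\<Sum>i<Suc N - m. q ^ i) \<le> 2 / x" using x by (simp add: pos_le_divide_eq mult.commute)
      also have "2 / x = 4 / (w * \<beta>)" unfolding x_def by simp
      finally show ?thesis .
    qed
    finally show ?thesis .
  qed
  have sub: "J \<subseteq> int ` {m..N} \<union> (\<lambda>j. - int j) ` {m..N}"
  proof
    fix k assume k: "k \<in> J"
    have "w / \<beta> \<le> real_of_int \<bar>k\<bar>" using J[OF k] pos by (simp add: pos_divide_le_eq mult.commute)
    then have "\<lceil>w / \<beta>\<rceil> \<le> \<bar>k\<bar>" by (simp add: ceiling_le_iff)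
    then have "m \<le> nat \<bar>k\<bar>" unfolding m_def by (rule nat_mono)
    then have "nat \<bar>k\<bar> \<in> {m..N}" using J[OF k] by auto
    moreover have "k = int (nat \<bar>k\<bar>) \<or> k = - int (nat \<bar>k\<bar>)" by auto
    ultimately show "k \<in> int ` {m..N} \<union> (\<lambda>j. - int j) ` {m..N}" by blast
  qed
  let ?f = "\<lambda>k. exp (- (w * (\<beta> * real_of_int \<bar>k\<bar> - w) / 2))"
  have "(\<Sum>k\<in>J. ?f k) \<le> (\<Sum>k\<in>int ` {m..N} \<union> (\<lambda>j. - int j) ` {m..N}. ?f k)"
    using sub by (intro sum_mono2) auto
  also have "\<dots> \<le> (\<Sum>k\<in>int ` {m..N}. ?f k) + (\<Sum>k\<in>(\<lambda>j. - int j) ` {m..N}. ?f k)"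
    by (subst sum_Un) (auto intro!: sum_nonneg)
  also have "\<dots> = (\<Sum>j\<in>{m..N}. g j) + (\<Sum>j\<in>{m..N}. g j)"
    by (subst (1 2) sum.reindex) (auto simp: inj_on_def g_def)
  also have "\<dots> \<le> 4 / (w * \<beta>) + 4 / (w * \<beta>)" by (intro add_mono side)
  also have "\<dots> = 8 / (w * \<beta>)" by (simp only: add_divide_distrib[symmetric]) simp
  finally show ?thesis .
qed

text \<open>
Here p and q measure how far the two thresholds exceed their common lower bound w. The square
satisfies (2 w + p + q)^2 / 4 \<ge> w^2 + w (p + q). The first bound discards the decay in q, which is
affordable if the second index stays near the first; the second bound replaces the denominator
1 + R by 1 at the price of the constant exp C.
\<close>

lemma comparison_term_le:
  fixes D R \<theta> w p q :: real
  assumes D: "0 \<le> D" and R: "0 \<le> R" "R \<le> \<theta>" "\<theta> < 1" and w: "0 \<le> w" "0 \<le> p" "0 \<le> q"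
  shows "D / (1 - R) * exp (- (w + p + (w + q))\<^sup>2 / (4 * (1 + R))) \<le>
      D / (1 - \<theta>) * (exp (- (w\<^sup>2 / (1 + \<theta>))) * exp (- (w * p / 2)))"
    and "w\<^sup>2 * R \<le> C \<Longrightarrow> D / (1 - R) * exp (- (w + p + (w + q))\<^sup>2 / (4 * (1 + R))) \<le>
      D / (1 - \<theta>) * (exp C * exp (- w\<^sup>2) * (exp (- (w * p / 2)) * exp (- (w * q / 2))))"
proof -
  have sq: "w\<^sup>2 + w * (p + q) \<le> (w + p + (w + q))\<^sup>2 / 4"
  proof -
    have "(w + p + (w + q))\<^sup>2 / 4 = w\<^sup>2 + w * (p + q) + ((p + q) / 2)\<^sup>2" by (simp add: power2_eq_square field_simps)
    then show ?thesis by simp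
  qed
  have base: "(w\<^sup>2 + w * (p + q)) / (1 + R) \<le> (w + p + (w + q))\<^sup>2 / (4 * (1 + R))"
    using divide_right_mono[OF sq, of "1 + R"] R by simp
  have DR: "D / (1 - R) \<le> D / (1 - \<theta>)" using D R by (intro divide_left_mono) auto
  have split: "(w\<^sup>2 + w * (p + q)) / (1 + R) = w\<^sup>2 / (1 + R) + w * (p + q) / (1 + R)" by (rule add_divide_distrib)
  have half: "w * (p + q) / 2 \<le> w * (p + q) / (1 + R)" using R w by (intro divide_left_mono) auto
  have pq: "w * p / 2 \<le> w * (p + q) / 2" using w by (intro divide_right_mono mult_left_mono) auto
  have "w\<^sup>2 / (1 + \<theta>) \<le> w\<^sup>2 / (1 + R)" using R by (intro divide_left_mono) auto
  then have 1: "w\<^sup>2 / (1 + \<theta>) + w * p / 2 \<le> (w + p + (w + q))\<^sup>2 / (4 * (1 + R))"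
    using base split half pq by linarith
  have "exp (- (w + p + (w + q))\<^sup>2 / (4 * (1 + R))) \<le> exp (- (w\<^sup>2 / (1 + \<theta>))) * exp (- (w * p / 2))"
    unfolding exp_add[symmetric] minus_divide_left[symmetric] using 1 by (subst exp_le_cancel_iff) linarith
  then show "D / (1 - R) * exp (- (w + p + (w + q))\<^sup>2 / (4 * (1 + R))) \<le>
      D / (1 - \<theta>) * (exp (- (w\<^sup>2 / (1 + \<theta>))) * exp (- (w * p / 2)))"
    using DR D R by (intro mult_mono) auto
  assume C: "w\<^sup>2 * R \<le> C"
  have "w\<^sup>2 - w\<^sup>2 * R \<le> w\<^sup>2 / (1 + R)"
  proof -
    have "(w\<^sup>2 - w\<^sup>2 * R) * (1 + R) = w\<^sup>2 - w\<^sup>2 * R\<^sup>2" by (simp add: power2_eq_square algebra_simps)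
    also have "\<dots> \<le> w\<^sup>2" by simp
    finally show ?thesis using R by (simp add: pos_le_divide_eq)
  qed
  moreover have "w * (p + q) / 2 = w * p / 2 + w * q / 2" by (simp add: distrib_left add_divide_distrib)
  ultimately have 2: "w\<^sup>2 - C + (w * p / 2 + w * q / 2) \<le> (w + p + (w + q))\<^sup>2 / (4 * (1 + R))"
    using base split half C by linarith
  have "exp (- (w + p + (w + q))\<^sup>2 / (4 * (1 + R))) \<le> exp C * exp (- w\<^sup>2) * (exp (- (w * p / 2)) * exp (- (w * q / 2)))"
    unfolding exp_add[symmetric] minus_divide_left[symmetric] using 2 by (subst exp_le_cancel_iff) linarith
  then show "D / (1 - R) * exp (- (w + p + (w + q))\<^sup>2 / (4 * (1 + R))) \<le>
      D / (1 - \<theta>) * (exp C * exp (- w\<^sup>2) * (exp (- (w * p / 2)) * exp (- (w * q / 2))))"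
    using DR D R by (intro mult_mono) auto
qed

lemma card_near_le:
  fixes J :: "int set"
  assumes "0 \<le> n"
  shows "real (card {l \<in> J. real_of_int \<bar>k - l\<bar> \<le> n}) \<le> 2 * n + 1"
proof -
  have "{l \<in> J. real_of_int \<bar>k - l\<bar> \<le> n} \<subseteq> {k - \<lfloor>n\<rfloor>..k + \<lfloor>n\<rfloor>}"
  proof
    fix l assume "l \<in> {l \<in> J. real_of_int \<bar>k - l\<bar> \<le> n}"
    then have "real_of_int (k - l) \<le> n" "real_of_int (l - k) \<le> n" by auto
    then have "k - l \<le> \<lfloor>n\<rfloor>" "l - k \<le> \<lfloor>n\<rfloor>" by (simp_all only: le_floor_iff)
    then show "l \<in> {k - \<lfloor>n\<rfloor>..k + \<lfloor>n\<rfloor>}" by simp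
  qed
  then have "card {l \<in> J. real_of_int \<bar>k - l\<bar> \<le> n} \<le> card {k - \<lfloor>n\<rfloor>..k + \<lfloor>n\<rfloor>}" by (intro card_mono) auto
  also have "\<dots> = nat (2 * \<lfloor>n\<rfloor> + 1)" by simp
  finally have "real (card {l \<in> J. real_of_int \<bar>k - l\<bar> \<le> n}) \<le> real (nat (2 * \<lfloor>n\<rfloor> + 1))" by simp
  also have "\<dots> = 2 * real_of_int \<lfloor>n\<rfloor> + 1" using assms by simp
  also have "\<dots> \<le> 2 * n + 1" using of_int_floor_le[of n] by linarith
  finally show ?thesis .
qed

text \<open>
Three regimes for a pair of indices: within distance n1, within distance n2, or no restriction. In the first
two the inner sum is bounded by the number of neighbours, in the last it factorises.
\<close>

lemma double_sum_near_far_le: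
  fixes J :: "int set" and e :: "int \<Rightarrow> real"
  assumes J: "finite J" and n: "0 \<le> n1" "0 \<le> n2" and c: "0 \<le> c1" "0 \<le> c2" "0 \<le> c3"
    and e: "\<And>k. 0 \<le> e k"
    and T: "\<And>k l. k \<in> J \<Longrightarrow> l \<in> J \<Longrightarrow> k \<noteq> l \<Longrightarrow>
      (real_of_int \<bar>k - l\<bar> \<le> n1 \<and> T k l \<le> c1 * e k) \<or> (real_of_int \<bar>k - l\<bar> \<le> n2 \<and> T k l \<le> c2 * e k) \<or> T k l \<le> c3 * (e k * e l)"
  shows "(\<Sum>k\<in>J. \<Sum>l\<in>J - {k}. T k l) \<le> (c1 * (2 * n1 + 1) + c2 * (2 * n2 + 1)) * (\<Sum>k\<in>J. e k) + c3 * (\<Sum>k\<in>J. e k)\<^sup>2"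
proof -
  let ?ind = "\<lambda>n k l. if real_of_int \<bar>k - l\<bar> \<le> n then 1 else 0 :: real"
  have near: "(\<Sum>l\<in>J. ?ind n k l) \<le> 2 * n + 1" if "0 \<le> n" for n and k :: int
  proof -
    have "(\<Sum>l\<in>J. ?ind n k l) = real (card {l \<in> J. real_of_int \<bar>k - l\<bar> \<le> n})"
      using J by (simp add: sum.If_cases Int_def)
    then show ?thesis using card_near_le[OF that] by simp
  qed
  have "(\<Sum>k\<in>J. \<Sum>l\<in>J - {k}. T k l) \<le> (\<Sum>k\<in>J. \<Sum>l\<in>J. c1 * e k * ?ind n1 k l + c2 * e k * ?ind n2 k l + c3 * (e k * e l))"
  proof (rule sum_mono)
    fix k assume k: "k \<in> J"
    have "(\<Sum>l\<in>J - {k}. T k l) \<le> (\<Sum>l\<in>J - {k}. c1 * e k * ?ind n1 k l + c2 * e k * ?ind n2 k l + c3 * (e k * e l))"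
    proof (rule sum_mono)
      fix l assume l: "l \<in> J - {k}"
      have pos: "0 \<le> c1 * e k * ?ind n1 k l" "0 \<le> c2 * e k * ?ind n2 k l" "0 \<le> c3 * (e k * e l)" using c e by auto
      from T[of k l] k l consider "real_of_int \<bar>k - l\<bar> \<le> n1" "T k l \<le> c1 * e k" | "real_of_int \<bar>k - l\<bar> \<le> n2" "T k l \<le> c2 * e k"
        | "T k l \<le> c3 * (e k * e l)" by blast
      then show "T k l \<le> c1 * e k * ?ind n1 k l + c2 * e k * ?ind n2 k l + c3 * (e k * e l)"
        using pos by cases (simp_all split: if_splits)
    qed
    also have "\<dots> \<le> (\<Sum>l\<in>J. c1 * e k * ?ind n1 k l + c2 * e k * ?ind n2 k l + c3 * (e k * e l))"
      using J c e by (intro sum_mono2) auto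
    finally show "(\<Sum>l\<in>J - {k}. T k l) \<le> (\<Sum>l\<in>J. c1 * e k * ?ind n1 k l + c2 * e k * ?ind n2 k l + c3 * (e k * e l))" .
  qed
  also have "\<dots> = (\<Sum>k\<in>J. c1 * e k * (\<Sum>l\<in>J. ?ind n1 k l) + c2 * e k * (\<Sum>l\<in>J. ?ind n2 k l) + c3 * (e k * (\<Sum>l\<in>J. e l)))"
    by (simp only: sum.distrib sum_distrib_left)
  also have "\<dots> \<le> (\<Sum>k\<in>J. c1 * e k * (2 * n1 + 1) + c2 * e k * (2 * n2 + 1) + c3 * (e k * (\<Sum>l\<in>J. e l)))"
    using c e n by (intro sum_mono add_mono mult_left_mono near) auto
  also have "\<dots> = (\<Sum>k\<in>J. (c1 * (2 * n1 + 1) + c2 * (2 * n2 + 1)) * e k + c3 * (\<Sum>l\<in>J. e l) * e k)"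
    by (intro sum.cong refl) (simp add: algebra_simps)
  also have "\<dots> = (c1 * (2 * n1 + 1) + c2 * (2 * n2 + 1)) * (\<Sum>k\<in>J. e k) + c3 * (\<Sum>l\<in>J. e l) * (\<Sum>k\<in>J. e k)"
    by (simp only: sum.distrib sum_distrib_left)
  finally show ?thesis by (simp add: power2_eq_square mult.assoc)
qed

lemma eventually_ln_inverse:
  "eventually P at_top \<Longrightarrow> eventually (\<lambda>\<beta>::real. P (ln (1 / \<beta>))) (at_right 0)"
  by (rule eventually_compose_filterlim[OF _ ln_inverse_at_top])

text \<open>
With a = ln n and r = r_n, L (r - \<gamma>/L) = r a (L - a)/a + (r a - \<gamma>). In the given range of n,
|L - a| = O(ln L) is negligible compared with a, and r a - \<gamma> tends to 0 by hypothesis.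
\<close>

lemma far_covariance_close:
  fixes r :: "nat \<Rightarrow> real"
  assumes lim: "(\<lambda>n. r n * ln (real n)) \<longlonglongrightarrow> \<gamma>" and e: "0 < \<epsilon>"
  shows "eventually (\<lambda>\<beta>. \<forall>n. 1 / (\<beta> * ln (1 / \<beta>)) < real n \<and> n \<le> 2 * truncation \<beta> \<longrightarrow>
      \<bar>r n - rho \<gamma> \<beta>\<bar> \<le> \<epsilon> / ln (1 / \<beta>)) (at_right 0)"
proof -
  obtain M where M: "M > 0" "\<And>n. \<bar>r n * ln (real n)\<bar> \<le> M"
    using convergent_imp_Bseq[OF convergentI[OF lim]] by (auto simp: Bseq_def)
  obtain n0 where n0: "\<And>n. n0 \<le> n \<Longrightarrow> \<bar>r n * ln (real n) - \<gamma>\<bar> < \<epsilon> / 2"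
    using LIMSEQ_D[OF lim, of "\<epsilon> / 2"] e by auto
  have "((\<lambda>L::real. (2 * ln L + 1) / (L - ln L)) \<longlongrightarrow> 0) at_top" by real_asymp
  then have "eventually (\<lambda>L::real. (2 * ln L + 1) / (L - ln L) < \<epsilon> / (2 * M)) at_top"
    by (rule order_tendstoD) (use e M in simp)
  moreover have "eventually (\<lambda>L::real. 0 < L - ln L) at_top" by real_asymp
  moreover have "eventually (\<lambda>L::real. 1 < L) at_top" by real_asymp
  moreover have "filterlim (\<lambda>L::real. exp L / L) at_top at_top" by real_asymp
  then have "eventually (\<lambda>L::real. real n0 < exp L / L) at_top" by (simp add: filterlim_at_top_dense)
  ultimately have "eventually (\<lambda>L::real. (2 * ln L + 1) / (L - ln L) < \<epsilon> / (2 * M) \<and> 0 < L - ln L \<and> 1 < L \<and> real n0 < exp L / L) at_top"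
    by eventually_elim simp
  from eventually_ln_inverse[OF this] eventually_small[OF zero_less_one] show ?thesis
  proof eventually_elim
    case (elim \<beta>)
    define L where "L = ln (1 / \<beta>)"
    have L: "(2 * ln L + 1) / (L - ln L) < \<epsilon> / (2 * M)" "0 < L - ln L" "1 < L" "real n0 < exp L / L"
      using elim unfolding L_def by blast+
    have \<beta>: "0 < \<beta>" "\<beta> < 1" using elim by auto
    have expL: "exp L = 1 / \<beta>" unfolding L_def using \<beta> by simp
    have rho: "rho \<gamma> \<beta> = \<gamma> / L" unfolding L_def by (rule rho_eq[OF \<beta>])
    have lnL: "0 < ln L" using L by simp
    show ?case
    proof (intro allI impI, elim conjE)
      fix n assume n: "1 / (\<beta> * ln (1 / \<beta>)) < real n" "n \<le> 2 * truncation \<beta>"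
      have low: "exp L / L < real n" using n(1) unfolding L_def[symmetric] expL by simp
      then have npos: "0 < real n" using L by (smt (verit) divide_nonneg_nonneg exp_ge_zero)
      have "ln (exp L / L) < ln (real n)" using low L by (subst ln_less_cancel_iff) (auto simp: npos)
      then have l1: "L - ln L < ln (real n)" using L by (simp add: ln_div)
      have "\<beta> * real n \<le> 2 * L\<^sup>2"
      proof -
        have "real n \<le> 2 * real (truncation \<beta>)" using of_nat_mono[OF n(2), where 'a = real] by simp
        then have "\<beta> * real n \<le> \<beta> * (2 * real (truncation \<beta>))" using \<beta> by (intro mult_left_mono) auto
        then show ?thesis using truncation_bounds(2)[OF \<beta>] unfolding L_def[symmetric] by linarith
      qed
      then have "real n \<le> 2 * L\<^sup>2 * exp L" unfolding expL using \<beta> by (simp add: field_simps)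
      then have "ln (real n) \<le> ln (2 * L\<^sup>2 * exp L)" using npos L by (subst ln_le_cancel_iff) auto
      also have "\<dots> = ln 2 + 2 * ln L + L" using L by (simp add: ln_mult ln_realpow)
      finally have l2: "ln (real n) \<le> 1 + 2 * ln L + L" using ln_2_less_1 by linarith
      have lnn: "0 < ln (real n)" using l1 L by linarith
      have "\<bar>L - ln (real n)\<bar> \<le> 2 * ln L + 1" using l1 l2 lnL by linarith
      then have "\<bar>L - ln (real n)\<bar> / ln (real n) \<le> (2 * ln L + 1) / (L - ln L)"
        using l1 L lnL by (intro frac_le) auto
      then have q: "\<bar>L - ln (real n)\<bar> / ln (real n) \<le> \<epsilon> / (2 * M)" using L(1) by linarith
      have "real n0 < real n" using L(4) low by linarith
      then have nn: "\<bar>r n * ln (real n) - \<gamma>\<bar> < \<epsilon> / 2" by (intro n0) simp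
      have "L * (r n - \<gamma> / L) = r n * ln (real n) * ((L - ln (real n)) / ln (real n)) + (r n * ln (real n) - \<gamma>)"
        using lnn L by (simp add: field_simps)
      then have "\<bar>L * (r n - \<gamma> / L)\<bar> \<le> \<bar>r n * ln (real n) * ((L - ln (real n)) / ln (real n))\<bar> + \<bar>r n * ln (real n) - \<gamma>\<bar>"
        by simp
      also have "\<bar>r n * ln (real n) * ((L - ln (real n)) / ln (real n))\<bar> = \<bar>r n * ln (real n)\<bar> * (\<bar>L - ln (real n)\<bar> / ln (real n))"
        using lnn by (simp add: abs_mult)
      also have "\<dots> \<le> M * (\<epsilon> / (2 * M))" using M q lnn by (intro mult_mono) auto
      also have "\<dots> = \<epsilon> / 2" using M by simp
      finally have "\<bar>L * (r n - \<gamma> / L)\<bar> \<le> \<epsilon>" using nn by linarith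
      then have "L * \<bar>r n - \<gamma> / L\<bar> \<le> \<epsilon>" using L by (simp add: abs_mult)
      then show "\<bar>r n - rho \<gamma> \<beta>\<bar> \<le> \<epsilon> / ln (1 / \<beta>)"
        unfolding rho L_def[symmetric] using L by (simp add: pos_le_divide_eq mult.commute)
    qed
  qed
qed

text \<open>
All thresholds outside the window exceed w = sqrt (1-\<rho>) (a - c/a) for a suitable constant c.
Passing from a to w changes the square by a bounded amount, as \<rho> a^2 is bounded, so
exp(-w^2/2) keeps the order \<beta> L of exp(-a^2/2).
\<close>

lemma threshold_lower_bound:
  assumes g: "0 \<le> \<gamma>" and s: "(s \<longlongrightarrow> s0) (at_right 0)" and t: "(t \<longlongrightarrow> t0) (at_right 0)"
  obtains w :: "real \<Rightarrow> real" and A where "A > 0"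
    "eventually (\<lambda>\<beta>. \<forall>k\<in>critical_indices \<gamma> (s \<beta>) (t \<beta>) \<beta>.
        w \<beta> \<le> \<beta> * real_of_int \<bar>k\<bar>) (at_right 0)"
    "eventually (\<lambda>\<beta>. 1 \<le> w \<beta> \<and> ln (1 / \<beta>) \<le> (w \<beta>)\<^sup>2 \<and> (w \<beta>)\<^sup>2 \<le> 3 * ln (1 / \<beta>)) (at_right 0)"
    "eventually (\<lambda>\<beta>. exp (- ((w \<beta>)\<^sup>2 / 2)) \<le> A * \<beta> * ln (1 / \<beta>)) (at_right 0)"
proof
  define a where "a \<beta> = a_norm (step_size \<gamma> \<beta>)" for \<beta>
  \<comment> \<open>Eventually - c is below both second-order terms s and t.\<close>
  define c where "c = \<bar>s0\<bar> + \<bar>t0\<bar> + 1"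
  define w where "w \<beta> = sqrt (1 - rho \<gamma> \<beta>) * (a \<beta> - c / a \<beta>)" for \<beta>
  define A where "A = exp (c + \<gamma> + 1 / 2) * (8 * sqrt (2 * pi))"
  have c: "c > 0" unfolding c_def by auto
  have alim: "filterlim a at_top (at_right 0)" unfolding a_def by (rule a_norm_step_at_top[OF g])
  have sc: "eventually (\<lambda>\<beta>. - c < s \<beta>) (at_right 0)" "eventually (\<lambda>\<beta>. - c < t \<beta>) (at_right 0)"
    by (rule order_tendstoD(1)[OF s], simp add: c_def, rule order_tendstoD(1)[OF t], simp add: c_def)
  have a1: "eventually (\<lambda>\<beta>. 1 \<le> a \<beta>) (at_right 0)" "eventually (\<lambda>\<beta>. c + 1 \<le> a \<beta>) (at_right 0)"
    using alim by (auto simp: filterlim_at_top)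
  have ca: "((\<lambda>\<beta>. c / a \<beta>) \<longlongrightarrow> 0) (at_right 0)" by (rule real_tendsto_divide_at_top[OF tendsto_const alim])
  have ca2: "((\<lambda>\<beta>. c / a \<beta> * (1 / a \<beta>)) \<longlongrightarrow> 0 * 0) (at_right 0)"
    by (intro tendsto_mult ca real_tendsto_divide_at_top[OF tendsto_const alim])
  have a2L: "((\<lambda>\<beta>. (a \<beta>)\<^sup>2 / ln (1 / \<beta>)) \<longlongrightarrow> 2) (at_right 0)"
    unfolding a_def by (rule a_norm_step_sq_asymp[OF g])
  show "A > 0" unfolding A_def by simp
  show "eventually (\<lambda>\<beta>. \<forall>k\<in>critical_indices \<gamma> (s \<beta>) (t \<beta>) \<beta>.
        w \<beta> \<le> \<beta> * real_of_int \<bar>k\<bar>) (at_right 0)"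
    using sc a1 eventually_small[OF zero_less_one] eventually_rho_less[OF zero_less_one, of \<gamma>]
  proof eventually_elim
    case (elim \<beta>)
    have lev: "w \<beta> \<le> \<beta> * level_index \<gamma> x \<beta>" if "- c < x" for x
    proof -
      have "- c / a \<beta> \<le> x / a \<beta>" using that elim by (intro divide_right_mono) auto
      then have "a \<beta> - c / a \<beta> \<le> a \<beta> + x / a \<beta>" by simp
      then have "w \<beta> \<le> sqrt (1 - rho \<gamma> \<beta>) * (a \<beta> + x / a \<beta>)"
        unfolding w_def using elim by (intro mult_left_mono) auto
      also have "\<dots> = \<beta> * level_index \<gamma> x \<beta>" unfolding level_index_def a_def[symmetric] using elim by simp
      finally show ?thesis .
    qed
    show ?case
    proof
      fix k assume "k \<in> critical_indices \<gamma> (s \<beta>) (t \<beta>) \<beta>"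
      then have "level_index \<gamma> (s \<beta>) \<beta> \<le> real_of_int \<bar>k\<bar> \<or> level_index \<gamma> (t \<beta>) \<beta> \<le> real_of_int \<bar>k\<bar>"
        unfolding outer_indices_def by auto
      then have "\<beta> * level_index \<gamma> (s \<beta>) \<beta> \<le> \<beta> * real_of_int \<bar>k\<bar> \<or> \<beta> * level_index \<gamma> (t \<beta>) \<beta> \<le> \<beta> * real_of_int \<bar>k\<bar>"
        using elim by (auto intro: mult_left_mono)
      then show "w \<beta> \<le> \<beta> * real_of_int \<bar>k\<bar>" using lev[of "s \<beta>"] lev[of "t \<beta>"] elim by linarith
    qed
  qed
  have w2: "((\<lambda>\<beta>. (w \<beta>)\<^sup>2 / ln (1 / \<beta>)) \<longlongrightarrow> 2) (at_right 0)"
  proof -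
    have "((\<lambda>\<beta>. (1 - rho \<gamma> \<beta>) * ((a \<beta>)\<^sup>2 / ln (1 / \<beta>)) * (1 - c / a \<beta> * (1 / a \<beta>))\<^sup>2) \<longlongrightarrow> (1 - 0) * 2 * (1 - 0 * 0)\<^sup>2) (at_right 0)"
      by (intro tendsto_mult tendsto_diff tendsto_const tendsto_power rho_tendsto_0 a2L ca2)
    moreover have "eventually (\<lambda>\<beta>. (1 - rho \<gamma> \<beta>) * ((a \<beta>)\<^sup>2 / ln (1 / \<beta>)) * (1 - c / a \<beta> * (1 / a \<beta>))\<^sup>2 = (w \<beta>)\<^sup>2 / ln (1 / \<beta>)) (at_right 0)"
      using a1(1) eventually_rho_less[OF zero_less_one, of \<gamma>]
    proof eventually_elim
      case (elim \<beta>)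
      have "a \<beta> - c / a \<beta> = a \<beta> * (1 - c / a \<beta> * (1 / a \<beta>))" using elim by (simp add: right_diff_distrib)
      then have "(w \<beta>)\<^sup>2 = (1 - rho \<gamma> \<beta>) * ((a \<beta>)\<^sup>2 * (1 - c / a \<beta> * (1 / a \<beta>))\<^sup>2)"
        unfolding w_def using elim by (simp add: power_mult_distrib)
      then show ?case by simp
    qed
    ultimately show ?thesis using Lim_transform_eventually by fastforce
  qed
  have "eventually (\<lambda>\<beta>. 1 < (w \<beta>)\<^sup>2 / ln (1 / \<beta>)) (at_right 0)" "eventually (\<lambda>\<beta>. (w \<beta>)\<^sup>2 / ln (1 / \<beta>) < 3) (at_right 0)"
    using order_tendstoD[OF w2] by auto
  moreover have "eventually (\<lambda>\<beta>::real. 1 \<le> ln (1 / \<beta>)) (at_right 0)"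
    using ln_inverse_at_top by (simp add: filterlim_at_top)
  ultimately show "eventually (\<lambda>\<beta>. 1 \<le> w \<beta> \<and> ln (1 / \<beta>) \<le> (w \<beta>)\<^sup>2 \<and> (w \<beta>)\<^sup>2 \<le> 3 * ln (1 / \<beta>)) (at_right 0)"
    using a1 eventually_rho_less[OF zero_less_one, of \<gamma>]
  proof eventually_elim
    case (elim \<beta>)
    define L where "L = ln (1 / \<beta>)"
    have L: "1 \<le> L" "1 < (w \<beta>)\<^sup>2 / L" "(w \<beta>)\<^sup>2 / L < 3" using elim unfolding L_def by blast+
    have 1: "L \<le> (w \<beta>)\<^sup>2" "(w \<beta>)\<^sup>2 \<le> 3 * L" using L by (auto simp: pos_less_divide_eq pos_divide_less_eq)
    have "c / a \<beta> \<le> c" using elim c by (simp add: pos_divide_le_eq)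
    then have "0 \<le> w \<beta>" unfolding w_def using elim by (intro mult_nonneg_nonneg) auto
    moreover have "1\<^sup>2 \<le> (w \<beta>)\<^sup>2" using 1 L by simp
    ultimately have "1 \<le> w \<beta>" using power2_le_imp_le by blast
    then show ?case using 1 unfolding L_def by simp
  qed
  have ra: "((\<lambda>\<beta>. \<gamma> * ((a \<beta>)\<^sup>2 / ln (1 / \<beta>))) \<longlongrightarrow> \<gamma> * 2) (at_right 0)"
    by (intro tendsto_mult tendsto_const a2L)
  have "eventually (\<lambda>\<beta>. \<gamma> * ((a \<beta>)\<^sup>2 / ln (1 / \<beta>)) < 2 * \<gamma> + 1) (at_right 0)"
    by (rule order_tendstoD(2)[OF ra]) simp
  moreover have "eventually (\<lambda>\<beta>. ln (1 / step_size \<gamma> \<beta>) / ln (1 / \<beta>) < 2) (at_right 0)"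
    by (rule order_tendstoD(2)[OF ln_step_size_asymp[OF g]]) simp
  moreover have "eventually (\<lambda>\<beta>. 0 < ln (1 / step_size \<gamma> \<beta>)) (at_right 0)"
    using filterlim_compose[OF ln_inverse_at_top step_size_filterlim[OF g]] by (simp add: filterlim_at_top_dense)
  moreover have "eventually (\<lambda>\<beta>. std_normal_density (a \<beta>) = step_size \<gamma> \<beta> * (2 * ln (1 / step_size \<gamma> \<beta>))) (at_right 0)"
    unfolding a_def by (rule eventually_compose_filterlim[OF std_normal_density_a_norm step_size_filterlim[OF g]])
  moreover have "eventually (\<lambda>\<beta>. rho \<gamma> \<beta> < 3 / 4) (at_right 0)" by (rule eventually_rho_less) simp
  ultimately show "eventually (\<lambda>\<beta>. exp (- ((w \<beta>)\<^sup>2 / 2)) \<le> A * \<beta> * ln (1 / \<beta>)) (at_right 0)"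
    using a1(1) eventually_small[OF zero_less_one]
  proof eventually_elim
    case (elim \<beta>)
    define L where "L = ln (1 / \<beta>)"
    define h where "h = step_size \<gamma> \<beta>"
    have \<beta>: "0 < \<beta>" "\<beta> < 1" and ap: "1 \<le> a \<beta>" and \<rho>34: "rho \<gamma> \<beta> < 3 / 4" using elim by auto
    have f: "\<gamma> * ((a \<beta>)\<^sup>2 / L) < 2 * \<gamma> + 1" "ln (1 / h) / L < 2" "0 < ln (1 / h)"
      "std_normal_density (a \<beta>) = h * (2 * ln (1 / h))" using elim unfolding L_def h_def by blast+
    have L0: "0 < L" unfolding L_def using \<beta> by simp
    have rho: "rho \<gamma> \<beta> = \<gamma> / L" unfolding L_def by (rule rho_eq[OF \<beta>])
    have \<rho>0: "0 \<le> rho \<gamma> \<beta>" by (rule rho_nonneg[OF g])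
    have "(w \<beta>)\<^sup>2 = (1 - rho \<gamma> \<beta>) * (a \<beta> - c / a \<beta>)\<^sup>2" unfolding w_def using \<rho>34 by (simp add: power_mult_distrib)
    moreover have "(a \<beta>)\<^sup>2 - 2 * c \<le> (a \<beta> - c / a \<beta>)\<^sup>2" using ap by (simp add: power2_diff)
    then have "(1 - rho \<gamma> \<beta>) * ((a \<beta>)\<^sup>2 - 2 * c) \<le> (1 - rho \<gamma> \<beta>) * (a \<beta> - c / a \<beta>)\<^sup>2"
      using \<rho>34 by (intro mult_left_mono) auto
    moreover have "(1 - rho \<gamma> \<beta>) * ((a \<beta>)\<^sup>2 - 2 * c) = (a \<beta>)\<^sup>2 - 2 * c - \<gamma> * ((a \<beta>)\<^sup>2 / L) + 2 * c * rho \<gamma> \<beta>"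
      unfolding rho by (simp add: algebra_simps)
    moreover have "0 \<le> 2 * c * rho \<gamma> \<beta>" using c \<rho>0 by simp
    ultimately have "(a \<beta>)\<^sup>2 - 2 * c - (2 * \<gamma> + 1) \<le> (w \<beta>)\<^sup>2" using f(1) by linarith
    then have "- ((w \<beta>)\<^sup>2 / 2) \<le> (c + \<gamma> + 1 / 2) + (- (a \<beta>)\<^sup>2 / 2)" by (simp add: field_simps)
    then have "exp (- ((w \<beta>)\<^sup>2 / 2)) \<le> exp (c + \<gamma> + 1 / 2) * exp (- (a \<beta>)\<^sup>2 / 2)"
      unfolding exp_add[symmetric] by (subst exp_le_cancel_iff)
    also have "exp (- (a \<beta>)\<^sup>2 / 2) = sqrt (2 * pi) * std_normal_density (a \<beta>)"
      unfolding std_normal_density_def by simp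
    also have "\<dots> \<le> sqrt (2 * pi) * (2 * \<beta> * (2 * (2 * L)))"
      unfolding f(4)
    proof (intro mult_left_mono mult_mono)
      show "ln (1 / h) \<le> 2 * L" using f(2) L0 by (simp add: pos_divide_less_eq)
      have "sqrt (1 / 4) \<le> sqrt (1 - rho \<gamma> \<beta>)" using \<rho>34 by (intro real_sqrt_le_mono) simp
      then have "1 / 2 \<le> sqrt (1 - rho \<gamma> \<beta>)" by (simp add: real_sqrt_divide)
      then have "\<beta> / sqrt (1 - rho \<gamma> \<beta>) \<le> \<beta> / (1 / 2)" using \<beta> \<rho>34 by (intro divide_left_mono) auto
      then show "h \<le> 2 * \<beta>" unfolding h_def step_size_def by simp
    qed (use f \<beta> in auto)
    finally have "exp (- ((w \<beta>)\<^sup>2 / 2)) \<le> exp (c + \<gamma> + 1 / 2) * (sqrt (2 * pi) * (2 * \<beta> * (2 * (2 * L))))"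
      by simp
    then show ?case unfolding A_def L_def by (simp add: mult_ac)
  qed
qed

text \<open>
The weights e k = exp(-w (\<beta> |k| - w)/2) sum to O(1/(w \<beta>)), and exp(-w^2) = O(\<beta>^2 L^2).
Hence the three regimes contribute O(L powr (1 + 2 \<kappa>) exp(-\<kappa> L)), O(1/sqrt L) and O(\<epsilon>).
\<close>

lemma comparison_sum_tendsto_0:
  fixes r :: "nat \<Rightarrow> real"
  assumes g: "0 \<le> \<gamma>" and lim: "(\<lambda>n. r n * ln (real n)) \<longlonglongrightarrow> \<gamma>"
    and \<theta>: "\<And>n. n \<noteq> 0 \<Longrightarrow> \<bar>r n\<bar> \<le> \<theta>" "0 < \<theta>" "\<theta> < 1"
    and s: "(s \<longlongrightarrow> s0) (at_right 0)" and t: "(t \<longlongrightarrow> t0) (at_right 0)"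
  defines "J \<equiv> \<lambda>\<beta>. critical_indices \<gamma> (s \<beta>) (t \<beta>) \<beta>"
    and "R \<equiv> \<lambda>\<beta> (k::int) l. max \<bar>r (nat \<bar>k - l\<bar>)\<bar> (rho \<gamma> \<beta>)"
  shows "((\<lambda>\<beta>. \<Sum>k\<in>J \<beta>. \<Sum>l\<in>J \<beta> - {k}. \<bar>r (nat \<bar>k - l\<bar>) - rho \<gamma> \<beta>\<bar> / (1 - R \<beta> k l) *
      exp (- (\<beta> * real_of_int \<bar>k\<bar> + \<beta> * real_of_int \<bar>l\<bar>)\<^sup>2 / (4 * (1 + R \<beta> k l)))) \<longlongrightarrow> 0) (at_right 0)"
    (is "(?S \<longlongrightarrow> 0) _")
proof -
  obtain w A where A: "A > 0"
    and w1: "eventually (\<lambda>\<beta>. \<forall>k\<in>J \<beta>. w \<beta> \<le> \<beta> * real_of_int \<bar>k\<bar>) (at_right 0)"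
    and w2: "eventually (\<lambda>\<beta>. 1 \<le> w \<beta> \<and> ln (1 / \<beta>) \<le> (w \<beta>)\<^sup>2 \<and> (w \<beta>)\<^sup>2 \<le> 3 * ln (1 / \<beta>)) (at_right 0)"
    and w3: "eventually (\<lambda>\<beta>. exp (- ((w \<beta>)\<^sup>2 / 2)) \<le> A * \<beta> * ln (1 / \<beta>)) (at_right 0)"
    using threshold_lower_bound[OF g s t] unfolding J_def by blast
  obtain M where M: "M > 0" "\<And>n. \<bar>r n * ln (real n)\<bar> \<le> M"
    using convergent_imp_Bseq[OF convergentI[OF lim]] by (auto simp: Bseq_def)
  \<comment> \<open>This choice gives 2/(1+\<theta>) = 1 + 2 \<kappa>: a pair with covariance at most \<theta> costs \<beta> powr (1 + 2 \<kappa>) up to powers of L,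
    which leaves room for \<beta> powr (- 1 - \<kappa>) such pairs.\<close>
  define \<kappa> where "\<kappa> = (1 - \<theta>) / (2 * (1 + \<theta>))"
  have \<kappa>: "0 < \<kappa>" "2 / (1 + \<theta>) = 1 + 2 * \<kappa>" using \<theta> unfolding \<kappa>_def by (auto simp: field_simps)
  \<comment> \<open>For n > exp (\<kappa> L) one has |r n| \<le> M/(\<kappa> L), so |r n|, \<rho> = \<gamma>/L and |r n - \<rho>| are all at most C/L.\<close>
  define C where "C = M / \<kappa> + \<gamma>"
  have C0: "0 < C" unfolding C_def using M \<kappa> g by (simp add: add_pos_nonneg)
  \<comment> \<open>The factor 24 is 3 * 8: there are at most 3 n neighbours within distance n, and the weights sum
    to at most 8 / (w \<beta>).\<close>
  define K1 where "K1 = 2 / (1 - \<theta>) * A powr (1 + 2 * \<kappa>) * 24"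
  define K2 where "K2 = C / (1 - \<theta>) * exp (3 * C) * A\<^sup>2 * 24"
  define K3 where "K3 = 64 * exp (3 * C) * A\<^sup>2 / (1 - \<theta>)"
  have K3: "0 < K3" unfolding K3_def using A \<theta> by simp
  define G where "G L = K1 * (L powr (1 + 2 * \<kappa>) * exp (- \<kappa> * L)) + K2 / sqrt L" for L :: real
  have Glim: "(G \<longlongrightarrow> K1 * 0 + K2 * 0) at_top"
  proof -
    have "((\<lambda>L. L powr (1 + 2 * \<kappa>) * exp (- \<kappa> * L)) \<longlongrightarrow> 0) at_top" using \<kappa>(1) by real_asymp
    moreover have "((\<lambda>L. 1 / sqrt L) \<longlongrightarrow> 0) at_top" by real_asymp
    ultimately have "((\<lambda>L. K1 * (L powr (1 + 2 * \<kappa>) * exp (- \<kappa> * L)) + K2 * (1 / sqrt L)) \<longlongrightarrow> K1 * 0 + K2 * 0) at_top"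
      by (intro tendsto_add tendsto_mult tendsto_const)
    then show ?thesis by (simp add: G_def[abs_def])
  qed
  have S0: "eventually (\<lambda>\<beta>. 0 \<le> ?S \<beta>) (at_right 0)"
    using eventually_rho_less[OF zero_less_one, of \<gamma>]
  proof eventually_elim
    case (elim \<beta>)
    have "R \<beta> k l \<le> 1" if "k \<noteq> l" for k l
    proof -
      have "nat \<bar>k - l\<bar> \<noteq> 0" using that by simp
      from \<theta>(1)[OF this] show ?thesis unfolding R_def using elim \<theta> by simp
    qed
    then show ?case by (intro sum_nonneg mult_nonneg_nonneg divide_nonneg_nonneg) auto
  qed
  have upper: "eventually (\<lambda>\<beta>. ?S \<beta> \<le> G (ln (1 / \<beta>)) + K3 * \<epsilon>) (at_right 0)" if \<epsilon>: "0 < \<epsilon>" for \<epsilon>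
  proof -
    have "eventually (\<lambda>L::real. L * exp (- L) \<le> 1) at_top" by real_asymp
    moreover have "eventually (\<lambda>L::real. 3 * L * exp (- L) \<le> 1) at_top" by real_asymp
    moreover have "eventually (\<lambda>L::real. 1 < L) at_top" by real_asymp
    moreover have "eventually (\<lambda>L::real. C / L < \<theta>) at_top"
    proof -
      have "((\<lambda>L::real. C / L) \<longlongrightarrow> 0) at_top" by real_asymp
      then show ?thesis by (rule order_tendstoD) (use \<theta> in simp)
    qed
    ultimately have "eventually (\<lambda>L::real. L * exp (- L) \<le> 1 \<and> 3 * L * exp (- L) \<le> 1 \<and> 1 < L \<and> C / L < \<theta>) at_top"
      by eventually_elim simp
    from eventually_ln_inverse[OF this] far_covariance_close[OF lim \<epsilon>] eventually_small[OF zero_less_one]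
      eventually_rho_less[OF \<theta>(2), of \<gamma>] w1 w2 w3
    show ?thesis
    proof eventually_elim
      case (elim \<beta>)
      define L where "L = ln (1 / \<beta>)"
      define W where "W = w \<beta>"
      have L: "L * exp (- L) \<le> 1" "3 * L * exp (- L) \<le> 1" "1 < L" "C / L < \<theta>" using elim unfolding L_def by blast+
      have far: "\<bar>r n - rho \<gamma> \<beta>\<bar> \<le> \<epsilon> / L" if "1 / (\<beta> * L) < real n" "n \<le> 2 * truncation \<beta>" for n
        using elim(2) that unfolding L_def by blast
      have \<beta>: "0 < \<beta>" "\<beta> < 1" using elim by auto
      have \<rho>: "rho \<gamma> \<beta> < \<theta>" "0 \<le> rho \<gamma> \<beta>" using elim rho_nonneg[OF g] by auto
      have \<beta>L: "\<beta> = exp (- L)" unfolding L_def using \<beta> by (simp add: ln_div)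
      have rho: "rho \<gamma> \<beta> = \<gamma> / L" unfolding L_def by (rule rho_eq[OF \<beta>])
      have W: "\<And>k. k \<in> J \<beta> \<Longrightarrow> W \<le> \<beta> * real_of_int \<bar>k\<bar>" "1 \<le> W" "L \<le> W\<^sup>2" "W\<^sup>2 \<le> 3 * L"
        "exp (- (W\<^sup>2 / 2)) \<le> A * \<beta> * L" using elim unfolding L_def W_def by blast+
      have W\<beta>: "W * \<beta> \<le> 2"
      proof -
        have "W \<le> W\<^sup>2" using W(2) by (simp add: power2_eq_square)
        then have "W * \<beta> \<le> 3 * L * \<beta>" using W(4) \<beta> by (intro mult_right_mono) auto
        then show ?thesis using L(2) unfolding \<beta>L by linarith
      qed
      define e where "e k = exp (- (W * (\<beta> * real_of_int \<bar>k\<bar> - W) / 2))" for k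
      define E where "E = (\<Sum>k\<in>J \<beta>. e k)"
      have JN: "\<bar>k\<bar> \<le> int (truncation \<beta>)" if "k \<in> J \<beta>" for k using that unfolding J_def outer_indices_def by simp
      have E: "E \<le> 8 / (W * \<beta>)" unfolding E_def e_def
        using \<beta> W W\<beta> JN by (intro sum_weight_le[where N = "truncation \<beta>"]) auto
      have E0: "0 \<le> E" unfolding E_def e_def by (intro sum_nonneg) simp
      define T where "T k l = \<bar>r (nat \<bar>k - l\<bar>) - rho \<gamma> \<beta>\<bar> / (1 - R \<beta> k l) *
        exp (- (\<beta> * real_of_int \<bar>k\<bar> + \<beta> * real_of_int \<bar>l\<bar>)\<^sup>2 / (4 * (1 + R \<beta> k l)))" for k l
      define n1 where "n1 = exp (\<kappa> * L)"
      define n2 where "n2 = 1 / (\<beta> * L)"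
      define c1 where "c1 = 2 / (1 - \<theta>) * exp (- (W\<^sup>2 / (1 + \<theta>)))"
      define c2 where "c2 = C / L / (1 - \<theta>) * (exp (3 * C) * exp (- W\<^sup>2))"
      define c3 where "c3 = \<epsilon> / L / (1 - \<theta>) * (exp (3 * C) * exp (- W\<^sup>2))"
      have cpos: "0 \<le> c1" "0 \<le> c2" "0 \<le> c3" unfolding c1_def c2_def c3_def using \<theta> C0 L \<epsilon> by auto
      have npos: "0 \<le> n1" "0 \<le> n2" unfolding n1_def n2_def using \<beta> L by auto
      have "?S \<beta> = (\<Sum>k\<in>J \<beta>. \<Sum>l\<in>J \<beta> - {k}. T k l)" unfolding T_def ..
      also have "\<dots> \<le> (c1 * (2 * n1 + 1) + c2 * (2 * n2 + 1)) * E + c3 * E\<^sup>2"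
        unfolding E_def
      proof (rule double_sum_near_far_le[OF _ npos cpos])
        show "finite (J \<beta>)" unfolding J_def by (rule finite_outer_indices)
        show "0 \<le> e k" for k unfolding e_def by simp
        fix k l assume kl: "k \<in> J \<beta>" "l \<in> J \<beta>" "k \<noteq> l"
        define n where "n = nat \<bar>k - l\<bar>"
        have n: "n \<noteq> 0" "real_of_int \<bar>k - l\<bar> = real n" "n \<le> 2 * truncation \<beta>"
          unfolding n_def using kl JN[OF kl(1)] JN[OF kl(2)] by auto
        define p where "p = \<beta> * real_of_int \<bar>k\<bar> - W"
        define q where "q = \<beta> * real_of_int \<bar>l\<bar> - W"
        have pq: "0 \<le> p" "0 \<le> q" unfolding p_def q_def using W(1) kl by auto
        define D where "D = \<bar>r n - rho \<gamma> \<beta>\<bar>"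
        define R' where "R' = R \<beta> k l"
        have R': "R' = max \<bar>r n\<bar> (rho \<gamma> \<beta>)" unfolding R'_def R_def n_def ..
        have Rb: "0 \<le> R'" "R' \<le> \<theta>" unfolding R' using \<rho> \<theta>(1)[OF n(1)] by auto
        have D0: "0 \<le> D" unfolding D_def by simp
        have Teq: "T k l = D / (1 - R') * exp (- (W + p + (W + q))\<^sup>2 / (4 * (1 + R')))"
          unfolding T_def D_def R'_def n_def p_def q_def by simp
        have ek: "e k = exp (- (W * p / 2))" "e l = exp (- (W * q / 2))" unfolding e_def p_def q_def by auto
        have W0: "0 \<le> W" using W(2) by simp
        note bounds = comparison_term_le[OF D0 Rb \<theta>(3) W0 pq, folded Teq]
        show "(real_of_int \<bar>k - l\<bar> \<le> n1 \<and> T k l \<le> c1 * e k) \<or> (real_of_int \<bar>k - l\<bar> \<le> n2 \<and> T k l \<le> c2 * e k) \<or>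
            T k l \<le> c3 * (e k * e l)"
        proof (cases "real n \<le> n1")
          case True
          have "D \<le> 2" unfolding D_def using \<rho> \<theta>(1)[OF n(1)] \<theta>(3) by linarith
          then have "D / (1 - \<theta>) * (exp (- (W\<^sup>2 / (1 + \<theta>))) * e k) \<le> 2 / (1 - \<theta>) * (exp (- (W\<^sup>2 / (1 + \<theta>))) * e k)"
            using \<theta> unfolding ek by (intro mult_right_mono divide_right_mono) auto
          then have "T k l \<le> c1 * e k" using bounds(1) unfolding c1_def ek by (simp add: mult.assoc)
          then show ?thesis using True n(2) by simp
        next
          case False
          have lnn: "\<kappa> * L < ln (real n)"
          proof -
            have "ln (exp (\<kappa> * L)) < ln (real n)" using False n(1) unfolding n1_def by (subst ln_less_cancel_iff) auto
            then show ?thesis by simp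
          qed
          have \<kappa>L: "0 < \<kappa> * L" using \<kappa> L by simp
          have "\<bar>r n\<bar> * ln (real n) \<le> M" using M(2)[of n] lnn \<kappa>L by (simp add: abs_mult)
          then have "\<bar>r n\<bar> * (\<kappa> * L) \<le> M" using lnn mult_left_mono[of "\<kappa> * L" "ln (real n)" "\<bar>r n\<bar>"] by linarith
          then have rn: "\<bar>r n\<bar> \<le> M / \<kappa> / L" using \<kappa>L \<kappa> L by (simp add: pos_le_divide_eq mult_ac)
          have CL: "C / L = M / \<kappa> / L + rho \<gamma> \<beta>" unfolding C_def rho by (simp add: add_divide_distrib)
          have DC: "D \<le> C / L" unfolding D_def CL using rn \<rho> by linarith
          have "0 \<le> M / \<kappa> / L" using M \<kappa> L by simp
          then have RC: "R' \<le> C / L" unfolding R' CL using rn \<rho> by simp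
          have "W\<^sup>2 * R' \<le> (3 * L) * (C / L)" using W(4) RC Rb L by (intro mult_mono) auto
          also have "\<dots> = 3 * C" using L by simp
          finally have b2: "T k l \<le> D / (1 - \<theta>) * (exp (3 * C) * exp (- W\<^sup>2) * (e k * e l))"
            unfolding ek by (rule bounds(2))
          show ?thesis
          proof (cases "real n \<le> n2")
            case True
            have "e k * e l \<le> e k * 1" unfolding ek using W0 pq by (intro mult_left_mono) auto
            then have "D / (1 - \<theta>) * (exp (3 * C) * exp (- W\<^sup>2) * (e k * e l)) \<le> C / L / (1 - \<theta>) * (exp (3 * C) * exp (- W\<^sup>2) * e k)"
              using DC D0 \<theta> L C0 by (intro mult_mono divide_right_mono) (auto simp: e_def)
            then have "T k l \<le> c2 * e k" using b2 unfolding c2_def by (simp add: mult.assoc)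
            then show ?thesis using True n(2) by simp
          next
            case False
            then have "D \<le> \<epsilon> / L" unfolding D_def n2_def by (intro far n(3)) simp
            then have "D / (1 - \<theta>) * (exp (3 * C) * exp (- W\<^sup>2) * (e k * e l)) \<le> \<epsilon> / L / (1 - \<theta>) * (exp (3 * C) * exp (- W\<^sup>2) * (e k * e l))"
              using \<theta> by (intro mult_right_mono divide_right_mono) (auto simp: e_def)
            then have "T k l \<le> c3 * (e k * e l)" using b2 unfolding c3_def by (simp add: mult.assoc)
            then show ?thesis by simp
          qed
        qed
      qed
      also have "\<dots> \<le> (c1 * (3 * n1) + c2 * (3 * n2)) * (8 / (W * \<beta>)) + c3 * (8 / (W * \<beta>))\<^sup>2"
      proof (intro add_mono mult_mono mult_left_mono power_mono E E0)
        have "1 \<le> n1" unfolding n1_def using \<kappa> L by simp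
        then show "2 * n1 + 1 \<le> 3 * n1" by simp
        have "\<beta> * L \<le> 1" using L(1) unfolding \<beta>L by (simp add: mult.commute)
        then have "1 \<le> n2" unfolding n2_def using \<beta> L by (simp add: pos_le_divide_eq)
        then show "2 * n2 + 1 \<le> 3 * n2" by simp
      qed (use cpos npos in auto)
      also have "\<dots> = c1 * (3 * n1) * (8 / (W * \<beta>)) + c2 * (3 * n2) * (8 / (W * \<beta>)) + c3 * (8 / (W * \<beta>))\<^sup>2"
        by (simp only: distrib_right)
      also have "\<dots> \<le> K1 * (L powr (1 + 2 * \<kappa>) * exp (- \<kappa> * L)) + K2 / sqrt L + K3 * \<epsilon>"
      proof (intro add_mono)
        have "exp (- (W\<^sup>2 / (1 + \<theta>))) = exp (- (W\<^sup>2 / 2)) powr (1 + 2 * \<kappa>)"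
        proof -
          have "x / d = x / 2 * (2 / d)" for x d :: real by simp
          then have "- (W\<^sup>2 / (1 + \<theta>)) = 2 / (1 + \<theta>) * - (W\<^sup>2 / 2)" by (metis mult.commute mult_minus_right)
          then show ?thesis unfolding \<kappa>(2)[symmetric] powr_def by simp
        qed
        also have "\<dots> \<le> (A * \<beta> * L) powr (1 + 2 * \<kappa>)" using W(5) \<kappa> by (intro powr_mono2) auto
        also have "\<dots> = A powr (1 + 2 * \<kappa>) * (L powr (1 + 2 * \<kappa>) * exp (- (1 + 2 * \<kappa>) * L))"
          using A L unfolding \<beta>L by (simp add: powr_mult) (simp add: powr_def algebra_simps)
        finally have "c1 \<le> 2 / (1 - \<theta>) * (A powr (1 + 2 * \<kappa>) * (L powr (1 + 2 * \<kappa>) * exp (- (1 + 2 * \<kappa>) * L)))"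
          unfolding c1_def using \<theta> by (intro mult_left_mono) auto
        moreover have "8 / (W * \<beta>) \<le> 8 * exp L"
        proof -
          have "8 / (W * \<beta>) \<le> 8 / (1 * \<beta>)" using W(2) \<beta> by (intro divide_left_mono mult_right_mono) auto
          then show ?thesis unfolding \<beta>L by (simp add: exp_minus field_simps)
        qed
        ultimately have "c1 * (3 * n1) * (8 / (W * \<beta>)) \<le>
          2 / (1 - \<theta>) * (A powr (1 + 2 * \<kappa>) * (L powr (1 + 2 * \<kappa>) * exp (- (1 + 2 * \<kappa>) * L))) * (3 * n1) * (8 * exp L)"
          using npos cpos W(2) \<beta> \<theta> by (intro mult_mono) auto
        also have "\<dots> = K1 * (L powr (1 + 2 * \<kappa>) * (exp (- (1 + 2 * \<kappa>) * L) * n1 * exp L))"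
          unfolding K1_def by (simp add: mult_ac)
        also have "exp (- (1 + 2 * \<kappa>) * L) * n1 * exp L = exp (- \<kappa> * L)"
          unfolding n1_def exp_add[symmetric] by (simp add: algebra_simps)
        finally show "c1 * (3 * n1) * (8 / (W * \<beta>)) \<le> K1 * (L powr (1 + 2 * \<kappa>) * exp (- \<kappa> * L))" .
        have eW: "exp (- W\<^sup>2) \<le> (A * \<beta> * L)\<^sup>2"
        proof -
          have "exp (- W\<^sup>2) = (exp (- (W\<^sup>2 / 2)))\<^sup>2" by (simp add: power2_eq_square exp_add[symmetric])
          also have "\<dots> \<le> (A * \<beta> * L)\<^sup>2" by (intro power_mono W(5)) simp
          finally show ?thesis .
        qed
        have sqW: "sqrt L \<le> W" using W(2,3) by (intro real_le_lsqrt) auto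
        have "c2 * (3 * n2) * (8 / (W * \<beta>)) \<le> C / L / (1 - \<theta>) * (exp (3 * C) * (A * \<beta> * L)\<^sup>2) * (3 * n2) * (8 / (sqrt L * \<beta>))"
        proof (intro mult_mono)
          show "c2 \<le> C / L / (1 - \<theta>) * (exp (3 * C) * (A * \<beta> * L)\<^sup>2)"
            unfolding c2_def using eW C0 L \<theta> by (intro mult_left_mono) auto
          show "8 / (W * \<beta>) \<le> 8 / (sqrt L * \<beta>)" using sqW \<beta> L W(2)
            by (intro divide_left_mono mult_right_mono mult_pos_pos) auto
        qed (use npos C0 L \<theta> W \<beta> in auto)
        also have "\<dots> = K2 / sqrt L"
        proof -
          have "c / l / d * (x * (A * b * l)\<^sup>2) * (3 * (1 / (b * l))) * (8 / (q * b)) = c / d * x * A\<^sup>2 * 24 / q"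
            if "b \<noteq> 0" "l \<noteq> 0" for b c d l q x :: real
            using that by (simp add: power2_eq_square)
          then show ?thesis unfolding n2_def K2_def using \<beta> L by simp
        qed
        finally show "c2 * (3 * n2) * (8 / (W * \<beta>)) \<le> K2 / sqrt L" .
        have "c3 * (8 / (W * \<beta>))\<^sup>2 \<le> \<epsilon> / L / (1 - \<theta>) * (exp (3 * C) * (A * \<beta> * L)\<^sup>2) * (64 / (L * \<beta>\<^sup>2))"
        proof (intro mult_mono)
          show "c3 \<le> \<epsilon> / L / (1 - \<theta>) * (exp (3 * C) * (A * \<beta> * L)\<^sup>2)"
            unfolding c3_def using eW \<epsilon> L \<theta> by (intro mult_left_mono) auto
          have "(8 / (W * \<beta>))\<^sup>2 = 64 / (W\<^sup>2 * \<beta>\<^sup>2)" by (simp add: power_divide power_mult_distrib)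
          also have "\<dots> \<le> 64 / (L * \<beta>\<^sup>2)" using W(2,3) L \<beta>
            by (intro divide_left_mono mult_right_mono mult_pos_pos) auto
          finally show "(8 / (W * \<beta>))\<^sup>2 \<le> 64 / (L * \<beta>\<^sup>2)" .
        qed (use \<epsilon> L \<theta> in auto)
        also have "\<dots> = K3 * \<epsilon>"
        proof -
          have "c / l / d * (x * (A * b * l)\<^sup>2) * (64 / (l * b\<^sup>2)) = 64 * x * A\<^sup>2 / d * c"
            if "b \<noteq> 0" "l \<noteq> 0" for b c d l x :: real
            using that by (simp add: power2_eq_square)
          then show ?thesis unfolding K3_def using \<beta> L by simp
        qed
        finally show "c3 * (8 / (W * \<beta>))\<^sup>2 \<le> K3 * \<epsilon>" .
      qed
      finally show ?case unfolding G_def L_def .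
    qed
  qed
  show ?thesis
  proof (rule order_tendstoI)
    fix b :: real assume "b < 0"
    then show "eventually (\<lambda>\<beta>. b < ?S \<beta>) (at_right 0)" using S0 by (auto elim!: eventually_mono)
  next
    fix b :: real assume b: "0 < b"
    have "eventually (\<lambda>L. G L < b / 2) at_top" by (rule order_tendstoD(2)[OF Glim]) (use b in simp)
    from eventually_ln_inverse[OF this] upper[of "b / (2 * K3)"]
    show "eventually (\<lambda>\<beta>. ?S \<beta> < b) (at_right 0)"
    proof (rule eventually_elim2)
      show "0 < b / (2 * K3)" using b K3 by simp
      fix \<beta> assume "G (ln (1 / \<beta>)) < b / 2" "?S \<beta> \<le> G (ln (1 / \<beta>)) + K3 * (b / (2 * K3))"
      moreover have "K3 * (b / (2 * K3)) = b / 2" using K3 by simp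
      ultimately show "?S \<beta> < b" by linarith
    qed
  qed
qed

section \<open>Stationary Gaussian sequences and the last exceedances\<close>

lemma std_normal_rv:
  assumes M: "prob_space M" and Z: "distributed M lborel Z std_normal_density"
  shows "Z \<in> borel_measurable M" "distr M borel Z = std_normal_distribution"
    "integrable M Z" "integrable M (\<lambda>\<omega>. (Z \<omega>)\<^sup>2)" "(\<integral>\<omega>. Z \<omega> \<partial>M) = 0" "(\<integral>\<omega>. (Z \<omega>)\<^sup>2 \<partial>M) = 1"
    "(\<integral>\<omega>. iexp (s * Z \<omega>) \<partial>M) = complex_of_real (exp (- s\<^sup>2 / 2))"
proof -
  interpret prob_space M by fact
  show m[measurable]: "Z \<in> borel_measurable M" using distributed_measurable[OF Z] by simp
  have "distr M borel Z = distr M lborel Z" by (rule distr_cong) auto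
  also have "\<dots> = std_normal_distribution" by (rule distributed_distr_eq_density[OF Z])
  finally show d: "distr M borel Z = std_normal_distribution" .
  have "integrable (distr M borel Z) (\<lambda>x. x ^ 1)" "integrable (distr M borel Z) (\<lambda>x. x\<^sup>2)"
    unfolding d by (rule integrable_std_normal_distribution_moment)+
  then show "integrable M Z" "integrable M (\<lambda>\<omega>. (Z \<omega>)\<^sup>2)" by (simp_all add: integrable_distr_eq)
  show "(\<integral>\<omega>. Z \<omega> \<partial>M) = 0" by (rule standard_normal_distributed_expectation[OF Z])
  have "(\<integral>\<omega>. (Z \<omega>)\<^sup>2 \<partial>M) = (\<integral>x. x\<^sup>2 \<partial>distr M borel Z)" by (subst integral_distr) auto
  also have "\<dots> = 1" unfolding d using std_normal_distribution_even_moments(1)[of 1] by (simp add: fact_numeral)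
  finally show "(\<integral>\<omega>. (Z \<omega>)\<^sup>2 \<partial>M) = 1" .
  have "(\<integral>\<omega>. iexp (s * Z \<omega>) \<partial>M) = char (distr M borel Z) s"
    unfolding char_def by (subst integral_distr) auto
  then show "(\<integral>\<omega>. iexp (s * Z \<omega>) \<partial>M) = complex_of_real (exp (- s\<^sup>2 / 2))"
    unfolding d char_std_normal_distribution by simp
qed

text \<open>
Degenerate and nondegenerate laws are covered by the same formula.
\<close>

lemma gaussian_rv_char:
  assumes M: "prob_space M" and Y: "gaussian_rv M Y" and int: "integrable M Y"
    and mean: "(\<integral>\<omega>. Y \<omega> \<partial>M) = 0"
  shows "(\<integral>\<omega>. iexp (Y \<omega>) \<partial>M) = complex_of_real (exp (- (\<integral>\<omega>. (Y \<omega>)\<^sup>2 \<partial>M) / 2))"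
proof -
  interpret prob_space M by fact
  have [measurable]: "Y \<in> borel_measurable M" using Y unfolding gaussian_rv_def by simp
  consider \<mu> \<sigma> where "0 < \<sigma>" "distributed M lborel Y (normal_density \<mu> \<sigma>)" | \<mu> where "AE \<omega> in M. Y \<omega> = \<mu>"
    using Y unfolding gaussian_rv_def by blast
  then show ?thesis
  proof cases
    case 1
    define Z where "Z \<omega> = (Y \<omega> - \<mu>) / \<sigma>" for \<omega>
    have "distributed M lborel Z std_normal_density"
      unfolding Z_def using 1 normal_standard_normal_convert[OF 1(1)] by blast
    note Z = std_normal_rv[OF M this]
    have Y1: "Y \<omega> = \<sigma> * Z \<omega> + \<mu>" for \<omega> unfolding Z_def using 1(1) by simp
    have "(\<integral>\<omega>. Y \<omega> \<partial>M) = \<mu>" unfolding Y1 using Z(3,5) by (simp add: prob_space)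
    then have Y2: "Y \<omega> = \<sigma> * Z \<omega>" for \<omega> using mean Y1 by simp
    have "(\<integral>\<omega>. (Y \<omega>)\<^sup>2 \<partial>M) = \<sigma>\<^sup>2" unfolding Y2 power_mult_distrib using Z(6) by simp
    then show ?thesis unfolding Y2[of \<omega> for \<omega>] using Z(7)[of \<sigma>] by (simp add: Y2)
  next
    case 2
    have "(\<integral>\<omega>. Y \<omega> \<partial>M) = (\<integral>\<omega>. \<mu> \<partial>M)" by (rule integral_cong_AE) (use 2 in auto)
    then have "\<mu> = 0" using mean by (simp add: prob_space)
    then have 0: "AE \<omega> in M. Y \<omega> = 0" using 2 by simp
    have "(\<integral>\<omega>. (Y \<omega>)\<^sup>2 \<partial>M) = (\<integral>\<omega>. 0 \<partial>M)" by (rule integral_cong_AE) (use 0 in auto)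
    moreover have "(\<integral>\<omega>. iexp (Y \<omega>) \<partial>M) = (\<integral>\<omega>. 1 \<partial>M)" by (rule integral_cong_AE) (use 0 in auto)
    ultimately show ?thesis by (simp add: prob_space)
  qed
qed

locale stationary_gaussian = prob_space M for M :: "'a measure" +
  fixes X :: "int \<Rightarrow> 'a \<Rightarrow> real"
  assumes X: "standard_stationary_gaussian M X"
begin

abbreviation r :: "nat \<Rightarrow> real" where "r \<equiv> covariance_seq M X"

lemma X_std: "distributed M lborel (X i) std_normal_density"
  using X unfolding standard_stationary_gaussian_def by blast

lemmas X_rv = std_normal_rv[OF prob_space_axioms X_std]

lemma X_measurable [measurable]: "X i \<in> borel_measurable M" by (rule X_rv(1))

lemma X_mult_integrable: "integrable M (\<lambda>\<omega>. X i \<omega> * X j \<omega>)"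
proof (rule Bochner_Integration.integrable_bound)
  show "integrable M (\<lambda>\<omega>. (X i \<omega>)\<^sup>2 + (X j \<omega>)\<^sup>2)" using X_rv(4) by simp
  have "\<bar>a * b\<bar> \<le> a\<^sup>2 + b\<^sup>2" for a b :: real
  proof -
    have "0 \<le> (\<bar>a\<bar> - \<bar>b\<bar>)\<^sup>2" by simp
    then have "2 * (\<bar>a\<bar> * \<bar>b\<bar>) \<le> a\<^sup>2 + b\<^sup>2" by (simp add: power2_diff mult.assoc)
    moreover have "0 \<le> \<bar>a\<bar> * \<bar>b\<bar>" by simp
    ultimately show ?thesis unfolding abs_mult by linarith
  qed
  then show "AE \<omega> in M. norm (X i \<omega> * X j \<omega>) \<le> norm ((X i \<omega>)\<^sup>2 + (X j \<omega>)\<^sup>2)" by simp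
qed auto

lemma covariance_shift: "(\<integral>\<omega>. X (i + k) \<omega> * X (j + k) \<omega> \<partial>M) = (\<integral>\<omega>. X i \<omega> * X j \<omega> \<partial>M)"
proof -
  let ?P = "\<Pi>\<^sub>M i\<in>{i, j}. (borel :: real measure)"
  have eq: "distr M ?P (\<lambda>\<omega>. \<lambda>l\<in>{i, j}. X (l + k) \<omega>) = distr M ?P (\<lambda>\<omega>. \<lambda>l\<in>{i, j}. X l \<omega>)"
  proof -
    have "stationary_process M X" using X unfolding standard_stationary_gaussian_def by (elim conjE)
    then have st: "\<forall>J k. finite J \<longrightarrow> distr M (\<Pi>\<^sub>M i\<in>J. borel) (\<lambda>\<omega>. \<lambda>i\<in>J. X (i + k) \<omega>) =
        distr M (\<Pi>\<^sub>M i\<in>J. borel) (\<lambda>\<omega>. \<lambda>i\<in>J. X i \<omega>)"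
      unfolding stationary_process_def by (elim conjE)
    show ?thesis by (rule st[rule_format]) simp
  qed
  have m: "(\<lambda>\<omega>. \<lambda>l\<in>{i, j}. X (l + c) \<omega>) \<in> measurable M ?P" for c
    by (rule measurable_restrict) simp
  have f: "(\<lambda>x. x i * x j) \<in> borel_measurable ?P" by measurable
  have "(\<integral>\<omega>. X (i + c) \<omega> * X (j + c) \<omega> \<partial>M) = (\<integral>x. x i * x j \<partial>distr M ?P (\<lambda>\<omega>. \<lambda>l\<in>{i, j}. X (l + c) \<omega>))" for c
    by (subst integral_distr[OF m f]) simp
  from this[of k] this[of 0] show ?thesis using eq by simp
qed

lemma covariance_eq: "(\<integral>\<omega>. X i \<omega> * X j \<omega> \<partial>M) = r (nat \<bar>i - j\<bar>)"
proof -
  have le: "(\<integral>\<omega>. X i \<omega> * X j \<omega> \<partial>M) = r (nat \<bar>i - j\<bar>)" if "i \<le> j" for i j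
  proof -
    have "(\<integral>\<omega>. X i \<omega> * X j \<omega> \<partial>M) = (\<integral>\<omega>. X (1 + (i - 1)) \<omega> * X ((int (nat \<bar>i - j\<bar>) + 1) + (i - 1)) \<omega> \<partial>M)"
      using that by simp
    also have "\<dots> = r (nat \<bar>i - j\<bar>)" unfolding covariance_shift covariance_seq_def ..
    finally show ?thesis .
  qed
  show ?thesis
  proof (cases "i \<le> j")
    case False
    then show ?thesis using le[of j i] by (simp add: mult.commute abs_minus_commute)
  qed (rule le)
qed

lemma r_0: "r 0 = 1"
  using covariance_eq[of 0 0] X_rv(6)[of 0] by (simp add: power2_eq_square)

lemma gaussian_family_X:
  assumes J: "finite J"
  shows "gaussian_family M J X (\<lambda>i j. r (nat \<bar>i - j\<bar>))"
proof -
  have "(\<integral>\<omega>. iexp (\<Sum>i\<in>J. c i * X i \<omega>) \<partial>M) =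
      complex_of_real (exp (- (\<Sum>i\<in>J. \<Sum>j\<in>J. c i * c j * r (nat \<bar>i - j\<bar>)) / 2))" for c
  proof -
    let ?Y = "\<lambda>\<omega>. \<Sum>i\<in>J. c i * X i \<omega>"
    have "gaussian_rv M ?Y"
    proof -
      have "gaussian_process M X" using X unfolding standard_stationary_gaussian_def by (elim conjE)
      then show ?thesis unfolding gaussian_process_def using J by (elim allE[of _ J] allE[of _ c]) simp
    qed
    moreover have "integrable M ?Y" using X_rv(3) by simp
    moreover have "(\<integral>\<omega>. ?Y \<omega> \<partial>M) = 0" using X_rv(3,5) by simp
    ultimately have "(\<integral>\<omega>. iexp (?Y \<omega>) \<partial>M) = complex_of_real (exp (- (\<integral>\<omega>. (?Y \<omega>)\<^sup>2 \<partial>M) / 2))"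
      by (rule gaussian_rv_char[OF prob_space_axioms])
    also have "(\<integral>\<omega>. (?Y \<omega>)\<^sup>2 \<partial>M) = (\<integral>\<omega>. (\<Sum>i\<in>J. \<Sum>j\<in>J. (c i * c j) * (X i \<omega> * X j \<omega>)) \<partial>M)"
      by (simp add: power2_eq_square sum_product mult_ac)
    also have "\<dots> = (\<Sum>i\<in>J. \<Sum>j\<in>J. c i * c j * r (nat \<bar>i - j\<bar>))"
      using X_mult_integrable by (simp add: Bochner_Integration.integral_sum covariance_eq)
    finally show ?thesis .
  qed
  then show ?thesis unfolding gaussian_family_def using J prob_space_axioms by auto
qed

lemma r_abs_le_1: "\<bar>r n\<bar> \<le> 1"
proof -
  have sq: "(\<integral>\<omega>. (X (int n) \<omega> - b * X 0 \<omega>)\<^sup>2 \<partial>M) = 1 - 2 * b * r n + b\<^sup>2" for b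
  proof -
    have "(\<integral>\<omega>. (X (int n) \<omega> - b * X 0 \<omega>)\<^sup>2 \<partial>M) =
        (\<integral>\<omega>. (X (int n) \<omega>)\<^sup>2 - 2 * b * (X (int n) \<omega> * X 0 \<omega>) + b\<^sup>2 * (X 0 \<omega>)\<^sup>2 \<partial>M)"
      by (simp add: power2_eq_square algebra_simps)
    then show ?thesis using X_rv(4,6) X_mult_integrable by (simp add: covariance_eq)
  qed
  have "0 \<le> (\<integral>\<omega>. (X (int n) \<omega> - b * X 0 \<omega>)\<^sup>2 \<partial>M)" for b by simp
  from this[of 1] this[of "-1"] show ?thesis unfolding sq by (simp add: abs_le_iff)
qed

text \<open>
If |r n| = 1 then X (m + n) = r n X m almost surely, by the equality case of the Cauchy-Schwarz
inequality.
\<close>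

lemma r_periodic:
  assumes b: "\<bar>r n\<bar> = 1"
  shows "r (m + n) = r n * r m"
proof -
  let ?b = "r n"
  have b2: "?b\<^sup>2 = 1" using b by (metis power2_abs one_power2)
  have "(\<integral>\<omega>. (X (int (m + n)) \<omega> - ?b * X (int m) \<omega>)\<^sup>2 \<partial>M) =
      (\<integral>\<omega>. (X (int (m + n)) \<omega>)\<^sup>2 - 2 * ?b * (X (int (m + n)) \<omega> * X (int m) \<omega>) + ?b\<^sup>2 * (X (int m) \<omega>)\<^sup>2 \<partial>M)"
    by (simp add: power2_eq_square algebra_simps)
  also have "\<dots> = 1 - 2 * ?b * ?b + ?b\<^sup>2"
    using X_rv(4,6) X_mult_integrable by (simp add: covariance_eq)
  also have "\<dots> = 0" using b2 by (simp add: power2_eq_square)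
  finally have "AE \<omega> in M. (X (int (m + n)) \<omega> - ?b * X (int m) \<omega>)\<^sup>2 = 0"
  proof (subst (asm) integral_nonneg_eq_0_iff_AE)
    show "integrable M (\<lambda>\<omega>. (X (int (m + n)) \<omega> - ?b * X (int m) \<omega>)\<^sup>2)"
      using X_rv(4) X_mult_integrable
      by (simp add: power2_diff power_mult_distrib mult.assoc mult.left_commute)
  qed auto
  then have "AE \<omega> in M. X (int (m + n)) \<omega> * X 0 \<omega> = ?b * X (int m) \<omega> * X 0 \<omega>" by eventually_elim simp
  then have "(\<integral>\<omega>. X (int (m + n)) \<omega> * X 0 \<omega> \<partial>M) = (\<integral>\<omega>. ?b * X (int m) \<omega> * X 0 \<omega> \<partial>M)"
    by (intro integral_cong_AE) auto
  also have "\<dots> = ?b * (\<integral>\<omega>. X (int m) \<omega> * X 0 \<omega> \<partial>M)" by (simp add: mult.assoc)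
  finally show ?thesis by (simp add: covariance_eq nat_int_add)
qed

text \<open>
Because r tends to 0, only finitely many n can matter, and |r n| = 1 for a single n \<noteq> 0 would
propagate along the multiples of n.
\<close>

lemma r_uniformly_less_1:
  assumes lim: "(\<lambda>n. r n * ln (real n)) \<longlonglongrightarrow> \<gamma>"
  obtains \<theta> where "0 < \<theta>" "\<theta> < 1" "\<And>n. n \<noteq> 0 \<Longrightarrow> \<bar>r n\<bar> \<le> \<theta>"
proof -
  have "((\<lambda>n. r n * ln (real n) * (1 / ln (real n))) \<longlongrightarrow> \<gamma> * 0) sequentially"
    by (intro tendsto_mult lim) real_asymp
  moreover have "eventually (\<lambda>n. r n * ln (real n) * (1 / ln (real n)) = r n) sequentially"
    using eventually_gt_at_top[of 1] by eventually_elim simp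
  ultimately have r0: "r \<longlonglongrightarrow> 0" using Lim_transform_eventually by fastforce
  obtain n0 where n0: "\<And>n. n0 \<le> n \<Longrightarrow> \<bar>r n\<bar> < 1 / 2" using LIMSEQ_D[OF r0, of "1 / 2"] by auto
  have less1: "\<bar>r n\<bar> < 1" if "n \<noteq> 0" for n
  proof (rule ccontr)
    assume "\<not> \<bar>r n\<bar> < 1"
    then have 1: "\<bar>r n\<bar> = 1" using r_abs_le_1[of n] by simp
    have "\<bar>r (k * n)\<bar> = 1" for k
    proof (induction k)
      case (Suc k)
      then show ?case using r_periodic[OF 1, of "k * n"] 1 by (simp add: abs_mult add.commute)
    qed (simp add: r_0)
    moreover have "n0 \<le> n0 * n" using that by simp
    ultimately show False using n0[of "n0 * n"] by auto
  qed
  define \<theta> where "\<theta> = Max (insert (1 / 2) ((\<lambda>n. \<bar>r n\<bar>) ` {1..<n0}))"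
  show thesis
  proof
    show "\<theta> < 1" unfolding \<theta>_def using less1 by (subst Max_less_iff) auto
    have "1 / 2 \<le> \<theta>" unfolding \<theta>_def by (intro Max_ge) auto
    then show "0 < \<theta>" by linarith
    fix n :: nat assume n: "n \<noteq> 0"
    show "\<bar>r n\<bar> \<le> \<theta>"
    proof (cases "n < n0")
      case True
      then show ?thesis unfolding \<theta>_def using n by (intro Max_ge) auto
    next
      case False
      then show ?thesis using n0[of n] \<open>1 / 2 \<le> \<theta>\<close> by simp
    qed
  qed
qed

lemma prob_X_gt: "prob {\<omega> \<in> space M. v < X i \<omega>} = std_normal_tail v"
proof -
  have "std_normal_tail v = measure (distr M borel (X i)) {v<..}" unfolding X_rv(2) std_normal_tail_def ..
  also have "\<dots> = prob {\<omega> \<in> space M. v < X i \<omega>}"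
    by (subst measure_distr) (auto intro!: arg_cong[where f = prob])
  finally show ?thesis by simp
qed

text \<open>
A bound that is uniform in the number of terms; it serves both for summability and for the
truncation error.
\<close>

lemma sum_tail_shift_le:
  assumes b: "0 < \<beta>" and N: "1 < real N"
  shows "(\<Sum>n<k. std_normal_tail (\<beta> * real (N + 1 + n))) \<le> tail_primitive (\<beta> * real N - \<beta>) / \<beta>"
proof -
  have "(\<Sum>n<k. std_normal_tail (\<beta> * real (N + 1 + n))) =
      (\<Sum>j\<in>{j::nat. real N < real j \<and> j \<le> N + k}. std_normal_tail (\<beta> * real j - 0))"
    by (rule sum.reindex_bij_witness[of _ "\<lambda>j. j - (N + 1)" "\<lambda>n. N + 1 + n"]) auto
  also have "\<dots> \<le> tail_primitive (\<beta> * real N - 0 - \<beta>) / \<beta>"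
    using b N by (intro sum_std_normal_tail_le) auto
  finally show ?thesis by simp
qed

lemma tail_summable:
  assumes b: "0 < \<beta>" shows "summable (\<lambda>n. std_normal_tail (\<beta> * real n))"
proof -
  have "summable (\<lambda>n. std_normal_tail (\<beta> * real (2 + 1 + n)))"
    by (rule summableI_nonneg_bounded[OF std_normal_tail_nonneg sum_tail_shift_le[OF b]]) simp
  then have "summable (\<lambda>n. std_normal_tail (\<beta> * real (n + 3)))" by (simp add: add.commute)
  then show ?thesis using summable_iff_shift[of "\<lambda>n. std_normal_tail (\<beta> * real n)" 3] by simp
qed

lemma AE_eventually_below:
  assumes b: "0 < \<beta>" and f: "\<And>n. \<bar>f n\<bar> = int n"
  shows "AE \<omega> in M. \<exists>m. \<forall>n\<ge>m. X (f n) \<omega> \<le> \<beta> * real n"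
proof -
  have "AE \<omega> in M. eventually (\<lambda>n. \<omega> \<in> space M - {\<omega> \<in> space M. \<beta> * real n < X (f n) \<omega>}) sequentially"
    by (rule borel_cantelli_AE1) (auto simp: prob_X_gt tail_summable[OF b] emeasure_eq_measure)
  then show ?thesis by eventually_elim (auto simp: eventually_sequentially not_less)
qed

lemma AE_exists_above:
  assumes b: "0 < \<beta>"
  shows "AE \<omega> in M. \<exists>i. - \<beta> * real_of_int i < X i \<omega>"
proof -
  let ?A = "{\<omega> \<in> space M. \<forall>i. X i \<omega> \<le> - \<beta> * real_of_int i}"
  interpret N: real_distribution std_normal_distribution by (rule real_dist_normal_dist)
  have [measurable]: "?A \<in> sets M" by measurable
  have le: "prob ?A \<le> cdf std_normal_distribution (- \<beta> * real n)" for n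
  proof -
    have "prob ?A \<le> prob {\<omega> \<in> space M. X (int n) \<omega> \<le> - \<beta> * real n}"
      by (intro finite_measure_mono) (auto dest: spec[of _ "int n"])
    also have "\<dots> = measure (distr M borel (X (int n))) {..- \<beta> * real n}"
      by (subst measure_distr) (auto intro!: arg_cong[where f = prob])
    finally show ?thesis unfolding X_rv(2) cdf_def .
  qed
  have "filterlim (\<lambda>n. - \<beta> * real n) at_bot sequentially" using b by real_asymp
  then have "(\<lambda>n. cdf std_normal_distribution (- \<beta> * real n)) \<longlonglongrightarrow> 0"
    by (rule filterlim_compose[OF N.cdf_lim_at_bot])
  then have "prob ?A \<le> 0" by (rule LIMSEQ_le_const) (use le in auto)
  then have "prob ?A = 0" using measure_nonneg[of M ?A] by linarith
  then have "AE \<omega> in M. \<omega> \<notin> ?A" by (subst (asm) prob_eq_0) auto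
  then show ?thesis using AE_space by eventually_elim (auto simp: not_le)
qed

end

text \<open>
If no least element exists, the definite description is the same unspecified value for
every predicate. This makes the events below measurable even off the almost sure event on which the minimum
exists.
\<close>

lemma Least_cases_iff:
  fixes P Q :: "'a::order \<Rightarrow> bool"
  shows "Q (LEAST i. P i) \<longleftrightarrow> (\<exists>i. (P i \<and> (\<forall>j. P j \<longrightarrow> i \<le> j)) \<and> Q i) \<or>
     (\<not> (\<exists>i. P i \<and> (\<forall>j. P j \<longrightarrow> i \<le> j)) \<and> Q (THE i. False))"
proof (cases "\<exists>i. P i \<and> (\<forall>j. P j \<longrightarrow> i \<le> j)")
  case True
  then obtain i where i: "P i" "\<forall>j. P j \<longrightarrow> i \<le> j" by blast
  then have "(LEAST i. P i) = i" by (intro Least_equality) auto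
  moreover have "k = i" if "P k" "\<forall>j. P j \<longrightarrow> k \<le> j" for k
    using i that by (meson order_antisym)
  ultimately show ?thesis using i True by metis
next
  case False
  then have "(\<lambda>i. P i \<and> (\<forall>j. P j \<longrightarrow> i \<le> j)) = (\<lambda>i. False)" by (simp add: fun_eq_iff)
  then have "(LEAST i. P i) = (THE i. False)" unfolding Least_def by (rule arg_cong)
  then show ?thesis using False by auto
qed

lemma Greatest_cases_iff:
  fixes P Q :: "'a::order \<Rightarrow> bool"
  shows "Q (GREATEST i. P i) \<longleftrightarrow> (\<exists>i. (P i \<and> (\<forall>j. P j \<longrightarrow> j \<le> i)) \<and> Q i) \<or>
     (\<not> (\<exists>i. P i \<and> (\<forall>j. P j \<longrightarrow> j \<le> i)) \<and> Q (THE i. False))"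
proof (cases "\<exists>i. P i \<and> (\<forall>j. P j \<longrightarrow> j \<le> i)")
  case True
  then obtain i where i: "P i" "\<forall>j. P j \<longrightarrow> j \<le> i" by blast
  then have "(GREATEST i. P i) = i" by (intro Greatest_equality) auto
  moreover have "k = i" if "P k" "\<forall>j. P j \<longrightarrow> j \<le> k" for k
    using i that by (meson order_antisym)
  ultimately show ?thesis using i True by metis
next
  case False
  then have "(\<lambda>i. P i \<and> (\<forall>j. P j \<longrightarrow> j \<le> i)) = (\<lambda>i. False)" by (simp add: fun_eq_iff)
  then have "(GREATEST i. P i) = (THE i. False)" unfolding Greatest_def by (rule arg_cong)
  then show ?thesis using False by auto
qed

lemma Upsilon_iff:
  "real_of_int (Upsilon \<beta> x) \<ge> - U \<longleftrightarrow>
     (\<exists>i. (x i > - \<beta> * real_of_int i \<and> (\<forall>j. x j > - \<beta> * real_of_int j \<longrightarrow> i \<le> j)) \<and> real_of_int i \<ge> - U) \<or>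
     (\<not> (\<exists>i. x i > - \<beta> * real_of_int i \<and> (\<forall>j. x j > - \<beta> * real_of_int j \<longrightarrow> i \<le> j)) \<and>
       real_of_int (THE i. False) \<ge> - U)"
  unfolding Upsilon_def by (rule Least_cases_iff[where Q = "\<lambda>i. real_of_int i \<ge> - U"])

lemma tau_iff:
  "real_of_int (tau \<beta> x) \<le> V \<longleftrightarrow>
    (if \<exists>i\<ge>0. x i > \<beta> * real_of_int i then
     (\<exists>i. ((i \<ge> 0 \<and> x i > \<beta> * real_of_int i) \<and> (\<forall>j. j \<ge> 0 \<and> x j > \<beta> * real_of_int j \<longrightarrow> j \<le> i)) \<and> real_of_int i \<le> V) \<or>
     (\<not> (\<exists>i. (i \<ge> 0 \<and> x i > \<beta> * real_of_int i) \<and> (\<forall>j. j \<ge> 0 \<and> x j > \<beta> * real_of_int j \<longrightarrow> j \<le> i)) \<and>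
       real_of_int (THE i. False) \<le> V) else 0 \<le> V)"
proof (cases "\<exists>i\<ge>0. x i > \<beta> * real_of_int i")
  case False
  show ?thesis unfolding tau_def if_not_P[OF False] by simp
next
  case True
  show ?thesis unfolding tau_def if_P[OF True]
    by (rule Greatest_cases_iff[where Q = "\<lambda>i. real_of_int i \<le> V"])
qed

lemma int_has_least:
  fixes P :: "int \<Rightarrow> bool"
  assumes "P i0" "\<And>i. P i \<Longrightarrow> m \<le> i"
  obtains i where "P i" "\<And>j. P j \<Longrightarrow> i \<le> j"
proof -
  obtain n where n: "P (m + int n)" using assms(1) assms(2)[OF assms(1)] by (metis add_diff_cancel_left' diff_add_cancel nonneg_int_cases diff_ge_0_iff_ge add.commute)
  define l where "l = (LEAST n. P (m + int n))"
  have l: "P (m + int l)" unfolding l_def by (rule LeastI[of "\<lambda>n. P (m + int n)", OF n])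
  show thesis
  proof
    show "P (m + int l)" by (rule l)
    fix j assume j: "P j"
    then have "P (m + int (nat (j - m)))" using assms(2)[OF j] by simp
    then have "l \<le> nat (j - m)" unfolding l_def by (rule Least_le)
    then show "m + int l \<le> j" using assms(2)[OF j] by linarith
  qed
qed

lemma Upsilon_ge_iff:
  assumes ex: "\<exists>i. x i > - \<beta> * real_of_int i" and bd: "\<And>n. m \<le> n \<Longrightarrow> x (- int n) \<le> \<beta> * real n"
  shows "real_of_int (Upsilon \<beta> x) \<ge> - U \<longleftrightarrow> (\<forall>i. real_of_int i < - U \<longrightarrow> x i \<le> - \<beta> * real_of_int i)"
proof -
  obtain i0 where i0: "x i0 > - \<beta> * real_of_int i0" using ex by blast
  have "- int m \<le> i" if i: "x i > - \<beta> * real_of_int i" for i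
  proof (rule ccontr)
    assume "\<not> - int m \<le> i"
    then have "m \<le> nat (- i)" "i = - int (nat (- i))" by linarith+
    then have "x i \<le> \<beta> * real (nat (- i))" using bd by metis
    then show False using i \<open>\<not> - int m \<le> i\<close> by simp
  qed
  then obtain i where i: "x i > - \<beta> * real_of_int i" "\<And>j. x j > - \<beta> * real_of_int j \<Longrightarrow> i \<le> j"
    using int_has_least[of "\<lambda>i. x i > - \<beta> * real_of_int i", OF i0] by blast
  have U: "Upsilon \<beta> x = i" unfolding Upsilon_def using i by (intro Least_equality) auto
  show ?thesis unfolding U
  proof
    assume "- U \<le> real_of_int i"
    then show "\<forall>k. real_of_int k < - U \<longrightarrow> x k \<le> - \<beta> * real_of_int k"
      using i(2) by (meson not_le of_int_le_iff order_trans)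
  next
    assume "\<forall>k. real_of_int k < - U \<longrightarrow> x k \<le> - \<beta> * real_of_int k"
    then show "- U \<le> real_of_int i" using i(1) by (meson not_le)
  qed
qed

lemma tau_le_iff:
  assumes bd: "\<And>n. m \<le> n \<Longrightarrow> x (int n) \<le> \<beta> * real n" and V: "0 \<le> V"
  shows "real_of_int (tau \<beta> x) \<le> V \<longleftrightarrow> (\<forall>i. V < real_of_int i \<longrightarrow> x i \<le> \<beta> * real_of_int i)"
proof (cases "\<exists>i\<ge>0. x i > \<beta> * real_of_int i")
  case False
  have "i \<ge> 0" if "V < real_of_int i" for i using that V by linarith
  then have "\<forall>i. V < real_of_int i \<longrightarrow> x i \<le> \<beta> * real_of_int i" using False by (meson not_le)
  moreover have "tau \<beta> x = 0" unfolding tau_def by (rule if_not_P[OF False])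
  ultimately show ?thesis using V by simp
next
  case True
  then obtain i0 where i0: "i0 \<ge> 0" "x i0 > \<beta> * real_of_int i0" by blast
  let ?P = "\<lambda>i. - i \<ge> 0 \<and> x (- i) > \<beta> * real_of_int (- i)"
  have "- int m \<le> i" if i: "?P i" for i
  proof (rule ccontr)
    assume "\<not> - int m \<le> i"
    then have "m \<le> nat (- i)" "- i = int (nat (- i))" by linarith+
    then have "x (- i) \<le> \<beta> * real (nat (- i))" using bd by metis
    then show False using i by simp
  qed
  moreover have "?P (- i0)" using i0 by simp
  ultimately obtain i where i: "?P i" "\<And>j. ?P j \<Longrightarrow> i \<le> j" using int_has_least[of ?P] by blast
  have g: "j \<le> - i" if "j \<ge> 0" "x j > \<beta> * real_of_int j" for j using i(2)[of "- j"] that by simp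
  have T: "tau \<beta> x = - i" unfolding tau_def using True i(1) g by (auto intro!: Greatest_equality)
  show ?thesis unfolding T
  proof
    assume a: "real_of_int (- i) \<le> V"
    show "\<forall>k. V < real_of_int k \<longrightarrow> x k \<le> \<beta> * real_of_int k"
    proof (intro allI impI)
      fix k assume k: "V < real_of_int k"
      then have "0 \<le> k" using V by linarith
      show "x k \<le> \<beta> * real_of_int k"
      proof (rule ccontr)
        assume "\<not> x k \<le> \<beta> * real_of_int k"
        then have "k \<le> - i" using g \<open>0 \<le> k\<close> by simp
        then have "real_of_int k \<le> real_of_int (- i)" by (simp only: of_int_le_iff)
        then show False using a k by linarith
      qed
    qed
  next
    assume "\<forall>k. V < real_of_int k \<longrightarrow> x k \<le> \<beta> * real_of_int k"
    then show "real_of_int (- i) \<le> V" using i(1) by (meson not_le)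
  qed
qed

context stationary_gaussian begin

text \<open>
Almost surely only finitely many indices violate X i \<le> \<beta> |i| (Borel-Cantelli), and some index satisfies
X i > -\<beta> i, so that minimum and maximum exist.
Nonnegativity of V also handles the value 0 of tau on the empty set.
\<close>

lemma prob_Upsilon_tau:
  assumes b: "0 < \<beta>" and UV: "0 \<le> U" "0 \<le> V"
  shows "\<P>(\<omega> in M. real_of_int (Upsilon \<beta> (\<lambda>i. X i \<omega>)) \<ge> - U \<and> real_of_int (tau \<beta> (\<lambda>i. X i \<omega>)) \<le> V) =
     \<P>(\<omega> in M. \<forall>i. real_of_int i < - U \<or> V < real_of_int i \<longrightarrow> X i \<omega> \<le> \<beta> * real_of_int \<bar>i\<bar>)"
proof (rule prob_eq_AE)
  show "{\<omega> \<in> space M. \<forall>i. real_of_int i < - U \<or> V < real_of_int i \<longrightarrow> X i \<omega> \<le> \<beta> * real_of_int \<bar>i\<bar>} \<in> events"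
    by measurable
  show "{\<omega> \<in> space M. real_of_int (Upsilon \<beta> (\<lambda>i. X i \<omega>)) \<ge> - U \<and> real_of_int (tau \<beta> (\<lambda>i. X i \<omega>)) \<le> V} \<in> events"
    unfolding Upsilon_iff tau_iff by measurable
  show "AE \<omega> in M. (real_of_int (Upsilon \<beta> (\<lambda>i. X i \<omega>)) \<ge> - U \<and> real_of_int (tau \<beta> (\<lambda>i. X i \<omega>)) \<le> V) \<longleftrightarrow>
     (\<forall>i. real_of_int i < - U \<or> V < real_of_int i \<longrightarrow> X i \<omega> \<le> \<beta> * real_of_int \<bar>i\<bar>)"
    using AE_eventually_below[OF b, of int, simplified] AE_eventually_below[OF b, of "\<lambda>n. - int n", simplified] AE_exists_above[OF b]
  proof eventually_elim
    case (elim \<omega>)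
    obtain m1 where m1: "\<And>n. m1 \<le> n \<Longrightarrow> X (int n) \<omega> \<le> \<beta> * real n" using elim(1) by blast
    obtain m2 where m2: "\<And>n. m2 \<le> n \<Longrightarrow> X (- int n) \<omega> \<le> \<beta> * real n" using elim(2) by blast
    have 1: "real_of_int (Upsilon \<beta> (\<lambda>i. X i \<omega>)) \<ge> - U \<longleftrightarrow>
        (\<forall>i. real_of_int i < - U \<longrightarrow> X i \<omega> \<le> - \<beta> * real_of_int i)"
      by (rule Upsilon_ge_iff[OF elim(3) m2])
    have 2: "real_of_int (tau \<beta> (\<lambda>i. X i \<omega>)) \<le> V \<longleftrightarrow> (\<forall>i. V < real_of_int i \<longrightarrow> X i \<omega> \<le> \<beta> * real_of_int i)"
      by (rule tau_le_iff[OF m1 UV(2)])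
    have 3: "- \<beta> * real_of_int i = \<beta> * real_of_int \<bar>i\<bar>" if "real_of_int i < - U" for i
    proof -
      have "i < 0" using that UV by linarith
      then show ?thesis by simp
    qed
    have 4: "\<beta> * real_of_int i = \<beta> * real_of_int \<bar>i\<bar>" if "V < real_of_int i" for i
    proof -
      have "0 < i" using that UV by linarith
      then show ?thesis by simp
    qed
    have 5: "(real_of_int i < - U \<longrightarrow> X i \<omega> \<le> - \<beta> * real_of_int i) \<longleftrightarrow>
        (real_of_int i < - U \<longrightarrow> X i \<omega> \<le> \<beta> * real_of_int \<bar>i\<bar>)" for i
      using 3[of i] by (cases "real_of_int i < - U") (simp_all only: simp_thms)
    have 6: "(V < real_of_int i \<longrightarrow> X i \<omega> \<le> \<beta> * real_of_int i) \<longleftrightarrow>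
        (V < real_of_int i \<longrightarrow> X i \<omega> \<le> \<beta> * real_of_int \<bar>i\<bar>)" for i
      using 4[of i] by (cases "V < real_of_int i") (simp_all only: simp_thms)
    show ?case unfolding 1 2 5 6 by blast
  qed
qed

text \<open>
Union bound over all indices beyond N, on both sides.
\<close>

lemma truncation_error:
  assumes b: "0 < \<beta>" and N: "1 < real N"
  shows "\<bar>\<P>(\<omega> in M. \<forall>i. real_of_int i < - U \<or> V < real_of_int i \<longrightarrow> X i \<omega> \<le> \<beta> * real_of_int \<bar>i\<bar>) -
     measure M {\<omega> \<in> space M. \<forall>i\<in>outer_indices U V N. X i \<omega> \<le> \<beta> * real_of_int \<bar>i\<bar>}\<bar>
     \<le> 2 * (tail_primitive (\<beta> * real N - \<beta>) / \<beta>)"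
proof -
  let ?E = "{\<omega> \<in> space M. \<forall>i. real_of_int i < - U \<or> V < real_of_int i \<longrightarrow> X i \<omega> \<le> \<beta> * real_of_int \<bar>i\<bar>}"
  let ?F = "{\<omega> \<in> space M. \<forall>i\<in>outer_indices U V N. X i \<omega> \<le> \<beta> * real_of_int \<bar>i\<bar>}"
  let ?v = "\<lambda>n. \<beta> * real (N + 1 + n)"
  let ?A = "\<lambda>n. {\<omega> \<in> space M. ?v n < X (int (N + 1 + n)) \<omega>} \<union> {\<omega> \<in> space M. ?v n < X (- int (N + 1 + n)) \<omega>}"
  have [measurable]: "?F \<in> sets M" using finite_outer_indices[of U V N] by measurable
  have E[measurable]: "?E \<in> sets M" by measurable
  have sub1: "?E \<subseteq> ?F" by (auto simp: outer_indices_def)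
  have sub2: "?F \<subseteq> ?E \<union> (\<Union>n. ?A n)"
  proof
    fix \<omega> assume w: "\<omega> \<in> ?F"
    show "\<omega> \<in> ?E \<union> (\<Union>n. ?A n)"
    proof (rule ccontr)
      assume c: "\<omega> \<notin> ?E \<union> (\<Union>n. ?A n)"
      then obtain i where i: "real_of_int i < - U \<or> V < real_of_int i" "\<beta> * real_of_int \<bar>i\<bar> < X i \<omega>"
        using w by (auto simp: not_le)
      have "\<not> \<bar>i\<bar> \<le> int N" using i w by (auto simp: outer_indices_def not_less[symmetric])
      then obtain n where n: "\<bar>i\<bar> = int (N + 1 + n)"
        by (metis add.commute int_nat_eq abs_ge_zero linorder_not_le nat_less_iff less_iff_Suc_add Suc_eq_plus1 add.assoc of_nat_less_iff)
      then have "real_of_int \<bar>i\<bar> = real (N + 1 + n)" by simp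
      moreover have "i = int (N + 1 + n) \<or> i = - int (N + 1 + n)" using n by linarith
      ultimately have "\<omega> \<in> ?A n" using i(2) w by auto
      then show False using c by blast
    qed
  qed
  have pA: "prob (?A n) \<le> 2 * std_normal_tail (?v n)" for n
  proof -
    have "prob (?A n) \<le> prob {\<omega> \<in> space M. ?v n < X (int (N + 1 + n)) \<omega>} + prob {\<omega> \<in> space M. ?v n < X (- int (N + 1 + n)) \<omega>}"
      by (rule measure_Un_le) auto
    then show ?thesis unfolding prob_X_gt by simp
  qed
  have s1: "summable (\<lambda>n. std_normal_tail (?v n))"
    by (rule summableI_nonneg_bounded[OF std_normal_tail_nonneg sum_tail_shift_le[OF b N]])
  then have s2: "summable (\<lambda>n. 2 * std_normal_tail (?v n))" by (rule summable_mult)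
  have s3: "summable (\<lambda>n. prob (?A n))"
    by (rule summable_comparison_test[OF _ s2]) (use pA in auto)
  have "prob (\<Union>n. ?A n) \<le> (\<Sum>n. prob (?A n))"
    by (rule finite_measure_subadditive_countably[OF _ s3]) auto
  also have "\<dots> \<le> (\<Sum>n. 2 * std_normal_tail (?v n))" by (rule suminf_le[OF pA s3 s2])
  also have "\<dots> = 2 * (\<Sum>n. std_normal_tail (?v n))" by (rule suminf_mult[OF s1])
  also have "\<dots> \<le> 2 * (tail_primitive (\<beta> * real N - \<beta>) / \<beta>)"
    by (intro mult_left_mono suminf_le_const[OF s1] sum_tail_shift_le[OF b N]) simp
  finally have U: "prob (\<Union>n. ?A n) \<le> 2 * (tail_primitive (\<beta> * real N - \<beta>) / \<beta>)" .
  have "prob ?F \<le> prob (?E \<union> (\<Union>n. ?A n))" by (intro finite_measure_mono sub2) auto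
  also have "\<dots> \<le> prob ?E + prob (\<Union>n. ?A n)" by (rule measure_Un_le) auto
  finally have "prob ?F \<le> prob ?E + prob (\<Union>n. ?A n)" .
  moreover have "prob ?E \<le> prob ?F" by (intro finite_measure_mono sub1) auto
  ultimately show ?thesis using U by linarith
qed

lemma truncation_error_tendsto_0:
  "((\<lambda>\<beta>. 2 * (tail_primitive (\<beta> * real (truncation \<beta>) - \<beta>) / \<beta>)) \<longlongrightarrow> 0) (at_right 0)"
proof (rule tendsto_sandwich[OF _ _ tendsto_const])
  show "((\<lambda>\<beta>::real. 2 * (exp (- ((ln (1 / \<beta>))\<^sup>2 - 2)\<^sup>2 / 2) / \<beta>)) \<longlongrightarrow> 0) (at_right 0)" by real_asymp
  show "eventually (\<lambda>\<beta>. 0 \<le> 2 * (tail_primitive (\<beta> * real (truncation \<beta>) - \<beta>) / \<beta>)) (at_right 0)"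
    using eventually_small[OF zero_less_one] by eventually_elim (simp add: tail_primitive_nonneg)
  have "eventually (\<lambda>\<beta>::real. 1 \<le> (ln (1 / \<beta>))\<^sup>2 - 2) (at_right 0)" by real_asymp
  then show "eventually (\<lambda>\<beta>. 2 * (tail_primitive (\<beta> * real (truncation \<beta>) - \<beta>) / \<beta>) \<le>
     2 * (exp (- ((ln (1 / \<beta>))\<^sup>2 - 2)\<^sup>2 / 2) / \<beta>)) (at_right 0)"
    using eventually_small[OF zero_less_one]
  proof eventually_elim
    case (elim \<beta>)
    define v where "v = (ln (1 / \<beta>))\<^sup>2 - 2"
    have v: "1 \<le> v" using elim unfolding v_def by blast
    have "v \<le> \<beta> * real (truncation \<beta>) - \<beta>"
      using truncation_bounds(1)[of \<beta>] elim unfolding v_def by (simp add: algebra_simps)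
    then have "tail_primitive (\<beta> * real (truncation \<beta>) - \<beta>) \<le> tail_primitive v"
      using v by (intro tail_primitive_antimono) auto
    also have "\<dots> \<le> exp (- v\<^sup>2 / 2) / 1"
      unfolding tail_primitive_def
    proof (rule frac_le)
      have "1 \<le> sqrt (2 * pi)" using pi_gt3 by simp
      then have "1 / sqrt (2 * pi) \<le> 1" by simp
      then have "1 / sqrt (2 * pi) * exp (- v\<^sup>2 / 2) \<le> 1 * exp (- v\<^sup>2 / 2)" by (intro mult_right_mono) auto
      then show "std_normal_density v \<le> exp (- v\<^sup>2 / 2)" unfolding std_normal_density_def by simp
      show "1 \<le> v\<^sup>2" using v by (simp add: one_le_power)
    qed auto
    finally have "tail_primitive (\<beta> * real (truncation \<beta>) - \<beta>) \<le> exp (- v\<^sup>2 / 2)" by simp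
    then show ?case using elim unfolding v_def[symmetric] by (intro mult_left_mono divide_right_mono) auto
  qed
qed

text \<open>
Both parts of the corollary at once: \<gamma> = 0 is the weakly dependent case, in which \<rho> = 0 and the
comparison family is independent.
\<close>

theorem level_crossing_limit:
  assumes g: "0 \<le> \<gamma>" and lim: "(\<lambda>n. r n * ln (real n)) \<longlonglongrightarrow> \<gamma>"
    and s: "(s \<longlongrightarrow> s0) (at_right 0)" and t: "(t \<longlongrightarrow> t0) (at_right 0)"
  shows "((\<lambda>\<beta>. \<P>(\<omega> in M. real_of_int (Upsilon \<beta> (\<lambda>i. X i \<omega>)) \<ge> - level_index \<gamma> (s \<beta>) \<beta> \<and>
                   real_of_int (tau \<beta> (\<lambda>i. X i \<omega>)) \<le> level_index \<gamma> (t \<beta>) \<beta>)) \<longlongrightarrow>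
     (\<integral>z. exp (- (exp (- (s0 - sqrt (2 * \<gamma>) * z)) + exp (- (t0 - sqrt (2 * \<gamma>) * z)))) \<partial>std_normal_distribution)) (at_right 0)"
proof -
  obtain \<theta> where \<theta>: "0 < \<theta>" "\<theta> < 1" "\<And>n. n \<noteq> 0 \<Longrightarrow> \<bar>r n\<bar> \<le> \<theta>" by (rule r_uniformly_less_1[OF lim]) blast
  define U where "U \<beta> = level_index \<gamma> (s \<beta>) \<beta>" for \<beta>
  define V where "V \<beta> = level_index \<gamma> (t \<beta>) \<beta>" for \<beta>
  define J where "J \<beta> = outer_indices (U \<beta>) (V \<beta>) (truncation \<beta>)" for \<beta>
  define R where "R \<beta> k l = max \<bar>r (nat \<bar>k - l\<bar>)\<bar> (rho \<gamma> \<beta>)" for \<beta> and k l :: int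
  define S where "S \<beta> = (\<Sum>k\<in>J \<beta>. \<Sum>l\<in>J \<beta> - {k}. \<bar>r (nat \<bar>k - l\<bar>) - rho \<gamma> \<beta>\<bar> / (1 - R \<beta> k l) *
      exp (- (\<beta> * real_of_int \<bar>k\<bar> + \<beta> * real_of_int \<bar>l\<bar>)\<^sup>2 / (4 * (1 + R \<beta> k l))))" for \<beta>
  define P where "P \<beta> = \<P>(\<omega> in M. real_of_int (Upsilon \<beta> (\<lambda>i. X i \<omega>)) \<ge> - U \<beta> \<and> real_of_int (tau \<beta> (\<lambda>i. X i \<omega>)) \<le> V \<beta>)" for \<beta>
  define Q where "Q \<beta> = (\<integral>z. (\<Prod>i\<in>J \<beta>. 1 - std_normal_tail ((\<beta> * real_of_int \<bar>i\<bar> - sqrt (rho \<gamma> \<beta>) * z) / sqrt (1 - rho \<gamma> \<beta>)))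
      \<partial>std_normal_distribution)" for \<beta>
  have S0: "(S \<longlongrightarrow> 0) (at_right 0)"
    using comparison_sum_tendsto_0[OF g lim \<theta>(3,1,2) s t] unfolding S_def J_def R_def U_def V_def .
  have Q0: "(Q \<longlongrightarrow> (\<integral>z. exp (- (exp (- (s0 - sqrt (2 * \<gamma>) * z)) + exp (- (t0 - sqrt (2 * \<gamma>) * z)))) \<partial>std_normal_distribution)) (at_right 0)"
    using equicorrelated_limit[OF g s t] unfolding Q_def J_def U_def V_def .
  have trunc: "eventually (\<lambda>\<beta>. 1 < real (truncation \<beta>)) (at_right 0)"
  proof -
    have "eventually (\<lambda>\<beta>::real. 2 < (ln (1 / \<beta>))\<^sup>2 / \<beta>) (at_right 0)" by real_asymp
    then show ?thesis
    proof eventually_elim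
      case (elim \<beta>)
      then have "2 \<le> \<lfloor>(ln (1 / \<beta>))\<^sup>2 / \<beta>\<rfloor>" by (simp add: le_floor_iff)
      then have "2 \<le> truncation \<beta>" unfolding truncation_def by linarith
      then show ?case by linarith
    qed
  qed
  have "eventually (\<lambda>\<beta>. \<bar>P \<beta> - Q \<beta>\<bar> \<le> 2 * (tail_primitive (\<beta> * real (truncation \<beta>) - \<beta>) / \<beta>) + 16 * S \<beta>) (at_right 0)"
    using level_index_eventually_in_range[OF g s] level_index_eventually_in_range[OF g t] eventually_small[OF zero_less_one] trunc
      eventually_rho_less[OF \<theta>(1), of \<gamma>]
  proof eventually_elim
    case (elim \<beta>)
    have \<beta>: "0 < \<beta>" and UV: "0 \<le> U \<beta>" "0 \<le> V \<beta>" and N: "1 < real (truncation \<beta>)"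
      and \<rho>: "rho \<gamma> \<beta> < \<theta>" "0 \<le> rho \<gamma> \<beta>"
      using elim rho_nonneg[OF g] unfolding U_def V_def by auto
    let ?mX = "measure M {\<omega> \<in> space M. \<forall>i\<in>J \<beta>. X i \<omega> \<le> \<beta> * real_of_int \<bar>i\<bar>}"
    have finJ: "finite (J \<beta>)" unfolding J_def by (rule finite_outer_indices)
    have 1: "\<bar>P \<beta> - ?mX\<bar> \<le> 2 * (tail_primitive (\<beta> * real (truncation \<beta>) - \<beta>) / \<beta>)"
      unfolding P_def prob_Upsilon_tau[OF \<beta> UV] J_def by (rule truncation_error[OF \<beta> N])
    have r01: "0 \<le> rho \<gamma> \<beta>" "rho \<gamma> \<beta> \<le> 1" "rho \<gamma> \<beta> < 1" using \<rho> \<theta> by auto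
    note Y = gaussian_family_interpolate[OF gaussian_family_common[OF finJ] gaussian_family_iid[OF finJ] r01(1,2)]
    have "\<bar>?mX - measure (std_normal_distribution \<Otimes>\<^sub>M (\<Pi>\<^sub>M j\<in>J \<beta>. std_normal_distribution))
      {\<omega> \<in> space (std_normal_distribution \<Otimes>\<^sub>M (\<Pi>\<^sub>M j\<in>J \<beta>. std_normal_distribution)).
        \<forall>j\<in>J \<beta>. interpolate (rho \<gamma> \<beta>) (\<lambda>_ z. z) (\<lambda>j w. w j) j \<omega> \<le> \<beta> * real_of_int \<bar>j\<bar>}\<bar> \<le>
      16 * (\<Sum>k\<in>J \<beta>. \<Sum>l\<in>J \<beta> - {k}. \<bar>r (nat \<bar>k - l\<bar>) - (rho \<gamma> \<beta> * 1 + (1 - rho \<gamma> \<beta>) * (if k = l then 1 else 0))\<bar> / (1 - R \<beta> k l) *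
      exp (- (\<beta> * real_of_int \<bar>k\<bar> + \<beta> * real_of_int \<bar>l\<bar>)\<^sup>2 / (4 * (1 + R \<beta> k l))))"
    proof (rule normal_comparison[OF gaussian_family_X[OF finJ] Y])
      fix i j assume ij: "i \<in> J \<beta>" "j \<in> J \<beta>" "i \<noteq> j"
      then have "nat \<bar>i - j\<bar> \<noteq> 0" by simp
      from \<theta>(3)[OF this] show "\<bar>r (nat \<bar>i - j\<bar>)\<bar> \<le> R \<beta> i j \<and>
        \<bar>rho \<gamma> \<beta> * 1 + (1 - rho \<gamma> \<beta>) * (if i = j then 1 else 0)\<bar> \<le> R \<beta> i j \<and> R \<beta> i j < 1"
        unfolding R_def using ij \<rho> \<theta>(2) by auto
    next
      fix i assume "i \<in> J \<beta>"
      then have "i \<noteq> 0" unfolding J_def outer_indices_def using UV by auto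
      then show "0 < \<beta> * real_of_int \<bar>i\<bar>" using \<beta> by simp
    qed (auto simp: r_0 abs_minus_commute)
    also have "(\<Sum>k\<in>J \<beta>. \<Sum>l\<in>J \<beta> - {k}. \<bar>r (nat \<bar>k - l\<bar>) - (rho \<gamma> \<beta> * 1 + (1 - rho \<gamma> \<beta>) * (if k = l then 1 else 0))\<bar> / (1 - R \<beta> k l) *
      exp (- (\<beta> * real_of_int \<bar>k\<bar> + \<beta> * real_of_int \<bar>l\<bar>)\<^sup>2 / (4 * (1 + R \<beta> k l)))) = S \<beta>"
      unfolding S_def by (intro sum.cong refl) auto
    finally have "\<bar>?mX - Q \<beta>\<bar> \<le> 16 * S \<beta>" unfolding equicorrelated_prob[OF finJ r01(1,3)] Q_def .
    then show ?case using 1 by linarith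
  qed
  then have close: "eventually (\<lambda>\<beta>. norm (P \<beta> - Q \<beta>) \<le> 2 * (tail_primitive (\<beta> * real (truncation \<beta>) - \<beta>) / \<beta>) + 16 * S \<beta>) (at_right 0)"
    by simp
  have "((\<lambda>\<beta>. 2 * (tail_primitive (\<beta> * real (truncation \<beta>) - \<beta>) / \<beta>) + 16 * S \<beta>) \<longlongrightarrow> 0 + 16 * 0) (at_right 0)"
    by (intro tendsto_add truncation_error_tendsto_0 tendsto_mult tendsto_const S0)
  then have "((\<lambda>\<beta>. 2 * (tail_primitive (\<beta> * real (truncation \<beta>) - \<beta>) / \<beta>) + 16 * S \<beta>) \<longlongrightarrow> 0) (at_right 0)" by simp
  from Lim_null_comparison[OF close this] have "((\<lambda>\<beta>. P \<beta> - Q \<beta>) \<longlongrightarrow> 0) (at_right 0)" .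
  from tendsto_add[OF this Q0] show ?thesis unfolding P_def U_def V_def by simp
qed

end

theorem corollary2p1:
  fixes M :: "'a measure" and X :: "int \<Rightarrow> 'a \<Rightarrow> real"
  assumes "prob_space M"
    and "standard_stationary_gaussian M X"
  shows
    "((\<lambda>n. covariance_seq M X n * ln (real n)) \<longlonglongrightarrow> 0 \<longrightarrow>
        (\<forall>x y :: real.
          ((\<lambda>\<beta>. \<P>(\<omega> in M. real_of_int (Upsilon \<beta> (\<lambda>i. X i \<omega>)) \<ge> - u_weak \<beta> x \<and>
                           real_of_int (tau \<beta> (\<lambda>i. X i \<omega>)) \<le> u_weak \<beta> y))
            \<longlongrightarrow> exp (- (exp (- x) + exp (- y)))) (at_right 0))) \<and>
     (\<forall>\<gamma> > 0. (\<lambda>n. covariance_seq M X n * ln (real n)) \<longlonglongrightarrow> \<gamma> \<longrightarrow>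
        (\<forall>x y :: real.
          ((\<lambda>\<beta>. \<P>(\<omega> in M. real_of_int (Upsilon \<beta> (\<lambda>i. X i \<omega>)) \<ge> - u_strong \<gamma> \<beta> x \<and>
                           real_of_int (tau \<beta> (\<lambda>i. X i \<omega>)) \<le> u_strong \<gamma> \<beta> y))
            \<longlongrightarrow> (\<integral>z. exp (- (exp (- sqrt (2 * \<gamma>) * (x - z)) + exp (- sqrt (2 * \<gamma>) * (y - z))))
                  \<partial>std_normal_distribution)) (at_right 0)))"
proof (intro conjI impI allI)
  interpret stationary_gaussian M X using assms by (simp add: stationary_gaussian_def stationary_gaussian_axioms_def)
  interpret N: prob_space std_normal_distribution by (rule prob_space_std_normal)
  {
    fix x y :: real
    assume lim: "(\<lambda>n. covariance_seq M X n * ln (real n)) \<longlonglongrightarrow> 0"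
    have u: "level_index 0 x \<beta> = u_weak \<beta> x" for x \<beta>
      by (simp add: level_index_def step_size_def rho_def u_weak_def)
    show "((\<lambda>\<beta>. \<P>(\<omega> in M. real_of_int (Upsilon \<beta> (\<lambda>i. X i \<omega>)) \<ge> - u_weak \<beta> x \<and>
                           real_of_int (tau \<beta> (\<lambda>i. X i \<omega>)) \<le> u_weak \<beta> y))
            \<longlongrightarrow> exp (- (exp (- x) + exp (- y)))) (at_right 0)"
      using level_crossing_limit[OF order_refl lim tendsto_const[of x] tendsto_const[of y]]
      unfolding u using N.prob_space by simp
  next
    fix \<gamma> x y :: real
    assume \<gamma>: "0 < \<gamma>" and lim: "(\<lambda>n. covariance_seq M X n * ln (real n)) \<longlonglongrightarrow> \<gamma>"
    have g: "0 \<le> \<gamma>" using \<gamma> by simp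
    define c where "c \<beta> = sqrt (rho \<gamma> \<beta>) / sqrt (1 - rho \<gamma> \<beta>) * a_norm (step_size \<gamma> \<beta>)" for \<beta>
    have c: "((\<lambda>\<beta>. c \<beta> * x) \<longlongrightarrow> sqrt (2 * \<gamma>) * x) (at_right 0)" for x
      unfolding c_def by (intro tendsto_mult sqrt_rho_a_norm_tendsto[OF g] tendsto_const)
    have "eventually (\<lambda>\<beta>. 0 < a_norm (step_size \<gamma> \<beta>)) (at_right 0)"
      using a_norm_step_at_top[OF g] by (simp add: filterlim_at_top_dense)
    then have u: "eventually (\<lambda>\<beta>. \<forall>x. level_index \<gamma> (c \<beta> * x) \<beta> = u_strong \<gamma> \<beta> x) (at_right 0)"
      using eventually_rho_less[OF zero_less_one, of \<gamma>]
    proof eventually_elim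
      case (elim \<beta>)
      define q where "q = sqrt (1 - rho \<gamma> \<beta>)"
      define a where "a = a_norm (step_size \<gamma> \<beta>)"
      have qa: "q \<noteq> 0" "a \<noteq> 0" using elim by (auto simp: q_def a_def)
      have "q * (a + sqrt (rho \<gamma> \<beta>) / q * a * x / a) / \<beta> = (q * a + sqrt (rho \<gamma> \<beta>) * x) * (1 / \<beta>)" for x
        using qa by (simp add: distrib_left)
      then show ?case
        unfolding level_index_def u_strong_def c_def step_size_def[symmetric] q_def[symmetric] a_def[symmetric]
        unfolding q_def a_def step_size_def by blast
    qed
    have eq: "sqrt (2 * \<gamma>) * x - sqrt (2 * \<gamma>) * z = sqrt (2 * \<gamma>) * (x - z)" for x z
      by (simp add: right_diff_distrib)
    have "((\<lambda>\<beta>. \<P>(\<omega> in M. real_of_int (Upsilon \<beta> (\<lambda>i. X i \<omega>)) \<ge> - level_index \<gamma> (c \<beta> * x) \<beta> \<and>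
                   real_of_int (tau \<beta> (\<lambda>i. X i \<omega>)) \<le> level_index \<gamma> (c \<beta> * y) \<beta>)) \<longlongrightarrow>
      (\<integral>z. exp (- (exp (- sqrt (2 * \<gamma>) * (x - z)) + exp (- sqrt (2 * \<gamma>) * (y - z)))) \<partial>std_normal_distribution)) (at_right 0)"
      using level_crossing_limit[OF g lim c[of x] c[of y]] unfolding eq by simp
    then show "((\<lambda>\<beta>. \<P>(\<omega> in M. real_of_int (Upsilon \<beta> (\<lambda>i. X i \<omega>)) \<ge> - u_strong \<gamma> \<beta> x \<and>
                           real_of_int (tau \<beta> (\<lambda>i. X i \<omega>)) \<le> u_strong \<gamma> \<beta> y))
            \<longlongrightarrow> (\<integral>z. exp (- (exp (- sqrt (2 * \<gamma>) * (x - z)) + exp (- sqrt (2 * \<gamma>) * (y - z))))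
                  \<partial>std_normal_distribution)) (at_right 0)"
      by (rule Lim_transform_eventually) (use u in eventually_elim, simp)
  }
qed

end
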